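(* Let $M$ be a von Neumann algebra and let $E$ be a faithful normal conditional expectation defined on $M$, with $N=E(M)$. Then the Weyl group $W(E)=\pi_0(\mathcal N_E)\simeq\mathcal N_E/\mathcal H_E$ obtained by the unitary construction and the Weyl group $W_1(E)=\pi_0(I_E)\simeq I_E/\mathcal Z_E$ obtained by the invertible construction are isomorphic.
   Context: $\mathcal U_A$ and $G_A$ denote the unitary group and the group of invertible elements of a von Neumann algebra $A$, with the norm topology. For $g\in G_M$, $L_g(E)=gE(g^{-1}\cdot g)g^{-1}$, i.e. $L_g(E)(x)=gE(g^{-1}xg)g^{-1}$. The centralizer of $E$ is the von Neumann algebra $M_E=\{x\in N'\cap M: E(xm)=E(mx)\ \forall m\in M\}$. $\mathcal N_E=\{u\in\mathcal U_M:L_u(E)=E\}$ and $I_E=\{g\in G_M:L_g(E)=E\}$. $\mathcal H_E=\mathcal U_N\cdot\mathcal U_{M_E}$ is the connected component of $1$ in $\mathcal N_E$ (an open, closed, normal subgroup), and $\mathcal Z_E=G_{M_E}\cdot G_N$ is the connected component of $1$ in $I_E$ (an open, closed, normal subgroup). $W(E)$ and $W_1(E)$ are the corresponding discrete quotient groups of connected components. *)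

theory Defs
  imports "HOL-Analysis.Analysis" "HOL-Algebra.Coset"
begin

section \<open>Complex Hilbert spaces\<close>

class complex_vector = real_vector +
  fixes scaleC :: "complex \<Rightarrow> 'a \<Rightarrow> 'a"  (infixr \<open>*\<^sub>C\<close> 75)
  assumes scaleC_add_right: "c *\<^sub>C (x + y) = c *\<^sub>C x + c *\<^sub>C y"
    and scaleC_add_left: "(c + d) *\<^sub>C x = c *\<^sub>C x + d *\<^sub>C x"
    and scaleC_scaleC: "c *\<^sub>C d *\<^sub>C x = (c * d) *\<^sub>C x"
    and scaleC_one: "1 *\<^sub>C x = x"
    and scaleR_scaleC: "r *\<^sub>R x = complex_of_real r *\<^sub>C x"

class complex_normed_vector = complex_vector + real_normed_vector +
  assumes norm_scaleC: "norm (c *\<^sub>C x) = cmod c * norm x"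

text \<open>The inner product is linear in the second argument. Its positivity and definiteness follow
  from \<^verbatim>\<open>norm_eq_sqrt_cinner\<close>.\<close>

class chilbert_space = complex_normed_vector + complete_space +
  fixes cinner :: "'a \<Rightarrow> 'a \<Rightarrow> complex"
  assumes cinner_commute: "cinner x y = cnj (cinner y x)"
    and cinner_add_right: "cinner x (y + z) = cinner x y + cinner x z"
    and cinner_scaleC_right: "cinner x (c *\<^sub>C y) = c * cinner x y"
    and norm_eq_sqrt_cinner: "norm x = sqrt (Re (cinner x x))"

lemma bounded_linear_scaleC: "bounded_linear (\<lambda>x::'a::complex_normed_vector. c *\<^sub>C x)"
  by (rule bounded_linear_intro[where K = "cmod c"])
    (simp_all add: scaleC_add_right scaleR_scaleC scaleC_scaleC norm_scaleC mult.commute)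

instantiation blinfun :: (real_normed_vector, complex_normed_vector) complex_normed_vector
begin

lift_definition scaleC_blinfun :: "complex \<Rightarrow> ('a \<Rightarrow>\<^sub>L 'b) \<Rightarrow> 'a \<Rightarrow>\<^sub>L 'b"
  is "\<lambda>c f x. c *\<^sub>C f x"
  by (rule bounded_linear_compose[OF bounded_linear_scaleC])

instance
proof
  fix c d :: complex and r :: real and a b :: "'a \<Rightarrow>\<^sub>L 'b"
  show "c *\<^sub>C (a + b) = c *\<^sub>C a + c *\<^sub>C b" by transfer (simp add: scaleC_add_right)
  show "(c + d) *\<^sub>C a = c *\<^sub>C a + d *\<^sub>C a" by transfer (simp add: scaleC_add_left)
  show "c *\<^sub>C d *\<^sub>C a = (c * d) *\<^sub>C a" by transfer (simp add: scaleC_scaleC)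
  show "1 *\<^sub>C a = a" by transfer (simp add: scaleC_one)
  show "r *\<^sub>R a = complex_of_real r *\<^sub>C a" by transfer (simp add: scaleR_scaleC)
  show "norm (c *\<^sub>C a) = cmod c * norm a"
  proof (rule antisym)
    have le: "norm (d *\<^sub>C b) \<le> cmod d * norm b" for d and b :: "'a \<Rightarrow>\<^sub>L 'b"
      by (rule norm_blinfun_bound)
        (simp_all add: scaleC_blinfun.rep_eq norm_scaleC mult.assoc mult_left_mono norm_blinfun)
    then show "norm (c *\<^sub>C a) \<le> cmod c * norm a" .
    show "cmod c * norm a \<le> norm (c *\<^sub>C a)"
    proof (cases "c = 0")
      case False
      have "inverse c *\<^sub>C c *\<^sub>C a = a"
        using False by transfer (simp add: scaleC_scaleC scaleC_one)
      with le[of "inverse c" "c *\<^sub>C a"] False show ?thesis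
        by (simp add: norm_inverse norm_divide field_simps)
    qed simp
  qed
qed

end

section \<open>Von Neumann algebras of operators\<close>

text \<open>The type \<^typ>\<open>'h \<Rightarrow>\<^sub>L 'h\<close> consists of the real-linear bounded operators, so complex linearity
  has to be imposed. Its topology is the norm topology.\<close>

type_synonym 'h op = "'h \<Rightarrow>\<^sub>L 'h"

definition bounded_ops :: "'h::chilbert_space op set" where
  "bounded_ops = {a :: 'h op. \<forall>c x. a (c *\<^sub>C x) = c *\<^sub>C a x}"

definition adj :: "'h::chilbert_space op \<Rightarrow> 'h op" where
  "adj a = (THE b :: 'h op. \<forall>x y. cinner (a x) y = cinner x (b y))"

definition commutant :: "'h::chilbert_space op set \<Rightarrow> 'h op set" where
  "commutant A = {x \<in> bounded_ops. \<forall>a\<in>A. x o\<^sub>L a = a o\<^sub>L x}"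

text \<open>A commutant is automatically a unital subalgebra, so the closure conditions other than the
  one for adjoints are consequences of the bicommutant condition.\<close>

definition von_neumann_algebra :: "'h::chilbert_space op set \<Rightarrow> bool" where
  "von_neumann_algebra M \<longleftrightarrow>
     M \<subseteq> bounded_ops \<and> (\<forall>a\<in>M. adj a \<in> M) \<and> commutant (commutant M) = M"

definition op_le :: "'h::chilbert_space op \<Rightarrow> 'h op \<Rightarrow> bool" where
  "op_le a b \<longleftrightarrow> (\<forall>x. Im (cinner x ((b - a) x)) = 0 \<and> 0 \<le> Re (cinner x ((b - a) x)))"

definition selfadjoint_part :: "'h::chilbert_space op set \<Rightarrow> 'h op set" where
  "selfadjoint_part A = {a \<in> A. adj a = a}"

definition op_lub :: "'h::chilbert_space op set \<Rightarrow> 'h op set \<Rightarrow> 'h op \<Rightarrow> bool" where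
  "op_lub A D s \<longleftrightarrow> s \<in> selfadjoint_part A \<and> (\<forall>d\<in>D. op_le d s) \<and>
     (\<forall>t\<in>selfadjoint_part A. (\<forall>d\<in>D. op_le d t) \<longrightarrow> op_le s t)"

section \<open>Conditional expectations\<close>

text \<open>Only the restriction of \<^verbatim>\<open>E\<close> to \<^verbatim>\<open>M\<close> is relevant, here and below.\<close>

definition conditional_expectation ::
  "'h::chilbert_space op set \<Rightarrow> 'h op set \<Rightarrow> ('h op \<Rightarrow> 'h op) \<Rightarrow> bool" where
  "conditional_expectation M N E \<longleftrightarrow>
     von_neumann_algebra N \<and> N \<subseteq> M \<and> E ` M = N \<and>
     (\<forall>x\<in>M. \<forall>y\<in>M. E (x + y) = E x + E y) \<and>
     (\<forall>c. \<forall>x\<in>M. E (c *\<^sub>C x) = c *\<^sub>C E x) \<and>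
     (\<forall>x\<in>M. op_le 0 x \<longrightarrow> op_le 0 (E x)) \<and>
     (\<forall>n\<in>N. E n = n) \<and>
     (\<forall>m\<in>N. \<forall>n\<in>N. \<forall>x\<in>M. E (m o\<^sub>L x o\<^sub>L n) = m o\<^sub>L E x o\<^sub>L n)"

definition faithful_on :: "'h::chilbert_space op set \<Rightarrow> ('h op \<Rightarrow> 'h op) \<Rightarrow> bool" where
  "faithful_on M E \<longleftrightarrow> (\<forall>x\<in>M. E (adj x o\<^sub>L x) = 0 \<longrightarrow> x = 0)"

text \<open>Normality is preservation of suprema of bounded increasing nets of self-adjoint elements;
  the range of such a net is an upward directed set, and conversely.\<close>

definition normal_map ::
  "'h::chilbert_space op set \<Rightarrow> 'h op set \<Rightarrow> ('h op \<Rightarrow> 'h op) \<Rightarrow> bool" where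
  "normal_map M N E \<longleftrightarrow>
     (\<forall>D s. D \<noteq> {} \<and> D \<subseteq> selfadjoint_part M \<and>
        (\<forall>a\<in>D. \<forall>b\<in>D. \<exists>c\<in>D. op_le a c \<and> op_le b c) \<and> op_lub M D s
        \<longrightarrow> op_lub N (E ` D) (E s))"

section \<open>The two normalizers and their Weyl groups\<close>

definition op_monoid :: "'h::chilbert_space op set \<Rightarrow> 'h op monoid" where
  "op_monoid S = \<lparr>carrier = S, mult = (o\<^sub>L), one = id_blinfun\<rparr>"

definition invertibles :: "'h::chilbert_space op set \<Rightarrow> 'h op set" where
  "invertibles A = Units (op_monoid A)"

definition unitaries :: "'h::chilbert_space op set \<Rightarrow> 'h op set" where
  "unitaries A = {u \<in> A. adj u o\<^sub>L u = id_blinfun \<and> u o\<^sub>L adj u = id_blinfun}"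

definition expectation_action ::
  "'h::chilbert_space op set \<Rightarrow> 'h op \<Rightarrow> ('h op \<Rightarrow> 'h op) \<Rightarrow> 'h op \<Rightarrow> 'h op" where
  "expectation_action M g E x =
     (let h = inv\<^bsub>op_monoid M\<^esub> g in g o\<^sub>L E (h o\<^sub>L x o\<^sub>L g) o\<^sub>L h)"

definition centralizer_exp ::
  "'h::chilbert_space op set \<Rightarrow> 'h op set \<Rightarrow> ('h op \<Rightarrow> 'h op) \<Rightarrow> 'h op set" where
  "centralizer_exp M N E = {x \<in> commutant N \<inter> M. \<forall>m\<in>M. E (x o\<^sub>L m) = E (m o\<^sub>L x)}"

definition unitary_normalizer ::
  "'h::chilbert_space op set \<Rightarrow> ('h op \<Rightarrow> 'h op) \<Rightarrow> 'h op set" where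
  "unitary_normalizer M E = {u \<in> unitaries M. \<forall>x\<in>M. expectation_action M u E x = E x}"

definition invertible_normalizer ::
  "'h::chilbert_space op set \<Rightarrow> ('h op \<Rightarrow> 'h op) \<Rightarrow> 'h op set" where
  "invertible_normalizer M E = {g \<in> invertibles M. \<forall>x\<in>M. expectation_action M g E x = E x}"

definition H_sub ::
  "'h::chilbert_space op set \<Rightarrow> 'h op set \<Rightarrow> ('h op \<Rightarrow> 'h op) \<Rightarrow> 'h op set" where
  "H_sub M N E = unitaries N <#>\<^bsub>op_monoid M\<^esub> unitaries (centralizer_exp M N E)"

definition Z_sub ::
  "'h::chilbert_space op set \<Rightarrow> 'h op set \<Rightarrow> ('h op \<Rightarrow> 'h op) \<Rightarrow> 'h op set" where
  "Z_sub M N E = invertibles (centralizer_exp M N E) <#>\<^bsub>op_monoid M\<^esub> invertibles N"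

text \<open>The group of connected components, with the product \<^verbatim>\<open>[a][b] = [ab]\<close>. In a topological group
  the component of \<^verbatim>\<open>ab\<close> does not depend on the representatives, so the union below is a single
  component.\<close>

definition pi0 :: "('a::topological_space, 'b) monoid_scheme \<Rightarrow> 'a set monoid" where
  "pi0 G = \<lparr>carrier = components (carrier G),
     mult = (\<lambda>A B. \<Union>a\<in>A. \<Union>b\<in>B. connected_component_set (carrier G) (a \<otimes>\<^bsub>G\<^esub> b)),
     one = connected_component_set (carrier G) \<one>\<^bsub>G\<^esub>\<rparr>"

definition weyl_group ::
  "'h::chilbert_space op set \<Rightarrow> ('h op \<Rightarrow> 'h op) \<Rightarrow> 'h op set monoid" where
  "weyl_group M E = pi0 (op_monoid (unitary_normalizer M E))"

definition weyl_group_inv ::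
  "'h::chilbert_space op set \<Rightarrow> ('h op \<Rightarrow> 'h op) \<Rightarrow> 'h op set monoid" where
  "weyl_group_inv M E = pi0 (op_monoid (invertible_normalizer M E))"

end

theory Submission
  imports Defs
begin

text \<open>If \<open>g\<close> normalizes \<open>E\<close> and \<open>E g\<close> is invertible, then \<open>g\<close> and \<open>E g\<close> induce the same automorphism of
  \<open>N\<close>, so \<open>g = z E(g)\<close> with \<open>z\<close> in the centralizer. This applies to \<open>g\<close> near 1, which makes \<open>Z\<^sub>E\<close> open, and to
  positive \<open>g\<close>. For a general normalizer \<open>g\<close> it applies to \<open>g\<^sup>*g\<close>, whose square root therefore lies in \<open>Z\<^sub>E\<close>, so that
  the unitary part of \<open>g\<close> represents the same class as \<open>g\<close>; and a unitary in \<open>Z\<^sub>E\<close> lies in \<open>H\<^sub>E\<close> by polar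
  decomposition of its two factors. Both subgroups are connected because the unitary groups of the two von Neumann
  algebras \<open>N\<close> and \<open>M\<^sub>E\<close> are: a spectral projection splits a unitary into factors with nonnegative real part.
  The projection stays in \<open>M\<^sub>E\<close> because \<open>E\<close> is normal.\<close>

section \<open>Operators on a Hilbert space\<close>

text \<open>No functional calculus is set up: square roots come from a norm-convergent iteration,
  spectral projections only in the form of kernel projections of self-adjoint operators. The
  centralizer is not given as a bicommutant, so polar decomposition and connectedness are proved for
  algebras that are merely closed under these constructions (\<open>op_algebra\<close>,
  \<open>spectral_algebra\<close>). A norm-closed algebra contains its square roots, but a kernel
  projection is only a strong limit; that is where a separate argument for \<open>M_E\<close> is
  required. Positive normalizers have invertible expectation because \<open>E\<close> preserves a
  lower bound \<open>c > 0\<close>, and a coercive element of \<open>N\<close> is invertible in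
  \<open>N\<close>. The Weyl groups are defined through connected components, hence each must first
  be identified with a quotient: components are cosets once the subgroup is connected and contains
  all group elements within distance 1/2 of 1. The comparison of the two quotients is then the
  second isomorphism theorem.\<close>

lemma scaleC_zero_left [simp]: "0 *\<^sub>C (x::'a::complex_normed_vector) = 0"
  using scaleR_scaleC[of 0 x] by simp

lemma scaleC_zero_right [simp]: "c *\<^sub>C (0::'a::complex_normed_vector) = 0"
  using bounded_linear_scaleC by (rule linear_simps)

lemma scaleC_minus_right [simp]: "c *\<^sub>C (- x::'a::complex_normed_vector) = - (c *\<^sub>C x)"
  using bounded_linear_scaleC by (rule linear_simps)

lemma scaleC_diff_right: "c *\<^sub>C (x - y::'a::complex_normed_vector) = c *\<^sub>C x - c *\<^sub>C y"
  using bounded_linear_scaleC by (rule linear_simps)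

lemma scaleC_minus_left [simp]: "(- c) *\<^sub>C (x::'a::complex_normed_vector) = - (c *\<^sub>C x)"
proof -
  have "(- c) *\<^sub>C x + c *\<^sub>C x = 0" by (simp flip: scaleC_add_left)
  then show ?thesis by (simp add: add_eq_0_iff2)
qed

section \<open>Algebraic rules for the inner product\<close>

lemma cinner_zero_right [simp]: "cinner x (0::'h::chilbert_space) = 0"
  using cinner_scaleC_right[of x 0 0] by simp

lemma cinner_zero_left [simp]: "cinner (0::'h::chilbert_space) x = 0"
  by (subst cinner_commute) simp

lemma cinner_minus_right [simp]: "cinner x (- y::'h::chilbert_space) = - cinner x y"
  using cinner_scaleC_right[of x "- 1" y] by (simp add: scaleC_one)

lemma cinner_diff_right: "cinner x (y - z::'h::chilbert_space) = cinner x y - cinner x z"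
  using cinner_add_right[of x y "- z"] by simp

lemma cinner_add_left: "cinner (x + y::'h::chilbert_space) z = cinner x z + cinner y z"
  by (metis cinner_add_right cinner_commute complex_cnj_add)

lemma cinner_scaleC_left: "cinner (c *\<^sub>C x::'h::chilbert_space) y = cnj c * cinner x y"
  by (metis cinner_commute cinner_scaleC_right complex_cnj_mult)

lemma cinner_minus_left [simp]: "cinner (- x::'h::chilbert_space) y = - cinner x y"
  by (metis cinner_commute cinner_minus_right complex_cnj_minus)

lemma cinner_diff_left: "cinner (x - y::'h::chilbert_space) z = cinner x z - cinner y z"
  using cinner_add_left[of x "- y" z] by simp

lemma cinner_scaleR_right: "cinner x (r *\<^sub>R y::'h::chilbert_space) = of_real r * cinner x y"
  by (simp add: scaleR_scaleC cinner_scaleC_right)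

lemma cinner_scaleR_left: "cinner (r *\<^sub>R x::'h::chilbert_space) y = of_real r * cinner x y"
  by (simp add: scaleR_scaleC cinner_scaleC_left)

lemmas cinner_simps = cinner_add_left cinner_add_right cinner_diff_left cinner_diff_right
  cinner_scaleC_left cinner_scaleC_right cinner_scaleR_left cinner_scaleR_right

lemma Im_cinner_self [simp]: "Im (cinner x (x::'h::chilbert_space)) = 0"
  using cinner_commute[of x x] by (metis add.inverse_neutral cnj.simps(2) equal_neg_zero)

lemma Re_cinner_self: "Re (cinner x (x::'h::chilbert_space)) = (norm x)\<^sup>2"
proof -
  have "Re (cinner x x) \<ge> 0"
    using norm_eq_sqrt_cinner[of x] norm_ge_zero[of x] by (metis real_sqrt_ge_0_iff)
  then show ?thesis by (simp add: norm_eq_sqrt_cinner)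
qed

lemma cinner_self: "cinner x (x::'h::chilbert_space) = of_real ((norm x)\<^sup>2)"
  by (simp add: complex_eq_iff Re_cinner_self)

lemma Re_cinner_commute: "Re (cinner x (y::'h::chilbert_space)) = Re (cinner y x)"
  by (metis cinner_commute cnj.simps(1))

lemma norm_add_square: "(norm (x + y::'h::chilbert_space))\<^sup>2 = (norm x)\<^sup>2 + 2 * Re (cinner x y) + (norm y)\<^sup>2"
  using Re_cinner_commute[of y x] by (simp flip: Re_cinner_self add: cinner_simps)

lemma norm_diff_square: "(norm (x - y::'h::chilbert_space))\<^sup>2 = (norm x)\<^sup>2 - 2 * Re (cinner x y) + (norm y)\<^sup>2"
  using norm_add_square[of x "- y"] by simp

text \<open>The discriminant of a nonnegative quadratic polynomial. It serves for Cauchy-Schwarz,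
  for the first-order condition in the Riesz argument (with \<open>c = 0\<close>), for the form of a
  positive operator and for the vector states of \<open>E\<close>; the case \<open>a = 0\<close> is
  kept because these forms may degenerate.\<close>

lemma square_le_mult_if_nonneg_form:
  fixes a b c :: real
  assumes "\<And>s. 0 \<le> a * s\<^sup>2 + 2 * b * s + c" and "0 \<le> a"
  shows "b\<^sup>2 \<le> a * c"
proof (cases "a = 0")
  case True
  have "b = 0"
  proof (rule ccontr)
    assume "b \<noteq> 0"
    \<comment> \<open>At this point the linear function \<open>2 * b * s + c\<close> takes the value
      -1.\<close>
    then show False using assms(1)[of "- (c + 1) / (2 * b)"] True by simp
  qed
  then show ?thesis using True by simp
next
  case False
  then have "a > 0" using assms(2) by simp
  \<comment> \<open>For \<open>a > 0\<close> the minimum lies at \<open>s = - b / a\<close>; the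
    extra factor \<open>a\<close> clears the denominator.\<close>
  have "0 \<le> a * (a * (- b / a)\<^sup>2 + 2 * b * (- b / a) + c)"
    by (rule mult_nonneg_nonneg[OF assms(2) assms(1)])
  also have "\<dots> = a * c - b\<^sup>2"
    using \<open>a > 0\<close> by (simp add: field_simps power2_eq_square)
  finally show ?thesis by simp
qed

lemma Re_cinner_le: "\<bar>Re (cinner x (y::'h::chilbert_space))\<bar> \<le> norm x * norm y"
proof -
  have "0 \<le> (norm y)\<^sup>2 * s\<^sup>2 + 2 * Re (cinner x y) * s + (norm x)\<^sup>2" for s
    using norm_add_square[of x "s *\<^sub>R y"] zero_le_power2[of "norm (x + s *\<^sub>R y)"]
    by (simp add: cinner_simps power_mult_distrib algebra_simps)
  then have "(Re (cinner x y))\<^sup>2 \<le> (norm y)\<^sup>2 * (norm x)\<^sup>2"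
    by (rule square_le_mult_if_nonneg_form) simp
  then have "\<bar>Re (cinner x y)\<bar>\<^sup>2 \<le> (norm x * norm y)\<^sup>2"
    by (simp add: power_mult_distrib mult.commute)
  then show ?thesis by (rule power2_le_imp_le) simp
qed

lemma norm_cinner_le: "cmod (cinner x (y::'h::chilbert_space)) \<le> norm x * norm y"
proof (cases "cinner x y = 0")
  case False
  let ?c = "cinner x y"
  \<comment> \<open>A phase turning \<open>cinner x y\<close> onto the nonnegative real axis, so
    that the bound for real parts applies.\<close>
  define \<theta> where "\<theta> = cnj ?c / cmod ?c"
  have \<theta>: "cmod \<theta> = 1" using False by (simp add: \<theta>_def norm_divide)
  have "cinner x (\<theta> *\<^sub>C y) = of_real (cmod ?c)"
    using False by (simp add: \<theta>_def cinner_simps complex_norm_square power2_eq_square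
        nonzero_divide_eq_eq mult.commute[of "cnj ?c"] flip: of_real_mult)
      (metis complex_norm_square mult.commute nonzero_mult_div_cancel_left norm_eq_zero of_real_eq_0_iff power2_eq_square)
  then have "cmod ?c = \<bar>Re (cinner x (\<theta> *\<^sub>C y))\<bar>" by simp
  also have "\<dots> \<le> norm x * norm (\<theta> *\<^sub>C y)" by (rule Re_cinner_le)
  finally show ?thesis by (simp add: norm_scaleC \<theta>)
qed simp

lemma bounded_bilinear_cinner:
  "bounded_bilinear (cinner :: 'h::chilbert_space \<Rightarrow> 'h \<Rightarrow> complex)"
proof
  show "\<exists>K. \<forall>a b::'h. norm (cinner a b) \<le> norm a * norm b * K"
    by (rule exI[of _ 1]) (simp add: norm_cinner_le)
qed (simp_all add: cinner_simps scaleR_conv_of_real)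

lemmas tendsto_cinner [tendsto_intros] = bounded_bilinear.tendsto[OF bounded_bilinear_cinner]

lemma cinner_eqI:
  fixes x y :: "'h::chilbert_space"
  assumes "\<And>z. cinner z x = cinner z y"
  shows "x = y"
proof -
  have "cinner (x - y) (x - y) = 0" using assms[of "x - y"] by (simp add: cinner_simps)
  then show ?thesis by (simp add: cinner_self)
qed

section \<open>Riesz representation and adjoints\<close>

lemma parallelogram:
  fixes x y :: "'h::chilbert_space"
  shows "(norm (x + y))\<^sup>2 + (norm (x - y))\<^sup>2 = 2 * (norm x)\<^sup>2 + 2 * (norm y)\<^sup>2"
  by (simp add: norm_add_square norm_diff_square)

text \<open>The Riesz vector is the minimiser of \<^term>\<open>\<lambda>x. (norm x)\<^sup>2 - 2 * g x\<close>; the parallelogram law makes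
  minimising sequences Cauchy.\<close>

lemma riesz_real:
  fixes g :: "'h::chilbert_space \<Rightarrow> real"
  assumes "bounded_linear g"
  obtains w where "\<And>h. g h = Re (cinner w h)"
proof -
  interpret g: bounded_linear g by fact
  obtain K where K: "\<And>x. \<bar>g x\<bar> \<le> norm x * K" using g.bounded by auto
  define J where "J x = (norm x)\<^sup>2 - 2 * g x" for x
  have J_ge: "J x \<ge> - K\<^sup>2" for x
  proof -
    have "0 \<le> (norm x - K)\<^sup>2" by simp
    then show ?thesis using K[of x] by (simp add: J_def power2_diff)
  qed
  define m where "m = Inf (range J)"
  have bdd: "bdd_below (range J)" using J_ge by (auto simp: bdd_below_def)
  have m_le: "m \<le> J x" for x unfolding m_def by (rule cInf_lower) (use bdd in auto)
  have "\<exists>x. J x < m + 1 / real (Suc n)" for n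
    using cInf_lessD[of "range J" "m + 1 / real (Suc n)"] by (auto simp: m_def)
  then obtain X where X: "\<And>n. J (X n) < m + 1 / real (Suc n)" by metis
  have mid: "(norm (x - y))\<^sup>2 \<le> 2 * (J x + J y - 2 * m)" for x y
  proof -
    have "J ((1/2) *\<^sub>R (x + y)) = (norm (x + y))\<^sup>2 / 4 - (g x + g y)"
      by (simp only: J_def g.scaleR g.add norm_scaleR power_mult_distrib real_scaleR_def)
        (simp add: power2_eq_square add_divide_distrib)
    then have "4 * m \<le> (norm (x + y))\<^sup>2 - 4 * (g x + g y)"
      using m_le[of "(1/2) *\<^sub>R (x + y)"] by simp
    moreover have "J x + J y = (norm x)\<^sup>2 + (norm y)\<^sup>2 - 2 * (g x + g y)"
      by (simp add: J_def)
    ultimately show ?thesis using parallelogram[of x y] by argo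
  qed
  have "Cauchy X"
  proof (rule metric_CauchyI)
    fix e :: real assume "e > 0"
    obtain k where k: "1 / real (Suc k) < e\<^sup>2 / 4"
      using reals_Archimedean[of "e\<^sup>2/4"] \<open>e > 0\<close> by (auto simp: inverse_eq_divide)
    have "dist (X i) (X j) < e" if "i \<ge> k" "j \<ge> k" for i j
    proof -
      have "1 / real (Suc i) \<le> 1 / real (Suc k)" "1 / real (Suc j) \<le> 1 / real (Suc k)"
        using that by (simp_all add: frac_le)
      then have "J (X i) < m + e\<^sup>2 / 4" "J (X j) < m + e\<^sup>2 / 4"
        using less_trans[OF X[of i]] less_trans[OF X[of j]] k by (smt (verit))+
      then have "(norm (X i - X j))\<^sup>2 < e\<^sup>2"
        using mid[of "X i" "X j"] by argo
      then show ?thesis using \<open>e > 0\<close> by (simp add: dist_norm power2_less_imp_less)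
    qed
    then show "\<exists>M. \<forall>i\<ge>M. \<forall>j\<ge>M. dist (X i) (X j) < e" by blast
  qed
  then obtain w where w: "X \<longlonglongrightarrow> w" using Cauchy_convergent_iff convergent_def by blast
  have "(\<lambda>n. J (X n)) \<longlonglongrightarrow> J w"
    unfolding J_def by (intro tendsto_intros w g.tendsto)
  moreover have "(\<lambda>n. m + 1 / real (Suc n)) \<longlonglongrightarrow> m + 0"
    by (intro tendsto_intros LIMSEQ_Suc[OF lim_1_over_n])
  ultimately have "J w \<le> m + 0"
    by (rule LIMSEQ_le) (use X less_imp_le in blast)
  then have Jw: "J w \<le> J x" for x using m_le[of x] by simp
  have "g h = Re (cinner w h)" for h
  proof -
    \<comment> \<open>This is \<open>J (w + s *\<^sub>R h) - J w\<close>. It has no constant term,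
      so the discriminant forces the linear coefficient to vanish.\<close>
    have "0 \<le> (norm h)\<^sup>2 * s\<^sup>2 + 2 * (Re (cinner w h) - g h) * s + 0" for s
      using Jw[of "w + s *\<^sub>R h"] norm_add_square[of w "s *\<^sub>R h"]
      by (simp add: J_def g.add g.scaleR cinner_simps power_mult_distrib algebra_simps)
    then have "(Re (cinner w h) - g h)\<^sup>2 \<le> (norm h)\<^sup>2 * 0"
      by (rule square_le_mult_if_nonneg_form) simp
    then show ?thesis by simp
  qed
  then show ?thesis using that by blast
qed

text \<open>Riesz is applied over the reals, to real parts only; complex linearity of
  \<open>a\<close> recovers the imaginary parts by replacing \<open>x\<close> with
  \<open>\<i> *\<^sub>C x\<close>.\<close>

lemma adj_exists:
  fixes a :: "'h::chilbert_space op"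
  assumes a: "a \<in> bounded_ops"
  obtains b where "b \<in> bounded_ops" "\<And>x y. cinner (a x) y = cinner x (b y)"
proof -
  have ac: "a (c *\<^sub>C x) = c *\<^sub>C a x" for c x using a by (simp add: bounded_ops_def)
  have "\<exists>w. \<forall>x. Re (cinner y (a x)) = Re (cinner w x)" for y
  proof -
    have "bounded_linear (\<lambda>x. Re (cinner y (a x)))"
      by (intro bounded_linear_compose[OF bounded_linear_Re]
          bounded_linear_compose[OF bounded_bilinear.bounded_linear_right[OF bounded_bilinear_cinner]]
          blinfun.bounded_linear_right)
    then show ?thesis using riesz_real by metis
  qed
  then obtain f where f: "\<And>x y. Re (cinner y (a x)) = Re (cinner (f y) x)" by metis
  have fc: "cinner y (a x) = cinner (f y) x" for x y
  proof (rule complex_eqI)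
    show "Im (cinner y (a x)) = Im (cinner (f y) x)"
      using f[of y "\<i> *\<^sub>C x"] by (simp add: ac cinner_simps)
  qed (rule f)
  have adj: "cinner (a x) y = cinner x (f y)" for x y
    using fc[of y x] cinner_commute[of "a x" y] cinner_commute[of x "f y"] by simp
  have "bounded_linear f"
  proof (rule bounded_linear_intro[where K = "norm a"])
    show "f (x + y) = f x + f y" for x y
      by (rule cinner_eqI) (simp add: cinner_simps flip: adj)
    show "f (r *\<^sub>R x) = r *\<^sub>R f x" for r x
      by (rule cinner_eqI) (simp add: cinner_simps flip: adj)
    show "norm (f x) \<le> norm x * norm a" for x
    proof (cases "f x = 0")
      case False
      have "(norm (f x))\<^sup>2 = Re (cinner (a (f x)) x)" by (simp add: adj Re_cinner_self)
      also have "\<dots> \<le> norm (a (f x)) * norm x" using Re_cinner_le[of "a (f x)" x] by simp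
      also have "\<dots> \<le> (norm a * norm (f x)) * norm x"
        by (intro mult_right_mono norm_blinfun) simp
      finally have "norm (f x) * norm (f x) \<le> norm (f x) * (norm x * norm a)"
        by (simp add: power2_eq_square algebra_simps)
      then show ?thesis using False by simp
    qed simp
  qed
  then have ap: "blinfun_apply (Blinfun f) = f" by (rule bounded_linear_Blinfun_apply)
  have "Blinfun f \<in> bounded_ops"
    unfolding bounded_ops_def ap mem_Collect_eq
    by (intro allI cinner_eqI) (simp add: cinner_simps flip: adj)
  then show ?thesis by (rule that) (simp add: ap adj)
qed

text \<open>Turns the definite description behind \<open>adj\<close> into a rule: exhibiting a
  formal adjoint computes \<open>adj a\<close>.\<close>

lemma adj_unique:
  fixes a b :: "'h::chilbert_space op"
  assumes "\<And>x y. cinner (a x) y = cinner x (b y)"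
  shows "adj a = b"
  unfolding adj_def
proof (rule the_equality)
  show "\<forall>x y. cinner (a x) y = cinner x (b y)" using assms by blast
next
  fix c :: "'h op" assume "\<forall>x y. cinner (a x) y = cinner x (c y)"
  then show "c = b" using assms by (intro blinfun_eqI cinner_eqI) metis
qed

lemma cinner_adj_right:
  fixes a :: "'h::chilbert_space op"
  assumes "a \<in> bounded_ops"
  shows "cinner x (adj a y) = cinner (a x) y"
  using adj_exists[OF assms] adj_unique by metis

lemma cinner_adj_left:
  fixes a :: "'h::chilbert_space op"
  assumes "a \<in> bounded_ops"
  shows "cinner (adj a x) y = cinner x (a y)"
  using cinner_adj_right[OF assms] cinner_commute by metis

lemma adj_bounded_ops [simp]:
  fixes a :: "'h::chilbert_space op"
  assumes "a \<in> bounded_ops"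
  shows "adj a \<in> bounded_ops"
  using adj_exists[OF assms] adj_unique by metis

lemma adj_adj [simp]: "a \<in> bounded_ops \<Longrightarrow> adj (adj a) = a"
  by (rule adj_unique) (simp add: cinner_adj_left)

lemma bounded_ops_id [simp]: "id_blinfun \<in> bounded_ops"
  and bounded_ops_add [simp]: "a \<in> bounded_ops \<Longrightarrow> b \<in> bounded_ops \<Longrightarrow> a + b \<in> bounded_ops"
  and bounded_ops_diff [simp]: "a \<in> bounded_ops \<Longrightarrow> b \<in> bounded_ops \<Longrightarrow> a - b \<in> bounded_ops"
  and bounded_ops_scaleC [simp]: "a \<in> bounded_ops \<Longrightarrow> c *\<^sub>C a \<in> bounded_ops"
  and bounded_ops_scaleR [simp]: "a \<in> bounded_ops \<Longrightarrow> r *\<^sub>R a \<in> bounded_ops"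
  and bounded_ops_compose [simp]: "a \<in> bounded_ops \<Longrightarrow> b \<in> bounded_ops \<Longrightarrow> a o\<^sub>L b \<in> bounded_ops"
  and bounded_ops_zero [simp]: "0 \<in> bounded_ops"
  and bounded_ops_minus [simp]: "a \<in> bounded_ops \<Longrightarrow> - a \<in> bounded_ops"
  by (auto simp: bounded_ops_def blinfun.bilinear_simps scaleC_add_right scaleC_diff_right
      scaleC_blinfun.rep_eq scaleC_scaleC scaleR_scaleC mult.commute)

lemma adj_id [simp]: "adj id_blinfun = id_blinfun"
  by (rule adj_unique) simp

lemma adj_add [simp]: "a \<in> bounded_ops \<Longrightarrow> b \<in> bounded_ops \<Longrightarrow> adj (a + b) = adj a + adj b"
  and adj_diff [simp]: "a \<in> bounded_ops \<Longrightarrow> b \<in> bounded_ops \<Longrightarrow> adj (a - b) = adj a - adj b"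
  and adj_scaleC [simp]: "a \<in> bounded_ops \<Longrightarrow> adj (c *\<^sub>C a) = cnj c *\<^sub>C adj a"
  and adj_scaleR [simp]: "a \<in> bounded_ops \<Longrightarrow> adj (r *\<^sub>R a) = r *\<^sub>R adj a"
  and adj_compose [simp]: "a \<in> bounded_ops \<Longrightarrow> b \<in> bounded_ops \<Longrightarrow> adj (a o\<^sub>L b) = adj b o\<^sub>L adj a"
  by (rule adj_unique, simp add: blinfun.bilinear_simps cinner_simps cinner_adj_right scaleC_blinfun.rep_eq)+

lemma norm_adj_le:
  fixes a :: "'h::chilbert_space op"
  assumes "a \<in> bounded_ops"
  shows "norm (adj a) \<le> norm a"
proof (rule norm_blinfun_bound)
  fix x
  show "norm (adj a x) \<le> norm a * norm x"
  proof (cases "adj a x = 0")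
    case False
    have "(norm (adj a x))\<^sup>2 = Re (cinner (a (adj a x)) x)"
      by (simp add: Re_cinner_self flip: cinner_adj_right[OF assms])
    also have "\<dots> \<le> norm (a (adj a x)) * norm x" using Re_cinner_le[of "a (adj a x)" x] by simp
    also have "\<dots> \<le> (norm a * norm (adj a x)) * norm x"
      by (intro mult_right_mono norm_blinfun) simp
    finally have "norm (adj a x) * norm (adj a x) \<le> norm (adj a x) * (norm a * norm x)"
      by (simp add: power2_eq_square algebra_simps)
    then show ?thesis using False by simp
  qed simp
qed simp

lemma closed_bounded_ops: "closed (bounded_ops :: 'h::chilbert_space op set)"
  unfolding closed_sequential_limits
proof (intro allI impI)
  fix f :: "nat \<Rightarrow> 'h op" and l assume *: "(\<forall>n. f n \<in> bounded_ops) \<and> f \<longlonglongrightarrow> l"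
  have l: "(\<lambda>n. f n x) \<longlonglongrightarrow> l x" for x
    using * by (intro tendsto_intros) auto
  have "l (c *\<^sub>C x) = c *\<^sub>C l x" for c x
  proof (rule LIMSEQ_unique)
    show "(\<lambda>n. f n (c *\<^sub>C x)) \<longlonglongrightarrow> l (c *\<^sub>C x)" by (rule l)
    show "(\<lambda>n. f n (c *\<^sub>C x)) \<longlonglongrightarrow> c *\<^sub>C l x"
      using bounded_linear.tendsto[OF bounded_linear_scaleC l] * by (simp add: bounded_ops_def)
  qed
  then show "l \<in> bounded_ops" by (simp add: bounded_ops_def)
qed

lemma tendsto_adj:
  fixes f :: "'b \<Rightarrow> 'h::chilbert_space op"
  assumes "(f \<longlongrightarrow> a) F" and "a \<in> bounded_ops" and "\<And>n. f n \<in> bounded_ops"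
  shows "((\<lambda>n. adj (f n)) \<longlongrightarrow> adj a) F"
proof (rule metric_tendsto_imp_tendsto[OF assms(1)])
  have "dist (adj (f n)) (adj a) \<le> dist (f n) a" for n
    using norm_adj_le[of "f n - a"] assms by (simp add: dist_norm)
  then show "\<forall>\<^sub>F n in F. dist (adj (f n)) (adj a) \<le> dist (f n) a" by simp
qed

instance chilbert_space \<subseteq> banach ..

section \<open>The operator order and quadratic forms\<close>

lemma op_le_diff: "op_le a b \<longleftrightarrow> op_le 0 (b - a)"
  by (simp add: op_le_def)

lemma op_le_0_iff: "op_le 0 a \<longleftrightarrow> (\<forall>x. Im (cinner x (a x)) = 0 \<and> 0 \<le> Re (cinner x (a x)))"
  by (simp add: op_le_def)

lemma op_le_0D:
  assumes "op_le 0 a"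
  shows "Im (cinner x (a x)) = 0" and "0 \<le> Re (cinner x (a x))"
  using assms by (simp_all add: op_le_0_iff)

lemma op_le_refl: "op_le a a"
  by (simp add: op_le_def)

lemma op_le_0_add: "op_le 0 a \<Longrightarrow> op_le 0 b \<Longrightarrow> op_le 0 (a + b)"
  by (simp add: op_le_0_iff blinfun.add_left cinner_simps)

lemma op_le_0_scaleR: "op_le 0 a \<Longrightarrow> 0 \<le> r \<Longrightarrow> op_le 0 (r *\<^sub>R a)"
  by (simp add: op_le_0_iff blinfun.scaleR_left cinner_simps)

lemma op_le_0_adj_compose:
  assumes "a \<in> bounded_ops"
  shows "op_le 0 (adj a o\<^sub>L a)"
  by (simp add: op_le_0_iff cinner_adj_right[OF assms] Re_cinner_self)

lemma selfadjoint_Im: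
  assumes "a \<in> bounded_ops" "adj a = a"
  shows "Im (cinner x (a x)) = 0"
proof -
  have "cinner x (a x) = cnj (cinner x (a x))"
    using cinner_adj_right[OF assms(1), of x x] cinner_commute[of x "a x"] assms(2) by simp
  then show ?thesis by (simp add: complex_eq_iff)
qed

text \<open>Polarisation: the vectors \<open>x + y\<close> and \<open>x + \<i> *\<^sub>C y\<close>
  compare the imaginary and the real parts of the two off-diagonal values.\<close>

lemma selfadjoint_if_form_real:
  fixes a :: "'h::chilbert_space op"
  assumes "a \<in> bounded_ops" and real: "\<And>x. Im (cinner x (a x)) = 0"
  shows "adj a = a"
proof (rule adj_unique)
  fix x y
  have ac: "a (c *\<^sub>C z) = c *\<^sub>C a z" for c z using assms(1) by (simp add: bounded_ops_def)
  have im: "Im (cinner x (a y)) = - Im (cinner y (a x))"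
    using real[of "x + y"] real[of x] real[of y]
    by (simp add: cinner_simps blinfun.add_right)
  have re: "Re (cinner x (a y)) = Re (cinner y (a x))"
    using real[of "x + \<i> *\<^sub>C y"] real[of x] real[of y]
    by (simp add: cinner_simps blinfun.add_right ac)
  show "cinner (a x) y = cinner x (a y)"
    using im re cinner_commute[of "a x" y] by (simp add: complex_eq_iff)
qed

lemma op_le_0_selfadjoint:
  assumes "a \<in> bounded_ops" "op_le 0 a"
  shows "adj a = a"
  using assms by (intro selfadjoint_if_form_real) (auto simp: op_le_0_iff)

lemma eq_0_if_form_0:
  fixes a :: "'h::chilbert_space op"
  assumes "a \<in> bounded_ops" and zero: "\<And>x. cinner x (a x) = 0"
  shows "a = 0"
proof (rule blinfun_eqI)
  fix x
  have sa: "adj a = a" using assms by (intro selfadjoint_if_form_real) auto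
  \<comment> \<open>Polarising along \<open>x\<close> and \<open>a x\<close> suffices: by
    self-adjointness both cross terms equal the squared norm of \<open>a x\<close>.\<close>
  have "cinner (a x) (a x) + cinner x (a (a x)) = 0"
    using zero[of "x + a x"] zero[of x] zero[of "a x"]
    by (simp add: cinner_simps blinfun.add_right)
  moreover have "cinner x (a (a x)) = cinner (a x) (a x)"
    using cinner_adj_right[OF assms(1), of x "a x"] sa by simp
  ultimately show "a x = blinfun_apply 0 x" by (simp add: cinner_self)
qed

lemma op_le_antisym:
  assumes "a \<in> bounded_ops" "b \<in> bounded_ops" "op_le a b" "op_le b a"
  shows "a = b"
proof -
  have "b - a = 0"
  proof (rule eq_0_if_form_0)
    fix x
    show "cinner x ((b - a) x) = 0"
      using assms(3)[unfolded op_le_def, rule_format, of x] assms(4)[unfolded op_le_def, rule_format, of x]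
      by (simp add: complex_eq_iff blinfun.diff_left cinner_simps)
  qed (use assms in simp)
  then show ?thesis by simp
qed

text \<open>Cauchy-Schwarz for the semi-inner product given by \<open>a\<close>, between
  \<open>x\<close> and \<open>a x\<close>. Bounding the form at \<open>a x\<close> by
  \<open>K\<close> lets one factor \<open>(norm (a x))\<^sup>2\<close> cancel. This expresses that
  the square of \<open>a\<close> is at most \<open>K\<close> times \<open>a\<close>, before square
  roots exist.\<close>

lemma norm_square_le_form:
  fixes a :: "'h::chilbert_space op"
  assumes a: "a \<in> bounded_ops" "op_le 0 a" and K: "0 \<le> K" "\<And>x. Re (cinner x (a x)) \<le> K * (norm x)\<^sup>2"
  shows "(norm (a x))\<^sup>2 \<le> K * Re (cinner x (a x))"
proof (cases "a x = 0")
  case False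
  have sa: "cinner x (a y) = cinner (a x) y" for x y
    using cinner_adj_right[OF a(1), of x y] op_le_0_selfadjoint[OF a] by simp
  have "0 \<le> Re (cinner (a x) (a (a x))) * s\<^sup>2 + 2 * ((norm (a x))\<^sup>2) * s + Re (cinner x (a x))" for s
    using op_le_0D(2)[OF a(2), of "x + s *\<^sub>R a x"]
    by (simp add: cinner_simps blinfun.bilinear_simps sa[of x "a x"] cinner_self power2_eq_square algebra_simps)
  then have "((norm (a x))\<^sup>2)\<^sup>2 \<le> Re (cinner (a x) (a (a x))) * Re (cinner x (a x))"
    by (rule square_le_mult_if_nonneg_form) (rule op_le_0D(2)[OF a(2)])
  also have "\<dots> \<le> (K * (norm (a x))\<^sup>2) * Re (cinner x (a x))"
    by (intro mult_right_mono K op_le_0D a)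
  finally have "(norm (a x))\<^sup>2 * (norm (a x))\<^sup>2 \<le> (norm (a x))\<^sup>2 * (K * Re (cinner x (a x)))"
    by (simp only: power2_eq_square[of "(norm (a x))\<^sup>2"] mult_ac)
  then show ?thesis by (rule mult_left_le_imp_le) (use False in simp)
qed (use assms op_le_0D in simp)

lemma norm_le_form:
  fixes a :: "'h::chilbert_space op"
  assumes a: "a \<in> bounded_ops" "op_le 0 a" and K: "0 \<le> K" "\<And>x. Re (cinner x (a x)) \<le> K * (norm x)\<^sup>2"
  shows "norm a \<le> K"
proof (rule norm_blinfun_bound[OF K(1)])
  fix x
  have "(norm (a x))\<^sup>2 \<le> K * (K * (norm x)\<^sup>2)"
    using norm_square_le_form[OF a K, of x] mult_left_mono[OF K(2)[of x] K(1)] by simp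
  then have "(norm (a x))\<^sup>2 \<le> (K * norm x)\<^sup>2" by (simp add: power2_eq_square algebra_simps)
  then show "norm (a x) \<le> K * norm x" by (rule power2_le_imp_le) (simp add: K)
qed

lemma form_le_norm:
  fixes a :: "'h::chilbert_space op"
  shows "Re (cinner x (a x)) \<le> norm a * (norm x)\<^sup>2"
proof -
  have "Re (cinner x (a x)) \<le> norm x * norm (a x)" using Re_cinner_le[of x "a x"] by simp
  also have "\<dots> \<le> norm x * (norm a * norm x)" by (intro mult_left_mono norm_blinfun) simp
  finally show ?thesis by (simp add: power2_eq_square algebra_simps)
qed

lemma op_le_id_iff:
  assumes "a \<in> bounded_ops" "adj a = a"
  shows "op_le a (r *\<^sub>R id_blinfun) \<longleftrightarrow> (\<forall>x. Re (cinner x (a x)) \<le> r * (norm x)\<^sup>2)"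
  using selfadjoint_Im[OF assms]
  by (simp add: op_le_def blinfun.bilinear_simps cinner_simps Re_cinner_self)

section \<open>Square roots\<close>

text \<open>Only real-linear closure and no adjoints: the square root iteration has real
  coefficients, and the operators commuting with one arbitrary operator must qualify. Membership of
  a root in every such algebra therefore also yields what the root commutes with.\<close>

definition closed_unital_algebra :: "'h::chilbert_space op set \<Rightarrow> bool" where
  "closed_unital_algebra A \<longleftrightarrow>
     closed A \<and> subspace A \<and> id_blinfun \<in> A \<and> (\<forall>a\<in>A. \<forall>b\<in>A. a o\<^sub>L b \<in> A)"

lemma closed_unital_algebraD:
  assumes "closed_unital_algebra A"
  shows "closed A" "id_blinfun \<in> A" "0 \<in> A"
    and "a \<in> A \<Longrightarrow> b \<in> A \<Longrightarrow> a o\<^sub>L b \<in> A"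
    and "a \<in> A \<Longrightarrow> b \<in> A \<Longrightarrow> a + b \<in> A"
    and "a \<in> A \<Longrightarrow> b \<in> A \<Longrightarrow> a - b \<in> A"
    and "a \<in> A \<Longrightarrow> r *\<^sub>R a \<in> A"
  using assms by (auto simp: closed_unital_algebra_def subspace_def subspace_diff)

lemma continuous_on_compose_blinfun [continuous_intros]:
  "continuous_on S f \<Longrightarrow> continuous_on S g \<Longrightarrow> continuous_on S (\<lambda>x. f x o\<^sub>L g x)"
  by (rule bounded_bilinear.continuous_on[OF bounded_bilinear_blinfun_compose])

lemma tendsto_compose_blinfun [tendsto_intros]:
  "(f \<longlongrightarrow> a) F \<Longrightarrow> (g \<longlongrightarrow> b) F \<Longrightarrow> ((\<lambda>x. f x o\<^sub>L g x) \<longlongrightarrow> a o\<^sub>L b) F"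
  by (rule bounded_bilinear.tendsto[OF bounded_bilinear_blinfun_compose])

lemmas compose_simps =
  bounded_bilinear.add_left[OF bounded_bilinear_blinfun_compose]
  bounded_bilinear.add_right[OF bounded_bilinear_blinfun_compose]
  bounded_bilinear.diff_left[OF bounded_bilinear_blinfun_compose]
  bounded_bilinear.diff_right[OF bounded_bilinear_blinfun_compose]
  bounded_bilinear.scaleR_left[OF bounded_bilinear_blinfun_compose]
  bounded_bilinear.scaleR_right[OF bounded_bilinear_blinfun_compose]
  bounded_bilinear.minus_left[OF bounded_bilinear_blinfun_compose]
  bounded_bilinear.minus_right[OF bounded_bilinear_blinfun_compose]

lemma compose_zero [simp]: "a o\<^sub>L 0 = 0" "0 o\<^sub>L a = 0"
  by (simp_all add: blinfun_eqI)

lemma compose_id [simp]: "a o\<^sub>L id_blinfun = a" "id_blinfun o\<^sub>L a = a"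
  by (simp_all add: blinfun_eqI)

lemma compose_assoc: "a o\<^sub>L b o\<^sub>L c = a o\<^sub>L (b o\<^sub>L c)"
  by (simp add: blinfun_eqI)

lemma closed_unital_algebra_commuting:
  "closed_unital_algebra {y::'h::chilbert_space op. y o\<^sub>L x = x o\<^sub>L y}"
  unfolding closed_unital_algebra_def
proof (intro conjI ballI)
  show "closed {y. y o\<^sub>L x = x o\<^sub>L y}"
    by (intro closed_Collect_eq continuous_intros)
  show "subspace {y. y o\<^sub>L x = x o\<^sub>L y}"
    by (auto simp: subspace_def compose_simps)
  fix a b assume "a \<in> {y. y o\<^sub>L x = x o\<^sub>L y}" "b \<in> {y. y o\<^sub>L x = x o\<^sub>L y}"
  then show "a o\<^sub>L b \<in> {y. y o\<^sub>L x = x o\<^sub>L y}"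
    by simp (metis compose_assoc)
qed simp

text \<open>For \<^term>\<open>x\<close> of norm at most 1 the iteration \<^term>\<open>q = (1/2) *\<^sub>R (x + (q o\<^sub>L q))\<close> is dominated by its
  scalar version \<^term>\<open>t = (1 + t\<^sup>2) / 2\<close>, which is monotone and bounded, so it converges in norm; its
  limit is \<open>1 - sqrt (1 - x)\<close>.\<close>

primrec sqrt_iter :: "'h::chilbert_space op \<Rightarrow> nat \<Rightarrow> 'h op" where
  "sqrt_iter x 0 = 0"
| "sqrt_iter x (Suc n) = (1/2) *\<^sub>R (x + (sqrt_iter x n o\<^sub>L sqrt_iter x n))"

primrec sqrt_bound :: "nat \<Rightarrow> real" where
  "sqrt_bound 0 = 0"
| "sqrt_bound (Suc n) = (1 + (sqrt_bound n)\<^sup>2) / 2"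

lemma sqrt_bound_range: "0 \<le> sqrt_bound n \<and> sqrt_bound n \<le> 1"
proof (induction n)
  case (Suc n)
  then have "(sqrt_bound n)\<^sup>2 \<le> 1" by (simp add: power_le_one)
  then show ?case by simp
qed simp

lemma sqrt_bound_Suc_le: "sqrt_bound n \<le> sqrt_bound (Suc n)"
  using zero_le_power2[of "sqrt_bound n - 1"] by (simp add: power2_diff)

lemma sqrt_iter_mem: "closed_unital_algebra A \<Longrightarrow> x \<in> A \<Longrightarrow> sqrt_iter x n \<in> A"
  by (induction n) (simp_all add: closed_unital_algebraD)

text \<open>Membership in a commuting algebra is used twice: the iterate with index \<open>n\<close>
  commutes with \<open>x\<close>, so \<open>x\<close>, and with it every other iterate, lies in the
  algebra of operators commuting with that iterate.\<close>

lemma sqrt_iter_commute: "sqrt_iter x m o\<^sub>L sqrt_iter x n = sqrt_iter x n o\<^sub>L sqrt_iter x m"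
  using sqrt_iter_mem[OF closed_unital_algebra_commuting, of x x n]
    sqrt_iter_mem[OF closed_unital_algebra_commuting, of x "sqrt_iter x n" m] by simp

lemma norm_sqrt_iter:
  assumes "norm x \<le> 1"
  shows "norm (sqrt_iter x n) \<le> sqrt_bound n"
proof (induction n)
  case (Suc n)
  have "norm (x + (sqrt_iter x n o\<^sub>L sqrt_iter x n)) \<le> norm x + norm (sqrt_iter x n o\<^sub>L sqrt_iter x n)"
    by (rule norm_triangle_ineq)
  also have "\<dots> \<le> norm x + norm (sqrt_iter x n) * norm (sqrt_iter x n)"
    by (intro add_left_mono norm_blinfun_compose)
  also have "\<dots> \<le> 1 + sqrt_bound n * sqrt_bound n"
    by (intro add_mono assms mult_mono Suc) (simp_all add: sqrt_bound_range)
  finally show ?case by (simp add: power2_eq_square)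
qed simp

text \<open>Commuting iterates allow the factorisation \<open>(p - q) o\<^sub>L (p + q)\<close> of a
  difference of squares; the scalar recursion factors in the same way, so the domination of
  increments passes from one step to the next.\<close>

lemma norm_sqrt_iter_diff:
  assumes "norm x \<le> 1"
  shows "norm (sqrt_iter x (Suc n) - sqrt_iter x n) \<le> sqrt_bound (Suc n) - sqrt_bound n"
proof (induction n)
  case 0
  show ?case using assms by simp
next
  case (Suc n)
  define p q where "p = sqrt_iter x (Suc n)" and "q = sqrt_iter x n"
  define s t where "s = sqrt_bound (Suc n)" and "t = sqrt_bound n"
  have IH: "norm (p - q) \<le> s - t" using Suc by (simp only: p_def q_def s_def t_def)
  have pq: "p o\<^sub>L q = q o\<^sub>L p" unfolding p_def q_def by (rule sqrt_iter_commute)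
  have "sqrt_iter x (Suc (Suc n)) = (1/2) *\<^sub>R (x + (p o\<^sub>L p))" "p = (1/2) *\<^sub>R (x + (q o\<^sub>L q))"
    by (simp_all add: p_def q_def)
  then have "sqrt_iter x (Suc (Suc n)) - p = (1/2) *\<^sub>R ((x + (p o\<^sub>L p)) - (x + (q o\<^sub>L q)))"
    by (metis scaleR_right_diff_distrib)
  also have "(x + (p o\<^sub>L p)) - (x + (q o\<^sub>L q)) = (p - q) o\<^sub>L (p + q)"
    by (simp add: compose_simps pq)
  finally have "norm (sqrt_iter x (Suc (Suc n)) - p) = norm ((p - q) o\<^sub>L (p + q)) / 2" by simp
  also have "\<dots> \<le> (norm (p - q) * norm (p + q)) / 2"
    by (intro divide_right_mono norm_blinfun_compose) simp
  also have "\<dots> \<le> ((s - t) * (s + t)) / 2"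
  proof (intro divide_right_mono mult_mono IH)
    show "norm (p + q) \<le> s + t"
      unfolding p_def q_def s_def t_def by (intro norm_triangle_mono norm_sqrt_iter assms)
    show "0 \<le> s - t" unfolding s_def t_def using sqrt_bound_Suc_le[of n] by linarith
  qed simp_all
  also have "\<dots> = (1 + s\<^sup>2) / 2 - (1 + t\<^sup>2) / 2" by (simp add: power2_eq_square field_simps)
  also have "\<dots> = sqrt_bound (Suc (Suc n)) - s" by (simp add: s_def t_def)
  finally show ?case by (simp only: p_def s_def)
qed

text \<open>The dominating increments telescope to a bounded monotone sequence. This covers
  \<open>norm x = 1\<close>, where no contraction factor below 1 is available.\<close>

lemma sqrt_iter_convergent:
  assumes "norm x \<le> 1"
  shows "convergent (sqrt_iter x)"
proof -
  have "incseq sqrt_bound" using sqrt_bound_Suc_le by (rule incseq_SucI)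
  then have "convergent sqrt_bound"
    using incseq_convergent[of sqrt_bound 1] sqrt_bound_range convergentI by metis
  then have "convergent (\<lambda>n. sqrt_bound n - sqrt_bound 0)"
    by (intro convergent_diff convergent_const)
  then have "summable (\<lambda>n. sqrt_bound (Suc n) - sqrt_bound n)"
    by (simp only: summable_iff_convergent sum_lessThan_telescope)
  then have "summable (\<lambda>n. sqrt_iter x (Suc n) - sqrt_iter x n)"
    by (rule summable_comparison_test[rotated]) (use norm_sqrt_iter_diff[OF assms] in blast)
  then have "convergent (\<lambda>n. sqrt_iter x n - sqrt_iter x 0)"
    by (simp only: summable_iff_convergent sum_lessThan_telescope)
  then show ?thesis by simp
qed

lemma sqrt_exists_contraction:
  fixes a :: "'h::chilbert_space op"
  assumes a: "a \<in> bounded_ops" "op_le 0 a" "norm a \<le> 1"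
  obtains s where "s \<in> bounded_ops" "op_le 0 s" "s o\<^sub>L s = a"
    "\<And>A. closed_unital_algebra A \<Longrightarrow> a \<in> A \<Longrightarrow> s \<in> A"
proof -
  define x where "x = id_blinfun - a"
  have xb: "x \<in> bounded_ops" "adj x = x" using a op_le_0_selfadjoint by (auto simp: x_def)
  \<comment> \<open>For \<open>a\<close> between 0 and 1 the squared norm of \<open>a y\<close> is
    at most the form at \<open>y\<close>; expanding the squared norm of \<open>y - a y\<close> then
    gives at most that of \<open>y\<close>.\<close>
  have "norm x \<le> 1"
  proof (rule norm_blinfun_bound)
    fix y
    have "(norm (a y))\<^sup>2 \<le> 1 * Re (cinner y (a y))"
    proof (rule norm_square_le_form[OF a(1,2)])
      show "Re (cinner x (a x)) \<le> 1 * (norm x)\<^sup>2" for x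
        using form_le_norm[of x a] mult_right_mono[OF a(3), of "(norm x)\<^sup>2"] by simp
    qed simp
    then have "(norm (x y))\<^sup>2 \<le> (norm y)\<^sup>2"
      using op_le_0D[OF a(2), of y] by (simp add: x_def blinfun.diff_left norm_diff_square)
    then show "norm (x y) \<le> 1 * norm y" by simp
  qed simp
  then obtain q where q: "sqrt_iter x \<longlonglongrightarrow> q" using sqrt_iter_convergent convergent_def by blast
  have mem: "q \<in> A" if "closed_unital_algebra A" "x \<in> A" for A
    using closed_sequentially[OF closed_unital_algebraD(1)[OF that(1)] _ q] sqrt_iter_mem[OF that] by blast
  have iterb: "sqrt_iter x n \<in> bounded_ops" for n by (induction n) (simp_all add: xb)
  then have qb: "q \<in> bounded_ops" using closed_sequentially[OF closed_bounded_ops _ q] by blast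
  have "adj (sqrt_iter x n) = sqrt_iter x n" for n
    by (induction n) (simp_all add: xb iterb adj_unique)
  then have qadj: "adj q = q" using tendsto_adj[OF q qb iterb] q LIMSEQ_unique by auto
  have "norm q \<le> 1"
    using norm_sqrt_iter[OF \<open>norm x \<le> 1\<close>] sqrt_bound_range
    by (intro Lim_norm_ubound[OF _ q]) (auto intro!: always_eventually intro: order_trans)
  have "(\<lambda>n. sqrt_iter x (Suc n)) \<longlonglongrightarrow> (1/2) *\<^sub>R (x + (q o\<^sub>L q))"
    unfolding sqrt_iter.simps by (intro tendsto_intros q)
  then have qq: "q = (1/2) *\<^sub>R (x + (q o\<^sub>L q))" using LIMSEQ_Suc[OF q] LIMSEQ_unique by blast
  have "2 *\<^sub>R q = x + (q o\<^sub>L q)" by (subst qq) simp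
  \<comment> \<open>The fixed point equation in the form saying that \<open>id_blinfun - q\<close>
    squares to \<open>id_blinfun - x\<close>.\<close>
  then have qq': "q o\<^sub>L q = q + q - x" by (simp add: scaleR_2)
  show ?thesis
  proof
    show "id_blinfun - q \<in> bounded_ops" using qb by simp
    show "(id_blinfun - q) o\<^sub>L (id_blinfun - q) = a"
      by (simp add: compose_simps qq' x_def)
    show "op_le 0 (id_blinfun - q)"
      unfolding op_le_0_iff
    proof
      fix y
      have "Re (cinner y (q y)) \<le> (norm y)\<^sup>2"
        using form_le_norm[of y q] mult_right_mono[OF \<open>norm q \<le> 1\<close>, of "(norm y)\<^sup>2"] by simp
      then show "Im (cinner y ((id_blinfun - q) y)) = 0 \<and> 0 \<le> Re (cinner y ((id_blinfun - q) y))"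
        using selfadjoint_Im[OF qb qadj, of y] by (simp add: blinfun.diff_left cinner_simps Re_cinner_self)
    qed
    show "id_blinfun - q \<in> A" if A: "closed_unital_algebra A" "a \<in> A" for A
      using mem[OF A(1)] A by (simp add: x_def closed_unital_algebraD)
  qed
qed

lemma sqrt_exists:
  fixes a :: "'h::chilbert_space op"
  assumes a: "a \<in> bounded_ops" "op_le 0 a"
  obtains s where "s \<in> bounded_ops" "op_le 0 s" "s o\<^sub>L s = a"
    "\<And>A. closed_unital_algebra A \<Longrightarrow> a \<in> A \<Longrightarrow> s \<in> A"
proof -
  define K where "K = norm a + 1"
  have K: "K > 0" by (simp add: K_def add_nonneg_pos)
  obtain s where s: "s \<in> bounded_ops" "op_le 0 s" "s o\<^sub>L s = inverse K *\<^sub>R a"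
    "\<And>A. closed_unital_algebra A \<Longrightarrow> inverse K *\<^sub>R a \<in> A \<Longrightarrow> s \<in> A"
  proof (rule sqrt_exists_contraction)
    show "norm (inverse K *\<^sub>R a) \<le> 1" using K by (simp add: K_def field_simps)
  qed (use a K in \<open>auto intro: op_le_0_scaleR\<close>)
  show ?thesis
  proof
    show "sqrt K *\<^sub>R s o\<^sub>L sqrt K *\<^sub>R s = a"
      using K by (simp add: compose_simps s(3) flip: mult.assoc)
    show "op_le 0 (sqrt K *\<^sub>R s)" using K s(2) by (intro op_le_0_scaleR) simp_all
    show "sqrt K *\<^sub>R s \<in> A" if "closed_unital_algebra A" "a \<in> A" for A
      using that by (intro closed_unital_algebraD(7) s(4))
  qed (use s in simp)
qed

section \<open>Coercive operators\<close>

text \<open>The Lax-Milgram argument: coercivity bounds \<open>norm (a x)\<close> below, hence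
  injectivity and the norm of the inverse; solving \<open>a x = y\<close> is a fixed point problem
  for a contraction.\<close>

lemma coercive_invertible:
  fixes a :: "'h::chilbert_space op"
  assumes a: "a \<in> bounded_ops" and c: "c > 0" "\<And>x. c * (norm x)\<^sup>2 \<le> Re (cinner x (a x))"
  obtains b where "b \<in> bounded_ops" "a o\<^sub>L b = id_blinfun" "b o\<^sub>L a = id_blinfun" "norm b \<le> 1 / c"
proof -
  have lower: "c * norm x \<le> norm (a x)" for x
  proof (cases "x = 0")
    case False
    have "(c * norm x) * norm x \<le> norm (a x) * norm x"
      using c(2)[of x] Re_cinner_le[of x "a x"] by (simp add: power2_eq_square algebra_simps)
    then show ?thesis using False by simp
  qed simp
  have inj: "x = y" if "a x = a y" for x y
    using lower[of "x - y"] c(1) that by (simp add: blinfun.diff_right mult_le_0_iff)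
  \<comment> \<open>The summand \<open>c\<close> ensures \<open>K > 0\<close> and
    \<open>c \<le> K\<close>, so that the contraction factor below is a real number less than
    1.\<close>
  define K where "K = norm a + c"
  have K: "K > 0" "norm a \<le> K" "c \<le> K" using c(1) by (auto simp: K_def add_nonneg_pos)
  \<comment> \<open>This step size minimises the bound
    \<open>1 - 2 * \<tau> * c + \<tau>\<^sup>2 * K\<^sup>2\<close> on the squared Lipschitz
    constant; the minimum is \<open>1 - (c / K)\<^sup>2\<close>.\<close>
  define \<tau> where "\<tau> = c / K\<^sup>2"
  have \<tau>: "\<tau> > 0" using c K by (simp add: \<tau>_def)
  have surj: "\<exists>x. a x = y" for y
  proof -
    define \<phi> where "\<phi> x = x - \<tau> *\<^sub>R (a x - y)" for x
    have lip: "dist (\<phi> x) (\<phi> z) \<le> sqrt (1 - (c / K)\<^sup>2) * dist x z" for x z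
    proof -
      let ?d = "x - z"
      have "\<phi> x - \<phi> z = ?d - \<tau> *\<^sub>R a ?d"
        by (simp add: \<phi>_def blinfun.diff_right algebra_simps)
      then have "(norm (\<phi> x - \<phi> z))\<^sup>2 = (norm ?d)\<^sup>2 - 2 * \<tau> * Re (cinner ?d (a ?d)) + \<tau>\<^sup>2 * (norm (a ?d))\<^sup>2"
        by (simp add: norm_diff_square cinner_simps power_mult_distrib)
      also have "\<dots> \<le> (norm ?d)\<^sup>2 - 2 * \<tau> * (c * (norm ?d)\<^sup>2) + \<tau>\<^sup>2 * (K * norm ?d)\<^sup>2"
      proof (intro add_mono[OF diff_mono[OF order_refl mult_left_mono[OF c(2)]]] mult_left_mono[OF power_mono])
        show "norm (a ?d) \<le> K * norm ?d"
          using order_trans[OF norm_blinfun[of a ?d] mult_right_mono[OF K(2) norm_ge_zero]] .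
      qed (use \<tau> in simp_all)
      also have "\<dots> = (1 - (c / K)\<^sup>2) * (norm ?d)\<^sup>2"
      proof -
        have "n\<^sup>2 - 2 * \<tau> * (c * n\<^sup>2) + \<tau>\<^sup>2 * (K * n)\<^sup>2 = (1 - (c / K)\<^sup>2) * n\<^sup>2" for n :: real
        proof -
          have "\<tau> * c = (c / K)\<^sup>2" "\<tau>\<^sup>2 * K\<^sup>2 = (c / K)\<^sup>2"
            using K(1) by (simp_all add: \<tau>_def power2_eq_square)
          then show ?thesis by (simp add: power_mult_distrib left_diff_distrib flip: mult.assoc)
        qed
        then show ?thesis .
      qed
      finally have "norm (\<phi> x - \<phi> z) \<le> sqrt ((1 - (c / K)\<^sup>2) * (norm ?d)\<^sup>2)"
        by (rule real_le_rsqrt)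
      then show ?thesis by (simp add: real_sqrt_mult dist_norm)
    qed
    have "0 < (c / K)\<^sup>2" "(c / K)\<^sup>2 \<le> 1" using K c by (simp_all add: power_le_one)
    then have "\<exists>!x. \<phi> x = x"
      by (intro banach_fix_type[of "sqrt (1 - (c / K)\<^sup>2)"] allI lip) simp_all
    then obtain x where "\<phi> x = x" by blast
    then have "a x = y" using \<tau> by (simp add: \<phi>_def)
    then show ?thesis by blast
  qed
  define f where "f y = (THE x. a x = y)" for y
  have af: "a (f y) = y" for y
  proof -
    obtain x where x: "a x = y" using surj by blast
    then have "f y = x" unfolding f_def by (rule the_equality) (simp add: inj x)
    then show ?thesis by (simp add: x)
  qed
  have "bounded_linear f"
  proof (rule bounded_linear_intro[where K = "1 / c"])
    show "norm (f x) \<le> norm x * (1 / c)" for x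
      using lower[of "f x"] c(1) by (simp add: af field_simps)
    show "f (x + y) = f x + f y" for x y by (rule inj) (simp add: af blinfun.add_right)
    show "f (r *\<^sub>R x) = r *\<^sub>R f x" for r x by (rule inj) (simp add: af blinfun.scaleR_right)
  qed
  then have bf: "blinfun_apply (Blinfun f) = f" by (rule bounded_linear_Blinfun_apply)
  show ?thesis
  proof
    show "Blinfun f \<in> bounded_ops"
      unfolding bounded_ops_def mem_Collect_eq bf
      by (rule allI, rule allI, rule inj) (use a in \<open>simp add: bounded_ops_def af\<close>)
    show "a o\<^sub>L Blinfun f = id_blinfun" by (rule blinfun_eqI) (simp add: bf af)
    show "Blinfun f o\<^sub>L a = id_blinfun" by (rule blinfun_eqI, rule inj) (simp add: bf af)
    show "norm (Blinfun f) \<le> 1 / c"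
    proof (rule norm_blinfun_bound)
      show "norm (Blinfun f x) \<le> 1 / c * norm x" for x
        using lower[of "f x"] c(1) by (simp add: af bf field_simps)
    qed (use c in simp)
  qed
qed

section \<open>Monotone sequences\<close>

text \<open>Quadratic forms converge as bounded monotone real sequences. The differences are
  positive with norm at most \<open>2 * K\<close>, so \<open>norm_square_le_form\<close> upgrades
  this to norm convergence at every vector.\<close>

lemma monotone_strong_limit:
  fixes T :: "nat \<Rightarrow> 'h::chilbert_space op"
  assumes T: "\<And>n. T n \<in> bounded_ops" "\<And>n. norm (T n) \<le> K" and mono: "\<And>n. op_le (T n) (T (Suc n))"
  obtains L where "L \<in> bounded_ops" "norm L \<le> K" "\<And>x. (\<lambda>n. T n x) \<longlonglongrightarrow> L x"
proof -
  have K: "0 \<le> K" using T(2)[of 0] norm_ge_zero order_trans by blast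
  have le: "op_le (T m) (T n)" if "m \<le> n" for m n
    using that
  proof (induction rule: dec_induct)
    case (step n)
    have "op_le 0 (T (Suc n) - T n + (T n - T m))"
      by (intro op_le_0_add) (use step mono op_le_diff in blast)+
    then show ?case by (simp add: op_le_diff[of "T m"])
  qed (rule op_le_refl)
  define r where "r x n = Re (cinner x (T n x))" for x n
  have "Cauchy (\<lambda>n. T n x)" for x
  proof -
    have inc: "r x m \<le> r x n" if "m \<le> n" for m n
      using le[OF that] by (simp add: op_le_def r_def blinfun.diff_left cinner_simps)
    have "r x n \<le> K * (norm x)\<^sup>2" for n
      using form_le_norm[of x "T n"] mult_right_mono[OF T(2)[of n], of "(norm x)\<^sup>2"] by (simp add: r_def)
    moreover have "incseq (r x)" using inc by (simp add: incseq_def)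
    ultimately have "convergent (r x)"
      using incseq_convergent[of "r x" "K * (norm x)\<^sup>2"] convergentI by metis
    then have r: "Cauchy (r x)" by (rule convergent_Cauchy)
    have est: "(norm (T n x - T m x))\<^sup>2 \<le> 2 * K * (r x n - r x m)" if "m \<le> n" for m n
    proof -
      have "(norm ((T n - T m) x))\<^sup>2 \<le> 2 * K * Re (cinner x ((T n - T m) x))"
      proof (rule norm_square_le_form)
        show "op_le 0 (T n - T m)" using le[OF that] by (rule op_le_diff[THEN iffD1])
        fix y
        have "norm (T n - T m) \<le> 2 * K"
          using norm_triangle_ineq4[of "T n" "T m"] T(2)[of n] T(2)[of m] by simp
        then show "Re (cinner y ((T n - T m) y)) \<le> 2 * K * (norm y)\<^sup>2"
          using form_le_norm[of y "T n - T m"] by (meson mult_right_mono order_trans zero_le_power2)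
      qed (use T K in auto)
      then show ?thesis by (simp add: r_def blinfun.diff_left cinner_simps)
    qed
    show ?thesis
    proof (rule CauchyI)
      fix e :: real assume e: "e > 0"
      \<comment> \<open>The added 1 covers \<open>K = 0\<close> and makes the final estimate
        strict.\<close>
      define d where "d = e\<^sup>2 / (2 * K + 1)"
      have d: "d > 0" using e K by (simp add: d_def add_nonneg_pos)
      then obtain M where M: "\<And>m n. m \<ge> M \<Longrightarrow> n \<ge> M \<Longrightarrow> \<bar>r x m - r x n\<bar> < d"
        using CauchyD[OF r] by (metis real_norm_def)
      have main: "norm (T n x - T m x) < e" if "m \<ge> M" "m \<le> n" for m n
      proof -
        have "(norm (T n x - T m x))\<^sup>2 \<le> 2 * K * d"
        proof -
          have "r x n - r x m \<le> d" using M[of n m] that by simp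
          then have "2 * K * (r x n - r x m) \<le> 2 * K * d" using K by (intro mult_left_mono) simp_all
          then show ?thesis using est[OF that(2)] by (rule order_trans[rotated])
        qed
        also have "\<dots> < (2 * K + 1) * d" using d by simp
        also have "\<dots> = e\<^sup>2" using K by (simp add: d_def)
        finally show ?thesis using e by (simp add: power2_less_imp_less)
      qed
      have "norm (T m x - T n x) < e" if "m \<ge> M" "n \<ge> M" for m n
        using main[of m n] main[of n m] that by (metis linorder_le_cases norm_minus_commute)
      then show "\<exists>M. \<forall>m\<ge>M. \<forall>n\<ge>M. norm (T m x - T n x) < e" by blast
    qed
  qed
  then have "\<exists>l. (\<lambda>n. T n x) \<longlonglongrightarrow> l" for x by (simp add: convergent_eq_Cauchy)
  then obtain l where l: "\<And>x. (\<lambda>n. T n x) \<longlonglongrightarrow> l x" by metis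
  have nl: "norm (l x) \<le> K * norm x" for x
  proof (rule Lim_norm_ubound[OF _ l])
    show "\<forall>\<^sub>F n in sequentially. norm (T n x) \<le> K * norm x"
      by (intro always_eventually allI order_trans[OF norm_blinfun mult_right_mono[OF T(2) norm_ge_zero]])
  qed simp
  have "bounded_linear l"
  proof (rule bounded_linear_intro[where K = K])
    show "l (x + y) = l x + l y" for x y
      using tendsto_add[OF l[of x] l[of y]] l[of "x + y"] LIMSEQ_unique by (simp add: blinfun.add_right)
    show "l (r *\<^sub>R x) = r *\<^sub>R l x" for r x
      using tendsto_scaleR[OF tendsto_const l[of x], of r] l[of "r *\<^sub>R x"] LIMSEQ_unique
      by (simp add: blinfun.scaleR_right)
    show "norm (l x) \<le> norm x * K" for x using nl[of x] by (simp add: mult.commute)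
  qed
  then have bl: "blinfun_apply (Blinfun l) = l" by (rule bounded_linear_Blinfun_apply)
  show ?thesis
  proof
    have "l (c *\<^sub>C x) = c *\<^sub>C l x" for c x
      using bounded_linear.tendsto[OF bounded_linear_scaleC l[of x], of c] l[of "c *\<^sub>C x"] T(1) LIMSEQ_unique
      by (simp add: bounded_ops_def)
    then show "Blinfun l \<in> bounded_ops" by (simp add: bounded_ops_def bl)
    show "norm (Blinfun l) \<le> K" by (rule norm_blinfun_bound[OF K]) (simp add: bl nl)
  qed (simp add: bl l)
qed

section \<open>Kernel projections\<close>

text \<open>An algebraic description by annihilation instead of a projection onto a closed subspace:
  uniqueness and commutation reduce to operator identities.\<close>

definition kernel_projection :: "'h::chilbert_space op \<Rightarrow> 'h op \<Rightarrow> bool" where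
  "kernel_projection f p \<longleftrightarrow> p \<in> bounded_ops \<and> adj p = p \<and> p o\<^sub>L p = p \<and> f o\<^sub>L p = 0 \<and>
     (\<forall>y\<in>bounded_ops. f o\<^sub>L y = 0 \<longrightarrow> p o\<^sub>L y = y)"

section \<open>Effects and their iterated squares\<close>

definition effect :: "'h::chilbert_space op \<Rightarrow> bool" where
  "effect a \<longleftrightarrow> a \<in> bounded_ops \<and> op_le 0 a \<and> (\<forall>x. Re (cinner x (a x)) \<le> (norm x)\<^sup>2)"

lemma effectD:
  assumes "effect a"
  shows "a \<in> bounded_ops" "op_le 0 a" "Re (cinner x (a x)) \<le> (norm x)\<^sup>2" "adj a = a"
  using assms op_le_0_selfadjoint by (auto simp: effect_def)

lemma effect_norm: "effect a \<Longrightarrow> norm a \<le> 1"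
  using norm_le_form[of a 1] by (simp add: effect_def)

lemma cinner_selfadjoint:
  "a \<in> bounded_ops \<Longrightarrow> adj a = a \<Longrightarrow> cinner x (a y) = cinner (a x) y"
  using cinner_adj_right[of a x y] by simp

lemma effect_square_form:
  assumes "effect a"
  shows "cinner x ((a o\<^sub>L a) x) = of_real ((norm (a x))\<^sup>2)"
    and "(norm (a x))\<^sup>2 \<le> Re (cinner x (a x))"
  using norm_square_le_form[of a 1 x] effectD[OF assms] cinner_selfadjoint[of a x "a x"]
  by (simp_all add: cinner_self)

lemma effect_square:
  assumes "effect a"
  shows "effect (a o\<^sub>L a)"
  unfolding effect_def op_le_0_iff effect_square_form(1)[OF assms]
  using order_trans[OF effect_square_form(2)[OF assms] effectD(3)[OF assms]] effectD(1)[OF assms]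
  by simp

lemma effect_square_le: "effect a \<Longrightarrow> op_le (a o\<^sub>L a) a"
  using effect_square_form[of a] effectD[of a] op_le_0D(1)[of a] unfolding op_le_def
  by (simp add: blinfun.diff_left cinner_diff_right del: blinfun_apply_blinfun_compose)

text \<open>The powers of \<open>a\<close> with exponents 2^n. For an effect each squaring decreases
  the operator, and passing to the limit in the recursion gives idempotence.\<close>

primrec square_iter :: "'h::chilbert_space op \<Rightarrow> nat \<Rightarrow> 'h op" where
  "square_iter a 0 = a"
| "square_iter a (Suc n) = square_iter a n o\<^sub>L square_iter a n"

lemma square_iter_mem: "closed_unital_algebra A \<Longrightarrow> a \<in> A \<Longrightarrow> square_iter a n \<in> A"
  by (induction n) (simp_all add: closed_unital_algebraD)

lemma effect_square_iter: "effect a \<Longrightarrow> effect (square_iter a n)"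
  by (induction n) (simp_all add: effect_square)

lemma op_le_form: "op_le a b \<Longrightarrow> Re (cinner x (a x)) \<le> Re (cinner x (b x))"
  by (simp add: op_le_def blinfun.diff_left cinner_diff_right)

text \<open>The limit is the projection onto the fixed vectors of \<open>a\<close>, that is, the
  spectral projection for the value 1. Signs are flipped to use the theorem on increasing
  sequences.\<close>

lemma square_iter_limit:
  fixes a :: "'h::chilbert_space op"
  assumes a: "effect a"
  obtains q where "q \<in> bounded_ops" "adj q = q" "q o\<^sub>L q = q" "\<And>n. square_iter a n o\<^sub>L q = q"
    "\<And>x. a x = x \<Longrightarrow> q x = x" "\<And>x. (\<lambda>n. square_iter a n x) \<longlonglongrightarrow> q x"
    "\<And>n. op_le q (square_iter a n)"
proof -
  let ?S = "square_iter a"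
  have S: "effect (?S n)" for n by (rule effect_square_iter[OF a])
  have dec: "op_le (?S (Suc n)) (?S n)" for n using effect_square_le[OF S] by simp
  have negS: "- ?S n \<in> bounded_ops" "norm (- ?S n) \<le> 1" "op_le (- ?S n) (- ?S (Suc n))" for n
    using effectD(1)[OF S] effect_norm[OF S] dec[of n] by (simp_all add: op_le_def)
  obtain L where L: "L \<in> bounded_ops" "norm L \<le> 1" "\<And>x. (\<lambda>n. (- ?S n) x) \<longlonglongrightarrow> L x"
    by (rule monotone_strong_limit[of "\<lambda>n. - ?S n", OF negS]) (rule that)
  define q where "q = - L"
  have qb: "q \<in> bounded_ops" using L by (simp add: q_def)
  have lim: "(\<lambda>n. ?S n x) \<longlonglongrightarrow> q x" for x
    using tendsto_minus[OF L(3)[of x]] by (simp add: q_def blinfun.minus_left)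
  have real: "Im (cinner x (q x)) = 0" for x
  proof -
    have "(\<lambda>n. Im (cinner x (?S n x))) \<longlonglongrightarrow> Im (cinner x (q x))" by (intro tendsto_intros lim)
    moreover have "Im (cinner x (?S n x)) = 0" for n using effectD(2)[OF S] op_le_0D by blast
    ultimately show ?thesis by (simp add: LIMSEQ_const_iff)
  qed
  have qadj: "adj q = q" by (rule selfadjoint_if_form_real[OF qb real])
  have le: "op_le q (?S n)" for n
    unfolding op_le_def
  proof
    fix x
    have "decseq (\<lambda>n. Re (cinner x (?S n x)))"
      using op_le_form[OF dec] by (simp add: decseq_Suc_iff)
    moreover have "(\<lambda>n. Re (cinner x (?S n x))) \<longlonglongrightarrow> Re (cinner x (q x))"
      by (intro tendsto_intros lim)
    ultimately have "Re (cinner x (q x)) \<le> Re (cinner x (?S n x))" by (rule decseq_ge)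
    then show "Im (cinner x ((?S n - q) x)) = 0 \<and> 0 \<le> Re (cinner x ((?S n - q) x))"
      using real[of x] op_le_0D(1)[OF effectD(2)[OF S[of n]], of x]
      by (simp add: blinfun.diff_left cinner_diff_right)
  qed
  \<comment> \<open>Since the iterates have norm at most 1, their squares converge strongly to the
    square of \<open>q\<close>; these squares are the same sequence shifted by one.\<close>
  have qq: "q o\<^sub>L q = q"
  proof (rule blinfun_eqI)
    fix x
    have "(\<lambda>n. ?S n (?S n x) - ?S n (q x)) \<longlonglongrightarrow> 0"
    proof (rule Lim_null_comparison)
      show "\<forall>\<^sub>F n in sequentially. norm (?S n (?S n x) - ?S n (q x)) \<le> norm (?S n x - q x)"
      proof (intro always_eventually allI)
        fix n
        have "norm (?S n (?S n x - q x)) \<le> 1 * norm (?S n x - q x)"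
          using order_trans[OF norm_blinfun mult_right_mono[OF effect_norm[OF S] norm_ge_zero]] .
        then show "norm (?S n (?S n x) - ?S n (q x)) \<le> norm (?S n x - q x)"
          by (simp add: blinfun.diff_right)
      qed
      show "(\<lambda>n. norm (?S n x - q x)) \<longlonglongrightarrow> 0"
        using lim[of x] by (simp add: LIM_zero tendsto_norm_zero)
    qed
    then have "(\<lambda>n. ?S n (?S n x) - ?S n (q x) + ?S n (q x)) \<longlonglongrightarrow> 0 + q (q x)"
      by (intro tendsto_add lim)
    then have "(\<lambda>n. ?S (Suc n) x) \<longlonglongrightarrow> q (q x)" by simp
    then show "(q o\<^sub>L q) x = q x" using LIMSEQ_Suc[OF lim[of x]] LIMSEQ_unique by auto
  qed
  \<comment> \<open>On the range of \<open>q\<close> the form of \<open>?S n\<close> is at least the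
    squared norm, while \<open>?S n\<close> does not increase norms. Equality in Cauchy-Schwarz
    forces a fixed vector.\<close>
  have fix_q: "?S n (q x) = q x" for n x
  proof -
    let ?y = "q x"
    have "q ?y = ?y" using qq by (metis blinfun_apply_blinfun_compose)
    then have "(norm ?y)\<^sup>2 \<le> Re (cinner ?y (?S n ?y))"
      using op_le_form[OF le[of n], of ?y] by (simp add: Re_cinner_self)
    moreover have "norm (?S n ?y) \<le> norm ?y"
      using order_trans[OF norm_blinfun mult_right_mono[OF effect_norm[OF S] norm_ge_zero]] by simp
    then have "(norm (?S n ?y))\<^sup>2 \<le> (norm ?y)\<^sup>2" by (simp add: power_mono)
    ultimately have "(norm (?y - ?S n ?y))\<^sup>2 \<le> 0" unfolding norm_diff_square by linarith
    then show ?thesis by simp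
  qed
  show ?thesis
  proof
    show "?S n o\<^sub>L q = q" for n by (rule blinfun_eqI) (simp add: fix_q)
    show "q x = x" if "a x = x" for x
    proof -
      have "?S n x = x" for n by (induction n) (simp_all add: that)
      then show ?thesis using lim[of x] by (simp add: LIMSEQ_const_iff)
    qed
  qed (fact qb qadj qq lim le)+
qed

text \<open>With \<^term>\<open>a = 1 - f\<^sup>2 / K\<^sup>2\<close> the fixed vectors of \<^term>\<open>a\<close> are the kernel of \<^term>\<open>f\<close>.\<close>

lemma kernel_projection_exists:
  fixes f :: "'h::chilbert_space op"
  assumes f: "f \<in> bounded_ops" "adj f = f"
  obtains a q where "effect a" "\<And>A. closed_unital_algebra A \<Longrightarrow> f \<in> A \<Longrightarrow> a \<in> A"
    "kernel_projection f q" "\<And>n. square_iter a n o\<^sub>L q = q"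
    "\<And>x. (\<lambda>n. square_iter a n x) \<longlonglongrightarrow> q x" "\<And>n. op_le q (square_iter a n)"
proof -
  define K where "K = norm f + 1"
  have K: "K > 0" "norm f \<le> K" by (auto simp: K_def add_nonneg_pos)
  define a where "a = id_blinfun - inverse (K\<^sup>2) *\<^sub>R (f o\<^sub>L f)"
  have ff: "cinner x ((f o\<^sub>L f) x) = of_real ((norm (f x))\<^sup>2)" for x
    using cinner_selfadjoint[OF f, of x "f x"] by (simp add: cinner_self)
  have form: "cinner x (a x) = of_real ((norm x)\<^sup>2 - inverse (K\<^sup>2) * (norm (f x))\<^sup>2)" for x
    using ff[of x] by (simp add: a_def blinfun.bilinear_simps cinner_simps cinner_self)
  have eff: "effect a"
    unfolding effect_def op_le_0_iff form
  proof (intro conjI allI)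
    show "a \<in> bounded_ops" using f by (simp add: a_def)
    fix x
    have "norm (f x) \<le> K * norm x" using order_trans[OF norm_blinfun mult_right_mono[OF K(2) norm_ge_zero]] .
    then have "(norm (f x))\<^sup>2 \<le> K\<^sup>2 * (norm x)\<^sup>2" by (metis norm_ge_zero power_mono power_mult_distrib)
    then show "0 \<le> Re (complex_of_real ((norm x)\<^sup>2 - inverse (K\<^sup>2) * (norm (f x))\<^sup>2))"
      using K(1) by (simp add: field_simps)
  qed simp_all
  obtain q where q: "q \<in> bounded_ops" "adj q = q" "q o\<^sub>L q = q" "\<And>n. square_iter a n o\<^sub>L q = q"
    "\<And>x. a x = x \<Longrightarrow> q x = x" "\<And>x. (\<lambda>n. square_iter a n x) \<longlonglongrightarrow> q x"
    "\<And>n. op_le q (square_iter a n)"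
    using square_iter_limit[OF eff] by blast
  have "f (q x) = 0" for x
  proof -
    have "a (q x) = q x" using q(4)[of 0] by (metis blinfun_apply_blinfun_compose square_iter.simps(1))
    then have "cinner (q x) (q x) = of_real ((norm (q x))\<^sup>2 - inverse (K\<^sup>2) * (norm (f (q x)))\<^sup>2)"
      using form[of "q x"] by simp
    then show ?thesis using K(1) unfolding cinner_self of_real_eq_iff by simp
  qed
  then have fq: "f o\<^sub>L q = 0" by (intro blinfun_eqI) simp
  have "q o\<^sub>L y = y" if "f o\<^sub>L y = 0" for y :: "'h op"
  proof (rule blinfun_eqI)
    fix x
    have "f (y x) = 0" using that by (metis blinfun.zero_left blinfun_apply_blinfun_compose)
    then have "a (y x) = y x" by (simp add: a_def blinfun.bilinear_simps)
    then show "(q o\<^sub>L y) x = y x" by (simp add: q(5))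
  qed
  then have kp: "kernel_projection f q" using q fq by (simp add: kernel_projection_def)
  have mem: "a \<in> A" if "closed_unital_algebra A" "f \<in> A" for A
    unfolding a_def using that by (intro closed_unital_algebraD)
  show ?thesis by (rule that[OF eff mem kp q(4,6,7)])
qed

lemma kernel_projection_ex: "f \<in> bounded_ops \<Longrightarrow> adj f = f \<Longrightarrow> \<exists>p. kernel_projection f p"
  by (rule kernel_projection_exists[of f]) auto

lemma kernel_projection_unique:
  assumes "kernel_projection f p" "kernel_projection f q"
  shows "p = q"
proof -
  have p: "p \<in> bounded_ops" "adj p = p" "f o\<^sub>L p = 0" and q: "q \<in> bounded_ops" "adj q = q" "f o\<^sub>L q = 0"
    using assms by (simp_all add: kernel_projection_def)
  have "q o\<^sub>L p = p" "p o\<^sub>L q = q"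
    using assms p q unfolding kernel_projection_def by blast+
  then show ?thesis by (metis adj_compose p(1,2) q(1,2))
qed

text \<open>Both \<open>u\<close> and its adjoint preserve the kernel of \<open>f\<close>.
  Invariance under \<open>adj u\<close>, after taking adjoints, supplies the missing half of
  commutation.\<close>

lemma kernel_projection_commute:
  assumes p: "kernel_projection f p" and u: "u \<in> bounded_ops"
    and comm: "f o\<^sub>L u = u o\<^sub>L f" "f o\<^sub>L adj u = adj u o\<^sub>L f"
  shows "p o\<^sub>L u = u o\<^sub>L p"
proof -
  have pb: "p \<in> bounded_ops" "adj p = p" "f o\<^sub>L p = 0" using p by (auto simp: kernel_projection_def)
  have inv: "p o\<^sub>L (w o\<^sub>L p) = w o\<^sub>L p" if "w \<in> bounded_ops" "f o\<^sub>L w = w o\<^sub>L f" for w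
  proof -
    have "f o\<^sub>L (w o\<^sub>L p) = 0" by (metis compose_assoc compose_zero(1) pb(3) that(2))
    then show ?thesis using p that(1) pb by (simp add: kernel_projection_def)
  qed
  have "adj (p o\<^sub>L (adj u o\<^sub>L p)) = adj (adj u o\<^sub>L p)" using inv[of "adj u"] u comm by simp
  then have "(p o\<^sub>L u) o\<^sub>L p = p o\<^sub>L u" using u pb by simp
  then show ?thesis using inv[OF u comm(1)] by (simp add: compose_assoc)
qed

section \<open>Unitary and invertible groups of operator algebras\<close>

lemma invertibles_iff:
  "g \<in> invertibles A \<longleftrightarrow> g \<in> A \<and> (\<exists>h\<in>A. g o\<^sub>L h = id_blinfun \<and> h o\<^sub>L g = id_blinfun)"
  by (auto simp: invertibles_def Units_def op_monoid_def)

lemma unitaries_iff: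
  "u \<in> unitaries A \<longleftrightarrow> u \<in> A \<and> adj u o\<^sub>L u = id_blinfun \<and> u o\<^sub>L adj u = id_blinfun"
  by (simp add: unitaries_def)

lemma inverse_unique:
  assumes "a o\<^sub>L b = id_blinfun" "c o\<^sub>L a = id_blinfun"
  shows "b = c"
proof -
  have "c o\<^sub>L (a o\<^sub>L b) = (c o\<^sub>L a) o\<^sub>L b" by (simp only: compose_assoc)
  then show ?thesis by (simp add: assms)
qed

lemma adj_inverse:
  "a \<in> bounded_ops \<Longrightarrow> b \<in> bounded_ops \<Longrightarrow> a o\<^sub>L b = id_blinfun \<Longrightarrow> adj b o\<^sub>L adj a = id_blinfun"
  by (metis adj_compose adj_id)

lemma cancel_middle: "b o\<^sub>L c = id_blinfun \<Longrightarrow> a o\<^sub>L b o\<^sub>L (c o\<^sub>L d) = a o\<^sub>L d"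
  using compose_assoc[of "a o\<^sub>L b" c d] compose_assoc[of a b c] by simp

text \<open>Left translation by \<open>a\<close> moves a connected set through 1 and
  \<open>b\<close> to one through \<open>a\<close> and \<open>a o\<^sub>L b\<close>.\<close>

lemma connected_component_compose:
  fixes S :: "'h::chilbert_space op set"
  assumes S: "\<And>a b. a \<in> S \<Longrightarrow> b \<in> S \<Longrightarrow> a o\<^sub>L b \<in> S"
    and a: "connected_component S id_blinfun a" and b: "connected_component S id_blinfun b"
  shows "connected_component S id_blinfun (a o\<^sub>L b)"
proof -
  obtain T where T: "connected T" "T \<subseteq> S" "id_blinfun \<in> T" "b \<in> T"
    using b by (auto simp: connected_component_def)
  have "a \<in> S" using a connected_component_in by blast
  have "connected ((o\<^sub>L) a ` T)"
    by (intro connected_continuous_image T continuous_intros)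
  moreover have "(o\<^sub>L) a ` T \<subseteq> S" using T(2) S[OF \<open>a \<in> S\<close>] by blast
  moreover have "a \<in> (o\<^sub>L) a ` T" "a o\<^sub>L b \<in> (o\<^sub>L) a ` T"
    using imageI[OF T(3), of "(o\<^sub>L) a"] imageI[OF T(4), of "(o\<^sub>L) a"] by simp_all
  ultimately have "connected_component S a (a o\<^sub>L b)"
    unfolding connected_component_def by blast
  with a show ?thesis by (rule connected_component_trans)
qed

text \<open>The common ground of \<open>M\<close>, \<open>N\<close> and the centralizer. The
  centralizer can be shown to satisfy these axioms directly, without first being exhibited as a
  bicommutant.\<close>

locale op_algebra =
  fixes A :: "'h::chilbert_space op set"
  assumes bounded: "A \<subseteq> bounded_ops"
    and closed_unital: "closed_unital_algebra A"
    and adj_closed: "a \<in> A \<Longrightarrow> adj a \<in> A"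
    and scaleC_closed: "a \<in> A \<Longrightarrow> c *\<^sub>C a \<in> A"
    and inverse_closed: "a \<in> A \<Longrightarrow> b \<in> bounded_ops \<Longrightarrow> a o\<^sub>L b = id_blinfun \<Longrightarrow> b o\<^sub>L a = id_blinfun \<Longrightarrow> b \<in> A"
begin

lemma algebra_mem [simp]:
  shows "id_blinfun \<in> A" "0 \<in> A"
    and "a \<in> A \<Longrightarrow> b \<in> A \<Longrightarrow> a o\<^sub>L b \<in> A"
    and "a \<in> A \<Longrightarrow> b \<in> A \<Longrightarrow> a + b \<in> A"
    and "a \<in> A \<Longrightarrow> b \<in> A \<Longrightarrow> a - b \<in> A"
    and "a \<in> A \<Longrightarrow> r *\<^sub>R a \<in> A"
    and "a \<in> A \<Longrightarrow> c *\<^sub>C a \<in> A"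
    and "a \<in> A \<Longrightarrow> adj a \<in> A"
    and "a \<in> A \<Longrightarrow> a \<in> bounded_ops"
  using closed_unital_algebraD[OF closed_unital] scaleC_closed adj_closed bounded by auto

lemma unitaries_compose: "u \<in> unitaries A \<Longrightarrow> v \<in> unitaries A \<Longrightarrow> u o\<^sub>L v \<in> unitaries A"
  unfolding unitaries_iff by (simp add: cancel_middle)

lemma unitaries_id: "id_blinfun \<in> unitaries A"
  by (simp add: unitaries_iff)

lemma invertibles_compose:
  assumes "a \<in> invertibles A" "b \<in> invertibles A"
  shows "a o\<^sub>L b \<in> invertibles A"
proof -
  obtain a' b' where "a' \<in> A" "a o\<^sub>L a' = id_blinfun" "a' o\<^sub>L a = id_blinfun"
    "b' \<in> A" "b o\<^sub>L b' = id_blinfun" "b' o\<^sub>L b = id_blinfun"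
    using assms by (auto simp: invertibles_iff)
  then show ?thesis
    using assms by (auto simp: invertibles_iff cancel_middle intro!: bexI[of _ "b' o\<^sub>L a'"])
qed

lemma unitaries_subset_invertibles: "unitaries A \<subseteq> invertibles A"
  unfolding unitaries_iff invertibles_iff subset_iff by (blast intro: adj_closed)

lemma coercive_invertibles:
  assumes "a \<in> A" "c > 0" "\<And>x. c * (norm x)\<^sup>2 \<le> Re (cinner x (a x))"
  shows "a \<in> invertibles A"
proof -
  obtain b where "b \<in> bounded_ops" "a o\<^sub>L b = id_blinfun" "b o\<^sub>L a = id_blinfun"
    using coercive_invertible[of a c] assms by (metis algebra_mem(9))
  then show ?thesis using assms(1) inverse_closed[of a b] by (auto simp: invertibles_iff)
qed

lemma sqrt_in_algebra:
  assumes "a \<in> A" "op_le 0 a"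
  obtains s where "s \<in> A" "op_le 0 s" "adj s = s" "s o\<^sub>L s = a"
    "\<And>C. closed_unital_algebra C \<Longrightarrow> a \<in> C \<Longrightarrow> s \<in> C"
  using sqrt_exists[of a] assms closed_unital op_le_0_selfadjoint by (metis algebra_mem(9))

text \<open>\<open>s o\<^sub>L k\<close> is a right inverse of \<open>s\<close> and
  \<open>k o\<^sub>L s\<close> a left inverse, so they coincide; their product is
  \<open>k\<close>.\<close>

lemma sqrt_invertible:
  assumes s: "s \<in> A" and k: "k \<in> A" "(s o\<^sub>L s) o\<^sub>L k = id_blinfun" "k o\<^sub>L (s o\<^sub>L s) = id_blinfun"
  obtains t where "t \<in> A" "s o\<^sub>L t = id_blinfun" "t o\<^sub>L s = id_blinfun" "t o\<^sub>L t = k"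
proof -
  have 1: "s o\<^sub>L (s o\<^sub>L k) = id_blinfun" and 2: "(k o\<^sub>L s) o\<^sub>L s = id_blinfun"
    using k by (simp_all add: compose_assoc)
  have eq: "s o\<^sub>L k = k o\<^sub>L s" by (rule inverse_unique[OF 1 2])
  have "(k o\<^sub>L s) o\<^sub>L (s o\<^sub>L k) = k"
    using k(2) by (simp add: compose_assoc)
  then show ?thesis using that[of "s o\<^sub>L k"] 1 2 s k eq by simp
qed

text \<open>The final clause, membership of \<open>r\<close> in every closed algebra containing
  \<open>adj g o\<^sub>L g\<close>, is what later places the positive part of an element of
  \<open>N\<close> in the centralizer as well.\<close>

lemma polar_decomposition:
  assumes "g \<in> invertibles A"
  obtains u r t where "u \<in> unitaries A" "r \<in> A" "op_le 0 r" "adj r = r" "r o\<^sub>L r = adj g o\<^sub>L g"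
    "t \<in> A" "r o\<^sub>L t = id_blinfun" "t o\<^sub>L r = id_blinfun" "g = u o\<^sub>L r"
    "\<And>C. closed_unital_algebra C \<Longrightarrow> adj g o\<^sub>L g \<in> C \<Longrightarrow> r \<in> C"
proof -
  obtain h where g: "g \<in> A" and h: "h \<in> A" "g o\<^sub>L h = id_blinfun" "h o\<^sub>L g = id_blinfun"
    using assms by (auto simp: invertibles_iff)
  have h': "adj h o\<^sub>L adj g = id_blinfun" "adj g o\<^sub>L adj h = id_blinfun"
    using adj_inverse[of g h] adj_inverse[of h g] g h by simp_all
  obtain r where r: "r \<in> A" "op_le 0 r" "adj r = r" "r o\<^sub>L r = adj g o\<^sub>L g"
    "\<And>C. closed_unital_algebra C \<Longrightarrow> adj g o\<^sub>L g \<in> C \<Longrightarrow> r \<in> C"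
    using sqrt_in_algebra[of "adj g o\<^sub>L g"] op_le_0_adj_compose[of g] g by (metis algebra_mem(3,8,9))
  obtain t where t: "t \<in> A" "r o\<^sub>L t = id_blinfun" "t o\<^sub>L r = id_blinfun" "t o\<^sub>L t = h o\<^sub>L adj h"
  proof (rule sqrt_invertible[OF r(1), of "h o\<^sub>L adj h"])
    show "(r o\<^sub>L r) o\<^sub>L (h o\<^sub>L adj h) = id_blinfun" "(h o\<^sub>L adj h) o\<^sub>L (r o\<^sub>L r) = id_blinfun"
      using h h' by (simp_all add: r(4) cancel_middle)
  qed (use h in simp_all)
  have tadj: "adj t = t"
    using adj_inverse[of r t] r t by (metis algebra_mem(9) inverse_unique)
  define u where "u = g o\<^sub>L t"
  have "adj u o\<^sub>L u = t o\<^sub>L (adj g o\<^sub>L g) o\<^sub>L t"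
    using g t by (simp add: u_def tadj compose_assoc)
  also have "\<dots> = (t o\<^sub>L r) o\<^sub>L (r o\<^sub>L t)" by (simp add: compose_assoc flip: r(4))
  finally have 1: "adj u o\<^sub>L u = id_blinfun" by (simp add: t)
  have "u o\<^sub>L adj u = g o\<^sub>L (t o\<^sub>L t) o\<^sub>L adj g"
    using g t(1) by (simp add: u_def tadj compose_assoc)
  also have "\<dots> = (g o\<^sub>L h) o\<^sub>L (adj h o\<^sub>L adj g)" unfolding t(4) by (simp add: compose_assoc)
  finally have 2: "u o\<^sub>L adj u = id_blinfun" by (simp add: h h')
  have "g = u o\<^sub>L r" by (simp add: u_def compose_assoc t(3))
  moreover have "u \<in> unitaries A" using 1 2 g t by (simp add: unitaries_iff u_def)
  ultimately show ?thesis using that r t by blast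
qed

text \<open>The path \<open>(1 + t v) (1 + t v\<^sup>*)\<^sup>-\<^sup>1\<close> joins 1 to \<open>v\<close> inside the unitaries.\<close>

lemma unitary_accretive_connected:
  assumes v: "v \<in> unitaries A" and re: "\<And>x. 0 \<le> Re (cinner x (v x))"
  shows "connected_component (unitaries A) id_blinfun v"
proof -
  have vA: "v \<in> A" "adj v o\<^sub>L v = id_blinfun" "v o\<^sub>L adj v = id_blinfun"
    using v by (simp_all add: unitaries_iff)
  define y z where "y t = id_blinfun + t *\<^sub>R v" and "z t = id_blinfun + t *\<^sub>R adj v" for t :: real
  have yz: "y t \<in> A" "z t \<in> A" "adj (y t) = z t" "adj (z t) = y t" for t
    using vA by (simp_all add: y_def z_def)
  have comm: "y t o\<^sub>L z t = z t o\<^sub>L y t" for t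
    using vA by (simp add: y_def z_def compose_simps algebra_simps)
  have "\<exists>b. b \<in> bounded_ops \<and> z t o\<^sub>L b = id_blinfun \<and> b o\<^sub>L z t = id_blinfun \<and> norm b \<le> 1"
    if t: "t \<in> {0..1}" for t
  proof -
    \<comment> \<open>The nonnegative real part of \<open>v\<close> enters here: it makes
      \<open>z t\<close> coercive with constant 1 for all \<open>t\<close> at once, so the inverses
      are uniformly bounded.\<close>
    have "1 * (norm x)\<^sup>2 \<le> Re (cinner x (z t x))" for x
      using re[of x] t vA Re_cinner_commute[of x "v x"]
      by (simp add: z_def blinfun.bilinear_simps cinner_simps cinner_adj_right Re_cinner_self)
    then show ?thesis using coercive_invertible[of "z t" 1] yz by (metis algebra_mem(9) div_by_1 zero_less_one)
  qed
  then obtain i where i: "\<And>t. t \<in> {0..1} \<Longrightarrow> i t \<in> bounded_ops \<and> z t o\<^sub>L i t = id_blinfun \<and>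
      i t o\<^sub>L z t = id_blinfun \<and> norm (i t) \<le> 1" by metis
  have iA: "i t \<in> A" if "t \<in> {0..1}" for t using i[OF that] inverse_closed yz by blast
  define w where "w t = y t o\<^sub>L i t" for t
  have wU: "w t \<in> unitaries A" if t: "t \<in> {0..1}" for t
  proof -
    note I = i[OF t]
    have ai: "y t o\<^sub>L adj (i t) = id_blinfun" "adj (i t) o\<^sub>L y t = id_blinfun"
      using adj_inverse[of "z t" "i t"] adj_inverse[of "i t" "z t"] I yz by simp_all
    have aw: "adj (w t) = adj (i t) o\<^sub>L z t" using I yz by (simp add: w_def)
    have yi: "y t o\<^sub>L i t = i t o\<^sub>L y t"
    proof -
      have "(i t o\<^sub>L z t) o\<^sub>L (y t o\<^sub>L i t) = i t o\<^sub>L (z t o\<^sub>L y t) o\<^sub>L i t"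
        by (simp only: compose_assoc)
      also have "\<dots> = (i t o\<^sub>L y t) o\<^sub>L (z t o\<^sub>L i t)"
        by (simp only: compose_assoc flip: comm)
      finally show ?thesis using I by simp
    qed
    have "adj (w t) o\<^sub>L w t = adj (i t) o\<^sub>L (z t o\<^sub>L y t) o\<^sub>L i t"
      by (simp only: aw) (simp add: w_def compose_assoc)
    also have "\<dots> = (adj (i t) o\<^sub>L y t) o\<^sub>L (z t o\<^sub>L i t)"
      by (simp add: compose_assoc flip: comm)
    finally have 1: "adj (w t) o\<^sub>L w t = id_blinfun" using I ai by simp
    have "w t o\<^sub>L adj (w t) = i t o\<^sub>L (y t o\<^sub>L adj (i t)) o\<^sub>L z t"
      by (simp only: aw) (simp add: w_def yi compose_assoc)
    then have "w t o\<^sub>L adj (w t) = id_blinfun" using I ai by simp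
    then show ?thesis using 1 iA[OF t] yz by (simp add: unitaries_iff w_def)
  qed
  have "continuous_on {0..1} i"
  proof -
    have "dist (i s) (i t) \<le> norm (adj v) * dist s t" if s: "s \<in> {0..1}" and t: "t \<in> {0..1}" for s t
    proof -
      \<comment> \<open>The resolvent identity; with the uniform bound on the inverses it makes
        \<open>i\<close> Lipschitz.\<close>
      have "i s - i t = i s o\<^sub>L (z t - z s) o\<^sub>L i t"
        using i[OF s] i[OF t] by (simp add: compose_simps) (simp add: compose_assoc)
      also have "z t - z s = (t - s) *\<^sub>R adj v" by (simp add: z_def algebra_simps)
      finally have eq: "i s - i t = i s o\<^sub>L ((t - s) *\<^sub>R adj v) o\<^sub>L i t" .
      have "norm (i s - i t) \<le> norm (i s) * norm ((t - s) *\<^sub>R adj v) * norm (i t)"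
        unfolding eq by (intro order_trans[OF norm_blinfun_compose mult_right_mono[OF norm_blinfun_compose norm_ge_zero]])
      also have "\<dots> \<le> 1 * norm ((t - s) *\<^sub>R adj v) * 1"
        using i[OF s] i[OF t] by (intro mult_mono) simp_all
      finally show ?thesis by (simp add: dist_norm abs_minus_commute mult.commute)
    qed
    then show ?thesis
      by (intro lipschitz_on_continuous_on[of "norm (adj v)"] lipschitz_onI) simp_all
  qed
  then have "continuous_on {0..1} w"
    unfolding w_def y_def by (intro continuous_intros)
  then have conn: "connected (w ` {0..1})"
    by (intro connected_continuous_image) simp_all
  have w0: "w 0 = id_blinfun" using i[of 0] by (simp add: w_def y_def z_def)
  have w1: "w 1 = v"
  proof -
    \<comment> \<open>Unitarity gives \<open>v o\<^sub>L adj v = id_blinfun\<close>, so at the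
      endpoint \<open>v\<close> factors out of \<open>1 + v\<close> and leaves
      \<open>z 1\<close>.\<close>
    have "y 1 = v o\<^sub>L z 1" using vA by (simp add: y_def z_def compose_simps)
    then show ?thesis using i[of 1] by (simp add: w_def compose_assoc)
  qed
  have "w ` {0..1} \<subseteq> unitaries A" using wU by blast
  moreover have "id_blinfun \<in> w ` {0..1}" "v \<in> w ` {0..1}"
    using w0 w1 by (metis atLeastAtMost_iff imageI order_refl zero_le_one)+
  ultimately show ?thesis using conn by (auto simp: connected_component_def)
qed

end

text \<open>Kernel projections are strong limits, so norm closedness does not supply them; hence a
  separate axiom.\<close>

locale spectral_algebra = op_algebra +
  assumes kernel_projection_mem: "f \<in> A \<Longrightarrow> adj f = f \<Longrightarrow> kernel_projection f p \<Longrightarrow> p \<in> A"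
begin

text \<open>Multiplying \<^term>\<open>u\<close> by the sign of its real part \<^term>\<open>a\<close> gives a unitary whose real part is
  \<open>\<bar>a\<bar>\<close>; the sign itself is a product of unitaries with vanishing real part.\<close>

lemma unitary_connected:
  assumes u: "u \<in> unitaries A"
  shows "connected_component (unitaries A) id_blinfun u"
proof -
  let ?U = "unitaries A"
  have uA: "u \<in> A" "adj u o\<^sub>L u = id_blinfun" "u o\<^sub>L adj u = id_blinfun"
    using u by (simp_all add: unitaries_iff)
  define a where "a = (1/2) *\<^sub>R (u + adj u)"
  have a: "a \<in> A" "adj a = a" using uA by (simp_all add: a_def add.commute)
  have au: "a o\<^sub>L u = u o\<^sub>L a" "a o\<^sub>L adj u = adj u o\<^sub>L a"
    by (simp_all add: a_def compose_simps uA)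
  have "op_le 0 (a o\<^sub>L a)" using op_le_0_adj_compose[of a] a by simp
  then obtain r where r: "r \<in> A" "op_le 0 r" "adj r = r" "r o\<^sub>L r = a o\<^sub>L a"
    "\<And>C. closed_unital_algebra C \<Longrightarrow> a o\<^sub>L a \<in> C \<Longrightarrow> r \<in> C"
    using sqrt_in_algebra[of "a o\<^sub>L a"] a by (metis algebra_mem(3))
  have rcomm: "r o\<^sub>L x = x o\<^sub>L r" if "a o\<^sub>L x = x o\<^sub>L a" for x
  proof -
    have "(a o\<^sub>L a) o\<^sub>L x = x o\<^sub>L (a o\<^sub>L a)" using that by (metis compose_assoc)
    then show ?thesis using r(5)[OF closed_unital_algebra_commuting, of x] by simp
  qed
  \<comment> \<open>With \<open>r\<close> the absolute value of \<open>a\<close>, \<open>f\<close>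
    is twice the positive part of \<open>a\<close>. Its kernel projection \<open>p\<close> carries
    the nonpositive part, and \<open>id_blinfun - 2 *\<^sub>R p\<close> is a sign of
    \<open>a\<close> that is unitary even where \<open>a\<close> vanishes.\<close>
  define f where "f = r + a"
  have f: "f \<in> A" "adj f = f" using r a by (simp_all add: f_def)
  obtain p where kp: "kernel_projection f p" using kernel_projection_ex[of f] f by auto
  have p: "p \<in> A" "adj p = p" "p o\<^sub>L p = p" "f o\<^sub>L p = 0"
    using kernel_projection_mem[OF f kp] kp unfolding kernel_projection_def by blast+
  have pu: "p o\<^sub>L u = u o\<^sub>L p"
  proof (rule kernel_projection_commute[OF kp])
    show "u \<in> bounded_ops" using uA by simp
    show "f o\<^sub>L u = u o\<^sub>L f"
      unfolding f_def compose_simps rcomm[OF au(1)] au(1) ..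
    show "f o\<^sub>L adj u = adj u o\<^sub>L f"
      unfolding f_def compose_simps rcomm[OF au(2)] au(2) ..
  qed
  have "adj (p o\<^sub>L u) = adj (u o\<^sub>L p)" by (simp only: pu)
  then have pu': "p o\<^sub>L adj u = adj u o\<^sub>L p" using p uA by simp
  define s where "s = id_blinfun - 2 *\<^sub>R p"
  have s: "s \<in> A" "adj s = s" using p by (simp_all add: s_def)
  have ss: "s o\<^sub>L s = id_blinfun"
    by (simp add: s_def compose_simps p(3) scaleR_2)
  have sU: "s \<in> ?U" using s ss by (simp add: unitaries_iff)
  \<comment> \<open>As \<open>f\<close> annihilates \<open>r - a\<close>, the projection
    \<open>p\<close> fixes \<open>r - a\<close>, while \<open>f o\<^sub>L p = 0\<close>. The two
    relations determine \<open>a o\<^sub>L p\<close>.\<close>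
  have as: "a o\<^sub>L s = r"
  proof -
    have "f o\<^sub>L (r - a) = 0" using rcomm[of a] r(4) by (simp add: f_def compose_simps)
    then have "p o\<^sub>L (r - a) = r - a" using kp r a by (simp add: kernel_projection_def)
    then have "adj (p o\<^sub>L (r - a)) = adj (r - a)" by simp
    then have "(r - a) o\<^sub>L p = r - a" using p r a by simp
    then have 1: "(r o\<^sub>L p) - (a o\<^sub>L p) = r - a" by (simp add: compose_simps)
    have 2: "(r o\<^sub>L p) + (a o\<^sub>L p) = 0" using p(4) by (simp add: f_def compose_simps)
    have "a o\<^sub>L s = a - 2 *\<^sub>R (a o\<^sub>L p)" by (simp add: s_def compose_simps)
    also have "\<dots> = a + ((r o\<^sub>L p) - (a o\<^sub>L p)) - ((r o\<^sub>L p) + (a o\<^sub>L p))" by (simp add: scaleR_2)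
    also have "\<dots> = r" unfolding 1 2 by simp
    finally show ?thesis .
  qed
  define v where "v = u o\<^sub>L s"
  have vU: "v \<in> ?U" unfolding v_def using u sU by (rule unitaries_compose)
  have vA: "v \<in> A" using vU by (simp add: unitaries_iff)
  have vadj: "adj v = adj u o\<^sub>L s" using uA s pu' by (simp add: v_def) (simp add: s_def compose_simps pu')
  have vre: "0 \<le> Re (cinner x (v x))" for x
  proof -
    have "(1/2) *\<^sub>R (v + adj v) = r"
      unfolding vadj unfolding as[symmetric] by (simp add: v_def a_def compose_simps)
    then have "Re (cinner x (r x)) = Re (cinner x (((1/2) *\<^sub>R (v + adj v)) x))" by simp
    also have "\<dots> = Re (cinner x (v x))"
      using vA Re_cinner_commute[of "v x" x]
      by (simp add: blinfun.bilinear_simps cinner_simps cinner_adj_right)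
    finally show ?thesis using op_le_0D(2)[OF r(2), of x] by simp
  qed
  have cu: "c *\<^sub>C w \<in> ?U" if "cmod c = 1" "w \<in> ?U" for c w
  proof -
    have cc: "c * cnj c = 1" using complex_norm_square[of c] that(1) by simp
    have w: "w \<in> A" "adj w o\<^sub>L w = id_blinfun" "w o\<^sub>L adj w = id_blinfun"
      using that by (simp_all add: unitaries_iff)
    have lin: "adj w (d *\<^sub>C x) = d *\<^sub>C adj w x" "w (d *\<^sub>C x) = d *\<^sub>C w x" for d x
      using algebra_mem(9)[OF w(1)] algebra_mem(9)[OF adj_closed[OF w(1)]] by (simp_all add: bounded_ops_def)
    have "(cnj c *\<^sub>C adj w) o\<^sub>L (c *\<^sub>C w) = (c * cnj c) *\<^sub>C (adj w o\<^sub>L w)"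
      "(c *\<^sub>C w) o\<^sub>L (cnj c *\<^sub>C adj w) = (c * cnj c) *\<^sub>C (w o\<^sub>L adj w)"
      by (rule blinfun_eqI, simp add: scaleC_blinfun.rep_eq lin scaleC_scaleC mult.commute)+
    then show ?thesis using w by (simp add: unitaries_iff cc scaleC_one)
  qed
  have isU: "connected_component ?U id_blinfun (\<i> *\<^sub>C s)"
  proof (rule unitary_accretive_connected)
    show "\<i> *\<^sub>C s \<in> ?U" using cu sU by simp
    show "0 \<le> Re (cinner x ((\<i> *\<^sub>C s) x))" for x
      using selfadjoint_Im[of s x] s by (simp add: scaleC_blinfun.rep_eq cinner_simps)
  qed
  have mi: "connected_component ?U id_blinfun ((- \<i>) *\<^sub>C id_blinfun)"
  proof (rule unitary_accretive_connected)
    show "(- \<i>) *\<^sub>C id_blinfun \<in> ?U" using cu[of "- \<i>"] unitaries_id by simp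
    show "0 \<le> Re (cinner x (((- \<i>) *\<^sub>C id_blinfun) x))" for x
      by (simp add: blinfun.minus_left scaleC_blinfun.rep_eq cinner_simps cinner_self)
  qed
  have "connected_component ?U id_blinfun (v o\<^sub>L (((- \<i>) *\<^sub>C id_blinfun) o\<^sub>L (\<i> *\<^sub>C s)))"
    by (intro connected_component_compose unitaries_compose isU mi unitary_accretive_connected vU vre)
  also have "((- \<i>) *\<^sub>C id_blinfun) o\<^sub>L (\<i> *\<^sub>C s) = s"
    by (rule blinfun_eqI) (simp add: blinfun.minus_left scaleC_blinfun.rep_eq scaleC_scaleC scaleC_one)
  also have "v o\<^sub>L s = u" by (simp add: v_def compose_assoc ss)
  finally show ?thesis .
qed

text \<open>The positive factor is joined to 1 by a segment: before the endpoint its elements are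
  coercive with constant \<open>1 - s\<close>, and at the endpoint \<open>r\<close> is invertible
  already.\<close>

lemma invertible_connected:
  assumes g: "g \<in> invertibles A"
  shows "connected_component (invertibles A) id_blinfun g"
proof -
  obtain u r t where u: "u \<in> unitaries A" and r: "r \<in> A" "op_le 0 r"
    and t: "t \<in> A" "r o\<^sub>L t = id_blinfun" "t o\<^sub>L r = id_blinfun" and gu: "g = u o\<^sub>L r"
    using polar_decomposition[OF g] by metis
  have "connected_component (invertibles A) id_blinfun u"
    using connected_component_mono[OF unitaries_subset_invertibles] unitary_connected[OF u]
    by blast
  moreover have "connected_component (invertibles A) id_blinfun r"
  proof -
    define c where "c s = (1 - s) *\<^sub>R id_blinfun + s *\<^sub>R r" for s :: real
    have "c s \<in> invertibles A" if s: "s \<in> {0..1}" for s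
    proof (cases "s = 1")
      case True
      then show ?thesis using r t by (auto simp: c_def invertibles_iff)
    next
      case False
      show ?thesis
      proof (rule coercive_invertibles)
        show "c s \<in> A" using r by (simp add: c_def)
        show "0 < 1 - s" using s False by simp
        show "(1 - s) * (norm x)\<^sup>2 \<le> Re (cinner x (c s x))" for x
          using s op_le_0D(2)[OF r(2), of x]
          by (simp add: c_def blinfun.bilinear_simps cinner_simps Re_cinner_self)
      qed
    qed
    moreover have "connected (c ` {0..1})"
      unfolding c_def by (intro connected_continuous_image continuous_intros) simp
    moreover have "c 0 = id_blinfun" "c 1 = r" by (simp_all add: c_def)
    then have "id_blinfun \<in> c ` {0..1}" "r \<in> c ` {0..1}"
      by (metis atLeastAtMost_iff imageI order_refl zero_le_one)+
    ultimately show ?thesis unfolding connected_component_def by blast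
  qed
  ultimately show ?thesis unfolding gu by (intro connected_component_compose invertibles_compose)
qed

end

section \<open>Von Neumann algebras\<close>

lemma commutant_iff: "x \<in> commutant S \<longleftrightarrow> x \<in> bounded_ops \<and> (\<forall>s\<in>S. x o\<^sub>L s = s o\<^sub>L x)"
  by (simp add: commutant_def)

lemma closed_unital_algebra_Inter:
  assumes "\<And>i. i \<in> I \<Longrightarrow> closed_unital_algebra (C i)"
  shows "closed_unital_algebra (\<Inter>i\<in>I. C i)"
  using assms unfolding closed_unital_algebra_def subspace_def by (auto intro: closed_INT)

lemma closed_unital_algebra_Int:
  "closed_unital_algebra A \<Longrightarrow> closed_unital_algebra B \<Longrightarrow> closed_unital_algebra (A \<inter> B)"
  unfolding closed_unital_algebra_def subspace_def by (auto intro: closed_Int)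

lemma closed_unital_algebra_bounded_ops: "closed_unital_algebra bounded_ops"
  by (simp add: closed_unital_algebra_def closed_bounded_ops subspace_def)

lemma closed_unital_algebra_commutant: "closed_unital_algebra (commutant S)"
proof -
  have "commutant S = bounded_ops \<inter> (\<Inter>s\<in>S. {y. y o\<^sub>L s = s o\<^sub>L y})"
    by (auto simp: commutant_def)
  then show ?thesis
    by (simp add: closed_unital_algebra_Int closed_unital_algebra_bounded_ops
        closed_unital_algebra_Inter closed_unital_algebra_commuting)
qed

lemma commutant_adj:
  assumes "S \<subseteq> bounded_ops" "\<And>s. s \<in> S \<Longrightarrow> adj s \<in> S" and a: "a \<in> commutant S"
  shows "adj a \<in> commutant S"
  unfolding commutant_iff
proof (intro conjI ballI)
  show "adj a \<in> bounded_ops" using a by (simp add: commutant_iff)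
  fix s assume s: "s \<in> S"
  have ab: "a \<in> bounded_ops" and sb: "s \<in> bounded_ops" using a s assms(1) by (auto simp: commutant_iff)
  have "a o\<^sub>L adj s = adj s o\<^sub>L a" using a assms(2)[OF s] by (simp add: commutant_iff)
  then have "adj (a o\<^sub>L adj s) = adj (adj s o\<^sub>L a)" by (rule arg_cong)
  then show "adj a o\<^sub>L s = s o\<^sub>L adj a" using ab sb by simp
qed

lemma inverse_commute:
  assumes "a o\<^sub>L b = id_blinfun" "b o\<^sub>L a = id_blinfun" "a o\<^sub>L s = s o\<^sub>L a"
  shows "b o\<^sub>L s = s o\<^sub>L b"
proof -
  have "b o\<^sub>L s = (b o\<^sub>L s) o\<^sub>L (a o\<^sub>L b)" by (simp add: assms)
  also have "\<dots> = b o\<^sub>L (s o\<^sub>L a) o\<^sub>L b" by (simp only: compose_assoc)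
  also have "\<dots> = (b o\<^sub>L a) o\<^sub>L (s o\<^sub>L b)" by (simp only: compose_assoc flip: assms(3))
  finally show ?thesis by (simp add: assms)
qed

lemma spectral_algebra_commutant:
  fixes S :: "'h::chilbert_space op set"
  assumes S: "S \<subseteq> bounded_ops" "\<And>s. s \<in> S \<Longrightarrow> adj s \<in> S"
  shows "spectral_algebra (commutant S)"
proof
  show "commutant S \<subseteq> bounded_ops" by (auto simp: commutant_iff)
  show "closed_unital_algebra (commutant S)" by (rule closed_unital_algebra_commutant)
  fix a b c f p assume a: "a \<in> commutant S"
  show "adj a \<in> commutant S" by (rule commutant_adj[OF S a])
  show "c *\<^sub>C a \<in> commutant S"
    unfolding commutant_iff
  proof (intro conjI ballI)
    show "c *\<^sub>C a \<in> bounded_ops" using a by (simp add: commutant_iff)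
    fix s assume "s \<in> S"
    then have "a o\<^sub>L s = s o\<^sub>L a" "s \<in> bounded_ops" using a S by (auto simp: commutant_iff)
    then have "a (s x) = s (a x)" "s (c *\<^sub>C a x) = c *\<^sub>C s (a x)" for x
      by (metis blinfun_apply_blinfun_compose, simp add: bounded_ops_def)
    then show "c *\<^sub>C a o\<^sub>L s = s o\<^sub>L c *\<^sub>C a"
      by (intro blinfun_eqI) (simp add: scaleC_blinfun.rep_eq)
  qed
  show "b \<in> commutant S" if "b \<in> bounded_ops" "a o\<^sub>L b = id_blinfun" "b o\<^sub>L a = id_blinfun"
    using that a inverse_commute[of a b] by (simp add: commutant_iff)
next
  fix f p :: "'h op" assume f: "f \<in> commutant S" and p: "kernel_projection f p"
  show "p \<in> commutant S"
    unfolding commutant_iff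
  proof (intro conjI ballI)
    show "p \<in> bounded_ops" using p by (simp add: kernel_projection_def)
    fix s assume "s \<in> S"
    then show "p o\<^sub>L s = s o\<^sub>L p"
      using kernel_projection_commute[OF p] S f by (auto simp: commutant_iff)
  qed
qed

lemma spectral_algebra_von_neumann:
  assumes "von_neumann_algebra M"
  shows "spectral_algebra M"
proof -
  have "spectral_algebra (commutant (commutant M))"
  proof (rule spectral_algebra_commutant)
    show "adj s \<in> commutant M" if "s \<in> commutant M" for s
      using that assms by (intro commutant_adj) (auto simp: von_neumann_algebra_def)
  qed (auto simp: commutant_iff)
  then show ?thesis using assms by (simp add: von_neumann_algebra_def)
qed

lemma commutant_strong_limit:
  fixes L :: "'h::chilbert_space op"
  assumes T: "\<And>n. T n \<in> commutant S" and L: "L \<in> bounded_ops" "\<And>x. (\<lambda>n. T n x) \<longlonglongrightarrow> L x"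
  shows "L \<in> commutant S"
  unfolding commutant_iff
proof (intro conjI ballI L)
  fix s assume "s \<in> S"
  then have eq: "T n (s x) = s (T n x)" for n x
    using T[of n] by (simp add: commutant_iff) (metis blinfun_apply_blinfun_compose)
  have "L (s x) = s (L x)" for x
  proof (rule LIMSEQ_unique)
    show "(\<lambda>n. T n (s x)) \<longlonglongrightarrow> L (s x)" by (rule L)
    show "(\<lambda>n. T n (s x)) \<longlonglongrightarrow> s (L x)" unfolding eq by (intro tendsto_intros L)
  qed
  then show "L o\<^sub>L s = s o\<^sub>L L" by (intro blinfun_eqI) simp
qed

lemma von_neumann_strong_limit:
  assumes "von_neumann_algebra M" "\<And>n. T n \<in> M" "L \<in> bounded_ops" "\<And>x. (\<lambda>n. T n x) \<longlonglongrightarrow> L x"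
  shows "L \<in> M"
  using commutant_strong_limit[of T "commutant M" L] assms by (simp add: von_neumann_algebra_def)

section \<open>Conditional expectations\<close>

lemma adj_uminus [simp]: "a \<in> bounded_ops \<Longrightarrow> adj (- a) = - adj a"
  using adj_scaleR[of a "- 1"] by simp

lemma (in op_algebra) uminus_closed [simp]: "a \<in> A \<Longrightarrow> - a \<in> A"
  using algebra_mem(6)[of a "- 1"] by simp

locale expectation =
  fixes M N :: "'h::chilbert_space op set" and E :: "'h op \<Rightarrow> 'h op"
  assumes vnM: "von_neumann_algebra M"
    and cond: "conditional_expectation M N E"
begin

lemma vnN: "von_neumann_algebra N"
  and N_subset: "n \<in> N \<Longrightarrow> n \<in> M"
  and E_mem: "x \<in> M \<Longrightarrow> E x \<in> N"
  and E_add: "x \<in> M \<Longrightarrow> y \<in> M \<Longrightarrow> E (x + y) = E x + E y"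
  and E_scaleC: "x \<in> M \<Longrightarrow> E (c *\<^sub>C x) = c *\<^sub>C E x"
  and E_pos: "x \<in> M \<Longrightarrow> op_le 0 x \<Longrightarrow> op_le 0 (E x)"
  and E_N: "n \<in> N \<Longrightarrow> E n = n"
  and E_bimodule: "m \<in> N \<Longrightarrow> n \<in> N \<Longrightarrow> x \<in> M \<Longrightarrow> E (m o\<^sub>L x o\<^sub>L n) = m o\<^sub>L E x o\<^sub>L n"
  using cond by (auto simp: conditional_expectation_def)

sublocale M: spectral_algebra M
  by (rule spectral_algebra_von_neumann[OF vnM])

sublocale N: spectral_algebra N
  by (rule spectral_algebra_von_neumann[OF vnN])

lemma E_left: "n \<in> N \<Longrightarrow> x \<in> M \<Longrightarrow> E (n o\<^sub>L x) = n o\<^sub>L E x"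
  using E_bimodule[of n id_blinfun x] by simp

lemma E_right: "n \<in> N \<Longrightarrow> x \<in> M \<Longrightarrow> E (x o\<^sub>L n) = E x o\<^sub>L n"
  using E_bimodule[of id_blinfun n x] by simp

lemma E_scaleR: "x \<in> M \<Longrightarrow> E (r *\<^sub>R x) = r *\<^sub>R E x"
  by (simp add: scaleR_scaleC E_scaleC)

lemma E_minus: "x \<in> M \<Longrightarrow> E (- x) = - E x"
  using E_scaleR[of x "- 1"] by simp

lemma E_diff: "x \<in> M \<Longrightarrow> y \<in> M \<Longrightarrow> E (x - y) = E x - E y"
  using E_add[of x "- y"] by (simp add: E_minus)

lemma E_id: "E id_blinfun = id_blinfun"
  by (simp add: E_N)

lemma E_mono: "x \<in> M \<Longrightarrow> y \<in> M \<Longrightarrow> op_le x y \<Longrightarrow> op_le (E x) (E y)"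
  using E_pos[of "y - x"] op_le_diff[of x y] op_le_diff[of "E x" "E y"] by (simp add: E_diff)

text \<open>Adding \<open>norm x\<close> times the identity makes \<open>x\<close> positive, and
  \<open>E\<close> fixes the added multiple.\<close>

lemma E_selfadjoint:
  assumes x: "x \<in> M" "adj x = x"
  shows "adj (E x) = E x"
proof -
  have xK: "x + norm x *\<^sub>R id_blinfun \<in> M" using x by simp
  have "op_le 0 (x + norm x *\<^sub>R id_blinfun)"
    unfolding op_le_0_iff
  proof
    fix y
    have "- Re (cinner y (x y)) \<le> norm x * (norm y)\<^sup>2"
      using form_le_norm[of y "- x"] by (simp add: blinfun.minus_left)
    then show "Im (cinner y ((x + norm x *\<^sub>R id_blinfun) y)) = 0 \<and>
        0 \<le> Re (cinner y ((x + norm x *\<^sub>R id_blinfun) y))"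
      using selfadjoint_Im[of x y] x by (simp add: blinfun.bilinear_simps cinner_simps Re_cinner_self)
  qed
  then have "adj (E (x + norm x *\<^sub>R id_blinfun)) = E (x + norm x *\<^sub>R id_blinfun)"
    using E_pos[OF xK] E_mem[OF xK] by (intro op_le_0_selfadjoint) simp_all
  then show ?thesis using x E_mem[OF x(1)] by (simp add: E_add E_scaleR E_id)
qed

lemma E_adj:
  assumes x: "x \<in> M"
  shows "E (adj x) = adj (E x)"
proof -
  define a b where "a = (1/2) *\<^sub>R (x + adj x)" and "b = (- \<i> / 2) *\<^sub>C x + (\<i> / 2) *\<^sub>C adj x"
  have a: "a \<in> M" "adj a = a" and b: "b \<in> M" "adj b = b"
    using x by (simp_all add: a_def b_def add.commute)
  have ib: "\<i> *\<^sub>C b = (1/2) *\<^sub>R (x - adj x)"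
    by (simp add: b_def scaleC_scaleC scaleR_scaleC scaleC_add_right scaleC_diff_right)
  have "a + \<i> *\<^sub>C b = x" "a - \<i> *\<^sub>C b = adj x"
    unfolding ib by (simp_all add: a_def algebra_simps flip: scaleR_add_left)
  then have "E (adj x) = E a - \<i> *\<^sub>C E b" "E x = E a + \<i> *\<^sub>C E b"
    using a b E_diff[of a "\<i> *\<^sub>C b"] E_add[of a "\<i> *\<^sub>C b"] E_scaleC[of b \<i>] by simp_all
  then show ?thesis
    using E_selfadjoint[OF a] E_selfadjoint[OF b] E_mem[OF a(1)] E_mem[OF b(1)] by simp
qed

text \<open>Apply positivity to \<open>adj ?d o\<^sub>L ?d\<close> with \<open>?d = x - E x\<close>.
  By the bimodule property all terms except \<open>E (adj x o\<^sub>L x)\<close> collapse to a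
  single \<open>- (adj (E x) o\<^sub>L E x)\<close>.\<close>

lemma E_kadison:
  assumes x: "x \<in> M"
  shows "(norm (E x y))\<^sup>2 \<le> Re (cinner y (E (adj x o\<^sub>L x) y))"
proof -
  let ?d = "x - E x"
  have e: "E x \<in> N" "E x \<in> M" using E_mem[OF x] N_subset by auto
  have d: "?d \<in> M" using x e by simp
  have "adj ?d o\<^sub>L ?d = (adj x o\<^sub>L x) - (adj x o\<^sub>L E x) - (adj (E x) o\<^sub>L x) + (adj (E x) o\<^sub>L E x)"
    using x e by (simp add: compose_simps)
  then have "E (adj ?d o\<^sub>L ?d) = E (adj x o\<^sub>L x) - (adj (E x) o\<^sub>L E x)"
    using x e by (simp add: E_add E_diff E_left E_right E_adj E_N)
  moreover have "op_le 0 (E (adj ?d o\<^sub>L ?d))"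
    using d by (intro E_pos op_le_0_adj_compose) simp_all
  ultimately have "op_le (adj (E x) o\<^sub>L E x) (E (adj x o\<^sub>L x))"
    using op_le_diff by metis
  from op_le_form[OF this, of y] show ?thesis
    using e by (simp add: cinner_adj_right Re_cinner_self)
qed

lemma E_norm:
  assumes x: "x \<in> M"
  shows "norm (E x) \<le> norm x"
proof (rule norm_blinfun_bound)
  fix y
  have "op_le (adj x o\<^sub>L x) ((norm x)\<^sup>2 *\<^sub>R id_blinfun)"
  proof (subst op_le_id_iff)
    have "(norm (x y))\<^sup>2 \<le> (norm x)\<^sup>2 * (norm y)\<^sup>2" for y
      by (metis norm_blinfun norm_ge_zero power_mono power_mult_distrib)
    then show "\<forall>y. Re (cinner y ((adj x o\<^sub>L x) y)) \<le> (norm x)\<^sup>2 * (norm y)\<^sup>2"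
      using x by (simp add: cinner_adj_right Re_cinner_self)
  qed (use x in simp_all)
  then have "op_le (E (adj x o\<^sub>L x)) (E ((norm x)\<^sup>2 *\<^sub>R id_blinfun))"
    by (rule E_mono[rotated 2]) (use x in simp_all)
  from op_le_form[OF this, of y] E_kadison[OF x, of y]
  have "(norm (E x y))\<^sup>2 \<le> (norm x * norm y)\<^sup>2"
    by (simp add: E_scaleR E_id blinfun.scaleR_left cinner_simps Re_cinner_self power_mult_distrib)
  then show "norm (E x y) \<le> norm x * norm y" by (rule power2_le_imp_le) simp
qed simp

lemma E_tendsto:
  assumes "f \<longlonglongrightarrow> a" "\<And>n. f n \<in> M" "a \<in> M"
  shows "(\<lambda>n. E (f n)) \<longlonglongrightarrow> E a"
proof (rule metric_tendsto_imp_tendsto[OF assms(1)])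
  have "dist (E (f n)) (E a) \<le> dist (f n) a" for n
    using E_norm[of "f n - a"] assms by (simp add: dist_norm E_diff)
  then show "\<forall>\<^sub>F n in sequentially. dist (E (f n)) (E a) \<le> dist (f n) a" by simp
qed

text \<open>For fixed \<open>x\<close>, the expression
  \<open>cinner x (E (adj y o\<^sub>L m) x)\<close> is a positive semidefinite form in
  \<open>y\<close> and \<open>m\<close>. Compatibility of \<open>E\<close> with adjoints makes the
  two cross terms have equal real parts.\<close>

lemma E_cauchy_schwarz:
  assumes y: "y \<in> M" and m: "m \<in> M"
  shows "(Re (cinner x (E (adj y o\<^sub>L m) x)))\<^sup>2
    \<le> Re (cinner x (E (adj y o\<^sub>L y) x)) * Re (cinner x (E (adj m o\<^sub>L m) x))"
proof -
  define \<phi> where "\<phi> a = Re (cinner x (E a x))" for a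
  have pos: "0 \<le> \<phi> (adj a o\<^sub>L a)" if "a \<in> M" for a
    using op_le_0D(2)[OF E_pos[OF _ op_le_0_adj_compose]] that by (simp add: \<phi>_def)
  have conj: "\<phi> (adj m o\<^sub>L y) = \<phi> (adj y o\<^sub>L m)"
  proof -
    have mem: "adj y o\<^sub>L m \<in> M" using y m by simp
    have "E (adj m o\<^sub>L y) = adj (E (adj y o\<^sub>L m))"
      using E_adj[OF mem] y m by simp
    then show ?thesis
      using E_mem[OF mem] Re_cinner_commute by (simp add: \<phi>_def cinner_adj_right)
  qed
  have "0 \<le> \<phi> (adj y o\<^sub>L y) * s\<^sup>2 + 2 * \<phi> (adj y o\<^sub>L m) * s + \<phi> (adj m o\<^sub>L m)" for s
  proof -
    have "adj (s *\<^sub>R y + m) o\<^sub>L (s *\<^sub>R y + m)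
      = s\<^sup>2 *\<^sub>R (adj y o\<^sub>L y) + s *\<^sub>R ((adj y o\<^sub>L m) + (adj m o\<^sub>L y)) + (adj m o\<^sub>L m)"
      using y m by (simp add: compose_simps power2_eq_square algebra_simps)
    then have "\<phi> (adj (s *\<^sub>R y + m) o\<^sub>L (s *\<^sub>R y + m))
      = s\<^sup>2 * \<phi> (adj y o\<^sub>L y) + s * (\<phi> (adj y o\<^sub>L m) + \<phi> (adj m o\<^sub>L y)) + \<phi> (adj m o\<^sub>L m)"
      using y m by (simp add: \<phi>_def E_add E_scaleR blinfun.bilinear_simps cinner_simps)
    then show ?thesis using pos[of "s *\<^sub>R y + m"] y m by (simp add: conj algebra_simps)
  qed
  then have "(\<phi> (adj y o\<^sub>L m))\<^sup>2 \<le> \<phi> (adj y o\<^sub>L y) * \<phi> (adj m o\<^sub>L m)"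
    by (rule square_le_mult_if_nonneg_form) (rule pos[OF y])
  then show ?thesis by (simp add: \<phi>_def)
qed

section \<open>The centralizer\<close>

abbreviation "C \<equiv> centralizer_exp M N E"

lemma centralizer_iff:
  "x \<in> C \<longleftrightarrow> x \<in> M \<and> (\<forall>n\<in>N. x o\<^sub>L n = n o\<^sub>L x) \<and> (\<forall>m\<in>M. E (x o\<^sub>L m) = E (m o\<^sub>L x))"
  using M.bounded by (auto simp: centralizer_exp_def commutant_iff)

lemma centralizer_closed: "closed C"
  unfolding closed_sequential_limits
proof (intro allI impI)
  fix f a assume f: "(\<forall>n. f n \<in> C) \<and> f \<longlonglongrightarrow> a"
  have fM: "f n \<in> M" for n using f by (simp add: centralizer_iff)
  have a: "a \<in> M \<inter> commutant N"
  proof (rule closed_sequentially)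
    show "closed (M \<inter> commutant N)"
      by (intro closed_Int closed_unital_algebraD M.closed_unital closed_unital_algebra_commutant)
    show "f \<longlonglongrightarrow> a" "f n \<in> M \<inter> commutant N" for n
      using f by (auto simp: centralizer_exp_def)
  qed
  have "E (a o\<^sub>L m) = E (m o\<^sub>L a)" if m: "m \<in> M" for m
  proof (rule LIMSEQ_unique)
    show "(\<lambda>n. E (f n o\<^sub>L m)) \<longlonglongrightarrow> E (a o\<^sub>L m)"
      using f fM a m by (intro E_tendsto tendsto_intros) auto
    have "(\<lambda>n. E (m o\<^sub>L f n)) \<longlonglongrightarrow> E (m o\<^sub>L a)"
      using f fM a m by (intro E_tendsto tendsto_intros) auto
    then show "(\<lambda>n. E (f n o\<^sub>L m)) \<longlonglongrightarrow> E (m o\<^sub>L a)"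
      using f m by (simp add: centralizer_iff)
  qed
  then show "a \<in> C" using a by (auto simp: centralizer_exp_def)
qed

lemma centralizer_op_algebra: "op_algebra C"
proof
  show "C \<subseteq> bounded_ops" using M.bounded by (auto simp: centralizer_iff)
  show "closed_unital_algebra C"
    unfolding closed_unital_algebra_def subspace_def
  proof (intro conjI ballI allI centralizer_closed)
    show "0 \<in> C" "id_blinfun \<in> C" by (simp_all add: centralizer_iff)
    fix a b r assume a: "a \<in> C"
    show "r *\<^sub>R a \<in> C" using a by (simp add: centralizer_iff compose_simps E_scaleR)
    assume b: "b \<in> C"
    show "a + b \<in> C" using a b by (simp add: centralizer_iff compose_simps E_add)
    have "E (a o\<^sub>L b o\<^sub>L m) = E (m o\<^sub>L (a o\<^sub>L b))" if "m \<in> M" for m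
    proof -
      \<comment> \<open>The trace-like property is applied twice: first \<open>a\<close> is moved to
        the right end, then \<open>b\<close>.\<close>
      have "E (a o\<^sub>L (b o\<^sub>L m)) = E ((b o\<^sub>L m) o\<^sub>L a)" using a b that by (simp add: centralizer_iff)
      also have "\<dots> = E (b o\<^sub>L (m o\<^sub>L a))" by (simp only: compose_assoc)
      also have "\<dots> = E ((m o\<^sub>L a) o\<^sub>L b)" using a b that by (simp add: centralizer_iff)
      finally show ?thesis by (simp only: compose_assoc)
    qed
    moreover have "a o\<^sub>L b o\<^sub>L n = n o\<^sub>L (a o\<^sub>L b)" if "n \<in> N" for n
      using a b that by (simp add: centralizer_iff) (metis compose_assoc)
    ultimately show "a o\<^sub>L b \<in> C" using a b by (simp add: centralizer_iff)
  qed
  fix a b c assume a: "a \<in> C"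
  have aM: "a \<in> M" using a by (simp add: centralizer_iff)
  show "adj a \<in> C"
    unfolding centralizer_iff
  proof (intro conjI ballI)
    show "adj a \<in> M" using aM by simp
    have "adj a \<in> commutant N"
      using a N.bounded by (intro commutant_adj) (auto simp: centralizer_exp_def)
    then show "adj a o\<^sub>L n = n o\<^sub>L adj a" if "n \<in> N" for n using that by (simp add: commutant_iff)
    fix m assume m: "m \<in> M"
    have "E (a o\<^sub>L adj m) = E (adj m o\<^sub>L a)" using a m by (simp add: centralizer_iff)
    then have "adj (E (a o\<^sub>L adj m)) = adj (E (adj m o\<^sub>L a))" by (rule arg_cong)
    then show "E (adj a o\<^sub>L m) = E (m o\<^sub>L adj a)"
      using aM m by (simp flip: E_adj)
  qed
  show "c *\<^sub>C a \<in> C"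
    unfolding centralizer_iff
  proof (intro conjI ballI)
    show "c *\<^sub>C a \<in> M" using aM by simp
    have *: "(c *\<^sub>C a) o\<^sub>L m = c *\<^sub>C (a o\<^sub>L m)" "m o\<^sub>L (c *\<^sub>C a) = c *\<^sub>C (m o\<^sub>L a)" if "m \<in> bounded_ops" for m
      using that by (auto intro!: blinfun_eqI simp: scaleC_blinfun.rep_eq bounded_ops_def)
    show "(c *\<^sub>C a) o\<^sub>L n = n o\<^sub>L (c *\<^sub>C a)" if "n \<in> N" for n
      using a that by (simp add: * centralizer_iff)
    show "E ((c *\<^sub>C a) o\<^sub>L m) = E (m o\<^sub>L (c *\<^sub>C a))" if "m \<in> M" for m
      using a that by (simp add: * centralizer_iff E_scaleC)
  qed
  show "b \<in> C" if b: "b \<in> bounded_ops" "a o\<^sub>L b = id_blinfun" "b o\<^sub>L a = id_blinfun"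
    unfolding centralizer_iff
  proof (intro conjI ballI)
    show bM: "b \<in> M" using M.inverse_closed[OF aM b] .
    show "b o\<^sub>L n = n o\<^sub>L b" if "n \<in> N" for n
      using inverse_commute[OF b(2,3)] a that by (simp add: centralizer_iff)
    fix m assume m: "m \<in> M"
    \<comment> \<open>The condition for \<open>a\<close>, tested on
      \<open>b o\<^sub>L m o\<^sub>L b\<close>, is the condition for its inverse \<open>b\<close>
      tested on \<open>m\<close>.\<close>
    have "E (a o\<^sub>L (b o\<^sub>L m o\<^sub>L b)) = E ((b o\<^sub>L m o\<^sub>L b) o\<^sub>L a)"
      using a bM m by (simp add: centralizer_iff)
    moreover have "a o\<^sub>L (b o\<^sub>L m o\<^sub>L b) = m o\<^sub>L b"
      by (simp add: b(2) flip: compose_assoc)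
    moreover have "(b o\<^sub>L m o\<^sub>L b) o\<^sub>L a = b o\<^sub>L m"
      by (simp add: b(3) compose_assoc)
    ultimately show "E (b o\<^sub>L m) = E (m o\<^sub>L b)" by simp
  qed
qed

end

section \<open>Normality and strong limits\<close>

lemma op_le_trans: "op_le a b \<Longrightarrow> op_le b c \<Longrightarrow> op_le a c"
  using op_le_0_add[of "b - a" "c - b"] op_le_diff[of a b] op_le_diff[of b c] op_le_diff[of a c] by simp

lemma op_le_limit:
  fixes L :: "'h::chilbert_space op" and T :: "nat \<Rightarrow> 'h op"
  assumes lim: "\<And>x. (\<lambda>n. T n x) \<longlonglongrightarrow> L x" and le: "\<And>n. op_le 0 (T n)"
  shows "op_le 0 L"
  unfolding op_le_0_iff
proof (intro allI conjI)
  fix x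
  have "(\<lambda>n. Im (cinner x (T n x))) \<longlonglongrightarrow> Im (cinner x (L x))" by (intro tendsto_intros lim)
  then show "Im (cinner x (L x)) = 0" using op_le_0D(1)[OF le] by (simp add: LIMSEQ_const_iff)
  have "(\<lambda>n. Re (cinner x (T n x))) \<longlonglongrightarrow> Re (cinner x (L x))" by (intro tendsto_intros lim)
  then show "0 \<le> Re (cinner x (L x))" using op_le_0D(2)[OF le] by (intro LIMSEQ_le_const) auto
qed

locale normal_expectation = expectation M N E
  for M N :: "'h::chilbert_space op set" and E :: "'h op \<Rightarrow> 'h op" +
  assumes normal: "normal_map M N E"
begin

text \<open>Normality speaks of order suprema, whereas pointwise limits are wanted. The monotone
  sequence \<open>E (- c n)\<close> has a strong limit, and comparison in both directions identifies
  that limit with the supremum.\<close>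

lemma E_decreasing_limit:
  fixes q :: "'h op" and c :: "nat \<Rightarrow> 'h op"
  assumes c: "\<And>n. c n \<in> M" "\<And>n. op_le 0 (c n)" "\<And>n. norm (c n) \<le> 1"
    and dec: "\<And>n. op_le (c (Suc n)) (c n)"
    and q: "q \<in> M" "adj q = q" "\<And>x. (\<lambda>n. c n x) \<longlonglongrightarrow> q x" "\<And>n. op_le q (c n)"
  shows "(\<lambda>n. E (c n) x) \<longlonglongrightarrow> E q x"
proof -
  have mono: "op_le (c n) (c m)" if "m \<le> n" for m n
    using that by (induction rule: dec_induct) (use op_le_refl op_le_trans dec in blast)+
  have minus: "op_le (- b) (- a)" if "op_le a b" for a b :: "'h op" using that by (simp add: op_le_def)
  have cadj: "adj (c n) = c n" for n using op_le_0_selfadjoint[OF _ c(2)] c(1) by simp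
  define D where "D = range (\<lambda>n. - c n)"
  have lub: "op_lub M D (- q)"
    unfolding op_lub_def
  proof (intro conjI ballI impI)
    show "- q \<in> selfadjoint_part M" using q by (simp add: selfadjoint_part_def)
    show "op_le d (- q)" if "d \<in> D" for d using that minus q(4) by (auto simp: D_def)
    fix t assume t: "t \<in> selfadjoint_part M" "\<forall>d\<in>D. op_le d t"
    have "op_le 0 (t - (- q))"
    proof (rule op_le_limit)
      show "(\<lambda>n. (t - (- c n)) x) \<longlonglongrightarrow> (t - (- q)) x" for x
        by (simp add: blinfun.bilinear_simps) (intro tendsto_intros q)
      show "op_le 0 (t - (- c n))" for n
        using t(2) by (intro op_le_diff[THEN iffD1]) (simp add: D_def)
    qed
    then show "op_le (- q) t" by (rule op_le_diff[THEN iffD2])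
  qed
  have "D \<noteq> {}" "D \<subseteq> selfadjoint_part M"
    using c cadj by (auto simp: D_def selfadjoint_part_def)
  moreover have "\<forall>a\<in>D. \<forall>b\<in>D. \<exists>c\<in>D. op_le a c \<and> op_le b c"
  proof (intro ballI)
    fix a b assume "a \<in> D" "b \<in> D"
    then obtain i j where "a = - c i" "b = - c j" by (auto simp: D_def)
    then have "op_le a (- c (max i j))" "op_le b (- c (max i j))" "- c (max i j) \<in> D"
      using minus mono by (auto simp: D_def)
    then show "\<exists>c\<in>D. op_le a c \<and> op_le b c" by blast
  qed
  ultimately have lubE: "op_lub N (E ` D) (E (- q))"
    using normal lub unfolding normal_map_def by blast
  have T: "E (- c n) \<in> bounded_ops" "norm (E (- c n)) \<le> 1" "op_le (E (- c n)) (E (- c (Suc n)))" for n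
    using E_mem[of "- c n"] E_norm[of "- c n"] c minus[OF dec] E_mono order_trans
    by (auto intro: order_trans)
  obtain L where L: "L \<in> bounded_ops" "norm L \<le> 1" "\<And>x. (\<lambda>n. E (- c n) x) \<longlonglongrightarrow> L x"
    by (rule monotone_strong_limit[of "\<lambda>n. E (- c n)", OF T]) (rule that)
  \<comment> \<open>The supremum is taken among self-adjoint elements of \<open>N\<close>, so
    \<open>L\<close> must be shown to be one before it can compete.\<close>
  have LN: "L \<in> N"
    using von_neumann_strong_limit[OF vnN, of "\<lambda>n. E (- c n)" L] L E_mem c by simp
  have Tmono: "op_le (E (- c m)) (E (- c n))" if "m \<le> n" for m n
    using minus[OF mono[OF that]] c by (intro E_mono) auto
  have le: "op_le (E (- c m)) L" for m
  proof -
    have "op_le 0 (L - E (- c m))"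
    proof (rule op_le_limit)
      \<comment> \<open>Shifting the index by \<open>m\<close> makes every term of the sequence
        dominate \<open>E (- c m)\<close>.\<close>
      show "(\<lambda>n. (E (- c (n + m)) - E (- c m)) x) \<longlonglongrightarrow> (L - E (- c m)) x" for x
        by (simp only: blinfun.diff_left)
          (intro tendsto_intros LIMSEQ_ignore_initial_segment[of "\<lambda>n. E (- c n) x" for x] L)
      show "op_le 0 (E (- c (n + m)) - E (- c m))" for n
        using Tmono[of m "n + m"] by (intro op_le_diff[THEN iffD1]) simp
    qed
    then show ?thesis by (rule op_le_diff[THEN iffD2])
  qed
  have "adj (E (- c 0)) = E (- c 0)"
    using E_selfadjoint[of "- c 0"] c cadj by simp
  moreover have "adj (L - E (- c 0)) = L - E (- c 0)"
    using le[of 0] L T(1)[of 0] by (intro op_le_0_selfadjoint) (auto dest: op_le_diff[THEN iffD1])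
  ultimately have "adj L = L" using L T(1)[of 0] by simp
  then have "op_le (E (- q)) L"
    using lubE LN le unfolding op_lub_def selfadjoint_part_def D_def by blast
  moreover have "op_le L (E (- q))"
  proof -
    have "op_le 0 (E (- q) - L)"
    proof (rule op_le_limit)
      show "(\<lambda>n. (E (- q) - E (- c n)) x) \<longlonglongrightarrow> (E (- q) - L) x" for x
        by (simp only: blinfun.diff_left) (intro tendsto_intros L)
      show "op_le 0 (E (- q) - E (- c n))" for n
        using lubE unfolding op_lub_def D_def by (intro op_le_diff[THEN iffD1]) blast
    qed
    then show ?thesis by (rule op_le_diff[THEN iffD2])
  qed
  ultimately have "E (- q) = L"
    using E_mem[of "- q"] q L by (intro op_le_antisym) auto
  then have "E q = - L" using q(1) by (simp add: E_minus equation_minus_iff)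
  then show ?thesis
    using tendsto_minus[OF L(3)[of x]] c(1) by (simp add: E_minus blinfun.minus_left)
qed

text \<open>The projection is the infimum of the iterated squares of an element of the centralizer. Normality gives
  convergence of the vector states of \<^term>\<open>E\<close>, and the Cauchy-Schwarz inequality extends this to
  products with a fixed operator.\<close>

lemma centralizer_kernel_projection:
  assumes f: "f \<in> C" "adj f = f" and p: "kernel_projection f p"
  shows "p \<in> C"
proof -
  interpret C: op_algebra C by (rule centralizer_op_algebra)
  obtain a q where a: "effect a" "\<And>A. closed_unital_algebra A \<Longrightarrow> f \<in> A \<Longrightarrow> a \<in> A"
    and q: "kernel_projection f q" and aq: "\<And>n. square_iter a n o\<^sub>L q = q"
    and lim: "\<And>x. (\<lambda>n. square_iter a n x) \<longlonglongrightarrow> q x" and le: "\<And>n. op_le q (square_iter a n)"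
    by (rule kernel_projection_exists[of f]) (use f in simp_all)
  have pq: "p = q" by (rule kernel_projection_unique[OF p q])
  have q': "q \<in> bounded_ops" "adj q = q" "q o\<^sub>L q = q" using q by (auto simp: kernel_projection_def)
  let ?c = "square_iter a"
  have "a \<in> C" using a(2) C.closed_unital f(1) by blast
  then have cC: "?c n \<in> C" for n using square_iter_mem C.closed_unital by blast
  then have cM: "?c n \<in> M" and cN: "?c n \<in> commutant N" for n
    by (auto simp: centralizer_exp_def)
  have qM: "q \<in> M" by (rule von_neumann_strong_limit[OF vnM cM q'(1) lim])
  have qN: "q \<in> commutant N" by (rule commutant_strong_limit[OF cN q'(1) lim])
  have eff: "effect (?c n)" for n by (rule effect_square_iter[OF a(1)])
  have cadj: "adj (?c n) = ?c n" for n using effectD(4)[OF eff] .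
  have qc: "q o\<^sub>L ?c n = q" for n
  proof -
    have "adj (?c n o\<^sub>L q) = adj q" by (simp only: aq)
    then show ?thesis using cM qM by (simp add: cadj q')
  qed
  have Elim: "(\<lambda>n. E (?c n) x) \<longlonglongrightarrow> E q x" for x
  proof (rule E_decreasing_limit)
    show "op_le (?c (Suc n)) (?c n)" for n using effect_square_le[OF eff] by simp
  qed (use cM effectD(2)[OF eff] effect_norm[OF eff] qM q' lim le in auto)
  define e where "e n = ?c n - q" for n
  have eM: "e n \<in> M" "adj (e n) = e n" for n using cM qM by (simp_all add: e_def cadj q')
  \<comment> \<open>Because \<open>?c n\<close> and \<open>q\<close> multiply to \<open>q\<close> in
    either order, squaring \<open>e n\<close> only advances the index. In Cauchy-Schwarz the factor
    quadratic in \<open>e n\<close> is thus linear in \<open>e (Suc n)\<close>, where normality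
    applies.\<close>
  have ee: "e n o\<^sub>L e n = e (Suc n)" for n
    by (simp add: e_def compose_simps aq qc q')
  have Ee: "(\<lambda>n. Re (cinner x (E (e (Suc n)) x))) \<longlonglongrightarrow> 0" for x
  proof -
    have "(\<lambda>n. Re (cinner x (E (?c n) x - E q x))) \<longlonglongrightarrow> Re (cinner x (E q x - E q x))"
      by (intro tendsto_intros Elim)
    then have "(\<lambda>n. Re (cinner x (E (e n) x))) \<longlonglongrightarrow> 0"
      using cM qM by (simp add: e_def E_diff blinfun.diff_left)
    then show ?thesis by (rule LIMSEQ_Suc)
  qed
  have Re0: "(\<lambda>n. Re (cinner x (E (e n o\<^sub>L m) x))) \<longlonglongrightarrow> 0" if m: "m \<in> M" for m x
  proof -
    let ?m = "Re (cinner x (E (adj m o\<^sub>L m) x))"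
    have lim0: "(\<lambda>n. Re (cinner x (E (e (Suc n)) x)) * ?m) \<longlonglongrightarrow> 0"
      using tendsto_mult_right[OF Ee[of x], of ?m] by simp
    have cs: "(Re (cinner x (E (e n o\<^sub>L m) x)))\<^sup>2 \<le> Re (cinner x (E (e (Suc n)) x)) * ?m" for n
      using E_cauchy_schwarz[OF eM(1)[of n] m, of x] unfolding eM(2) ee .
    have "(\<lambda>n. (Re (cinner x (E (e n o\<^sub>L m) x)))\<^sup>2) \<longlonglongrightarrow> 0"
      by (rule tendsto_sandwich[OF _ _ tendsto_const lim0]) (simp_all add: cs)
    then have "(\<lambda>n. sqrt ((Re (cinner x (E (e n o\<^sub>L m) x)))\<^sup>2)) \<longlonglongrightarrow> sqrt 0"
      by (rule tendsto_real_sqrt)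
    then show ?thesis by (simp add: tendsto_rabs_zero_iff)
  qed
  have left0: "(\<lambda>n. cinner x (E (e n o\<^sub>L m) x)) \<longlonglongrightarrow> 0" if m: "m \<in> M" for m x
  proof -
    \<comment> \<open>Multiplication of \<open>m\<close> by \<open>- \<i>\<close> turns the
      imaginary part into a real part, so the real statement suffices.\<close>
    have im: "Im (cinner x (E (e n o\<^sub>L m) x)) = Re (cinner x (E (e n o\<^sub>L (- \<i>) *\<^sub>C m) x))" for n
    proof -
      have "e n o\<^sub>L (- \<i>) *\<^sub>C m = (- \<i>) *\<^sub>C (e n o\<^sub>L m)"
        using M.algebra_mem(9)[OF eM(1)[of n]]
        by (intro blinfun_eqI) (simp add: blinfun.bilinear_simps scaleC_blinfun.rep_eq bounded_ops_def)
      then have "E (e n o\<^sub>L (- \<i>) *\<^sub>C m) = (- \<i>) *\<^sub>C E (e n o\<^sub>L m)"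
        using eM m E_scaleC[of "e n o\<^sub>L m" "- \<i>"] by simp
      then show ?thesis by (simp add: blinfun.bilinear_simps scaleC_blinfun.rep_eq cinner_simps)
    qed
    show ?thesis
      unfolding tendsto_complex_iff im using Re0[OF m] Re0[of "(- \<i>) *\<^sub>C m"] m by (simp del: scaleC_minus_left)
  qed
  have right0: "(\<lambda>n. cinner x (E (m o\<^sub>L e n) x)) \<longlonglongrightarrow> 0" if m: "m \<in> M" for m x
  proof -
    have "cinner x (E (m o\<^sub>L e n) x) = cnj (cinner x (E (e n o\<^sub>L adj m) x))" for n
    proof -
      have mem: "e n o\<^sub>L adj m \<in> M" using eM m by simp
      have "E (m o\<^sub>L e n) = adj (E (e n o\<^sub>L adj m))" using E_adj[OF mem] eM m by simp
      then show ?thesis using E_mem[OF mem] by (simp add: cinner_adj_right flip: cinner_commute)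
    qed
    then show ?thesis using tendsto_cnj[OF left0[of "adj m" x]] m by simp
  qed
  have "E (q o\<^sub>L m) = E (m o\<^sub>L q)" if m: "m \<in> M" for m
  proof -
    have "E (q o\<^sub>L m) - E (m o\<^sub>L q) = 0"
    proof (rule eq_0_if_form_0)
      show "E (q o\<^sub>L m) - E (m o\<^sub>L q) \<in> bounded_ops" using E_mem qM m by simp
      fix x
      \<comment> \<open>Since \<open>?c n = q + e n\<close> lies in the centralizer, the failure of
        \<open>q\<close> to satisfy the trace-like identity is cancelled by that of
        \<open>e n\<close>, which tends to 0.\<close>
      have "E (q o\<^sub>L m) - E (m o\<^sub>L q) = E (m o\<^sub>L e n) - E (e n o\<^sub>L m)" for n
        using cC[of n] cM[of n] qM m by (simp add: e_def compose_simps E_diff centralizer_iff)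
      then have eq: "cinner x ((E (q o\<^sub>L m) - E (m o\<^sub>L q)) x)
          = cinner x (E (m o\<^sub>L e n) x) - cinner x (E (e n o\<^sub>L m) x)" for n
        by (metis blinfun.diff_left cinner_diff_right)
      have "(\<lambda>n. cinner x (E (m o\<^sub>L e n) x) - cinner x (E (e n o\<^sub>L m) x)) \<longlonglongrightarrow> 0 - 0"
        by (rule tendsto_diff[OF right0[OF m] left0[OF m]])
      then have "(\<lambda>n::nat. cinner x ((E (q o\<^sub>L m) - E (m o\<^sub>L q)) x)) \<longlonglongrightarrow> 0"
        unfolding eq[symmetric] by simp
      then show "cinner x ((E (q o\<^sub>L m) - E (m o\<^sub>L q)) x) = 0"
        by (simp add: LIMSEQ_const_iff)
    qed
    then show ?thesis by simp
  qed
  then show ?thesis using qM qN by (auto simp: pq centralizer_exp_def)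
qed

sublocale C: spectral_algebra C
proof -
  interpret C: op_algebra C by (rule centralizer_op_algebra)
  show "spectral_algebra C"
    by unfold_locales (rule centralizer_kernel_projection)
qed

end

section \<open>Components of operator groups\<close>

lemma op_monoid_simps [simp]:
  "carrier (op_monoid G) = G" "mult (op_monoid G) = (o\<^sub>L)" "one (op_monoid G) = id_blinfun"
  by (simp_all add: op_monoid_def)

lemma op_monoid_groupI:
  assumes "\<And>a b. a \<in> G \<Longrightarrow> b \<in> G \<Longrightarrow> a o\<^sub>L b \<in> G" "id_blinfun \<in> G"
    and "\<And>a. a \<in> G \<Longrightarrow> \<exists>b\<in>G. b o\<^sub>L a = id_blinfun"
  shows "group (op_monoid G)"
  by (rule groupI) (simp_all add: assms compose_assoc)

text \<open>The radius \<open>e\<close> expresses that \<open>Z\<close> is a neighbourhood of 1 in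
  \<open>G\<close>; translation spreads this to every coset. The locale serves both
  normalizers.\<close>

locale open_connected_subgroup =
  fixes G Z :: "'h::chilbert_space op set" and e :: real
  assumes group: "group (op_monoid G)"
    and subgroup: "subgroup Z (op_monoid G)"
    and connected: "connected Z"
    and e: "0 < e" "\<And>g. g \<in> G \<Longrightarrow> norm (g - id_blinfun) < e \<Longrightarrow> g \<in> Z"
begin

interpretation group "op_monoid G" by (rule group)

lemma Z_subset: "Z \<subseteq> G" using subgroup.subset[OF subgroup] by simp

lemma coset_alt: "Z #>\<^bsub>op_monoid G\<^esub> g = (\<lambda>z. z o\<^sub>L g) ` Z"
  by (auto simp: r_coset_def)

text \<open>A coset is a translate of a connected set, hence lies in one component. Conversely the
  coset of a point is locally constant, so it is constant on a component.\<close>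

lemma component_eq_coset:
  assumes g: "g \<in> G"
  shows "connected_component_set G g = Z #>\<^bsub>op_monoid G\<^esub> g"
proof
  have "connected ((\<lambda>z. z o\<^sub>L g) ` Z)"
    by (intro connected_continuous_image connected continuous_intros)
  moreover have "(\<lambda>z. z o\<^sub>L g) ` Z \<subseteq> G"
    using m_closed g Z_subset by auto
  moreover have "g \<in> (\<lambda>z. z o\<^sub>L g) ` Z"
    using subgroup.one_closed[OF subgroup] by force
  ultimately show "Z #>\<^bsub>op_monoid G\<^esub> g \<subseteq> connected_component_set G g"
    unfolding coset_alt by (intro connected_component_maximal)
  let ?S = "connected_component_set G g" and ?R = "\<lambda>x y. Z #>\<^bsub>op_monoid G\<^esub> x = Z #>\<^bsub>op_monoid G\<^esub> y"
  have SG: "?S \<subseteq> G" by (rule connected_component_subset)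
  show "?S \<subseteq> Z #>\<^bsub>op_monoid G\<^esub> g"
  proof
    fix x assume x: "x \<in> ?S"
    have "?R g x"
    proof (rule connected_equivalence_relation[of ?S])
      show "connected ?S" by (rule connected_connected_component)
      show "g \<in> ?S" using g by (simp add: connected_component_refl)
      fix a assume "a \<in> ?S"
      then have a: "a \<in> G" using SG by blast
      obtain b where b: "b \<in> G" "a o\<^sub>L b = id_blinfun" using r_inv_ex[of a] a by auto
      \<comment> \<open>Right multiplication by the inverse \<open>b\<close> of \<open>a\<close>
        scales distances by at most \<open>norm b\<close>, so this ball is sent into the
        \<open>e\<close>-ball about 1. The added 1 keeps the denominator positive.\<close>
      define T where "T = ?S \<inter> ball a (e / (norm b + 1))"
      have pos: "0 < norm b + 1" by (simp add: add_nonneg_pos)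
      have "?R a y" if y: "y \<in> T" for y
      proof -
        have yG: "y \<in> G" and d: "norm (y - a) < e / (norm b + 1)"
          using y SG by (auto simp: T_def dist_norm norm_minus_commute)
        have "(y o\<^sub>L b) - id_blinfun = (y - a) o\<^sub>L b" using b by (simp add: compose_simps)
        then have "norm ((y o\<^sub>L b) - id_blinfun) \<le> norm (y - a) * norm b"
          by (simp add: norm_blinfun_compose)
        also have "\<dots> \<le> norm (y - a) * (norm b + 1)" by (intro mult_left_mono) simp_all
        also have "\<dots> < e" using d pos by (simp add: pos_less_divide_eq)
        finally have yb: "y o\<^sub>L b \<in> Z" using e(2) m_closed[of y b] yG b by simp
        have "b o\<^sub>L a = id_blinfun" using inv_equality[of a b] l_inv[of b] inv_comm[of a b] a b by simp
        then have "y = (y o\<^sub>L b) o\<^sub>L a" by (simp add: compose_assoc)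
        then have "y \<in> Z #>\<^bsub>op_monoid G\<^esub> a" using yb unfolding coset_alt by blast
        then show ?thesis using repr_independence[of y Z a] a subgroup by simp
      qed
      moreover have "openin (top_of_set ?S) T" unfolding T_def by (rule openin_open_Int) simp
      moreover have "a \<in> T" using \<open>a \<in> ?S\<close> e(1) pos by (simp add: T_def)
      ultimately show "\<exists>T. openin (top_of_set ?S) T \<and> a \<in> T \<and> (\<forall>y\<in>T. ?R a y)" by blast
    qed (use x in auto)
    then show "x \<in> Z #>\<^bsub>op_monoid G\<^esub> g"
      using repr_independenceD[OF subgroup, of x g] x SG by auto
  qed
qed

text \<open>A conjugate of \<open>Z\<close> is connected and contains 1, so it lies in the component
  of 1, which is \<open>Z\<close>.\<close>

lemma normal_subgroup: "Z \<lhd> op_monoid G"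
  unfolding normal_inv_iff
proof (intro conjI ballI subgroup)
  fix x z assume x: "x \<in> carrier (op_monoid G)" and z: "z \<in> Z"
  let ?i = "inv\<^bsub>op_monoid G\<^esub> x"
  have i: "?i \<in> G" "x o\<^sub>L ?i = id_blinfun" using inv_closed[OF x] r_inv[OF x] by simp_all
  let ?T = "(\<lambda>z. x o\<^sub>L z o\<^sub>L ?i) ` Z"
  have "connected ?T" by (intro connected_continuous_image connected continuous_intros)
  moreover have "?T \<subseteq> G"
    using m_closed x i Z_subset by auto
  moreover have "id_blinfun \<in> ?T"
    using subgroup.one_closed[OF subgroup] i by (auto intro!: image_eqI[of _ _ id_blinfun])
  ultimately have "?T \<subseteq> connected_component_set G id_blinfun" by (intro connected_component_maximal)
  also have "\<dots> = Z"
    using component_eq_coset[of id_blinfun] one_closed by (simp add: coset_alt)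
  finally show "x \<otimes>\<^bsub>op_monoid G\<^esub> z \<otimes>\<^bsub>op_monoid G\<^esub> ?i \<in> Z" using z by auto
qed

lemma pi0_carrier: "carrier (pi0 (op_monoid G)) = carrier (op_monoid G Mod Z)"
proof -
  have "connected_component_set G ` G = (\<lambda>g. Z #>\<^bsub>op_monoid G\<^esub> g) ` G"
    by (rule image_cong[OF refl component_eq_coset])
  then show ?thesis by (auto simp: pi0_def FactGroup_def RCOSETS_def components_def)
qed

text \<open>All terms of the union defining the product are the same coset, and the index sets are
  nonempty, so the union is that coset.\<close>

lemma pi0_mult:
  assumes "A \<in> carrier (op_monoid G Mod Z)" "B \<in> carrier (op_monoid G Mod Z)"
  shows "A \<otimes>\<^bsub>pi0 (op_monoid G)\<^esub> B = A \<otimes>\<^bsub>op_monoid G Mod Z\<^esub> B"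
proof -
  interpret normal Z "op_monoid G" by (rule normal_subgroup)
  obtain a b where a: "a \<in> G" "A = Z #>\<^bsub>op_monoid G\<^esub> a" and b: "b \<in> G" "B = Z #>\<^bsub>op_monoid G\<^esub> b"
    using assms by (auto simp: FactGroup_def RCOSETS_def)
  have "connected_component_set G (x o\<^sub>L y) = A <#>\<^bsub>op_monoid G\<^esub> B" if "x \<in> A" "y \<in> B" for x y
  proof -
    have coset_subset: "w \<in> G" if "w \<in> Z #>\<^bsub>op_monoid G\<^esub> g" "g \<in> G" for w g
      using that component_eq_coset connected_component_subset by blast
    have xy: "x \<in> G" "y \<in> G" using that a b coset_subset by blast+
    have "A = Z #>\<^bsub>op_monoid G\<^esub> x" "B = Z #>\<^bsub>op_monoid G\<^esub> y"
      using repr_independence[OF _ _ subgroup] that a b by auto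
    then show ?thesis
      using rcos_sum[of x y] xy group.is_monoid[OF group, THEN monoid.m_closed, of x y] component_eq_coset[of "x o\<^sub>L y"] by simp
  qed
  moreover have "a \<in> A" "b \<in> B" using a b rcos_self[OF _ subgroup] by auto
  ultimately have "(\<Union>x\<in>A. \<Union>y\<in>B. connected_component_set G (x o\<^sub>L y)) = A <#>\<^bsub>op_monoid G\<^esub> B"
    by auto
  then show ?thesis by (simp add: pi0_def FactGroup_def)
qed

lemma pi0_iso_Mod:
  "pi0 (op_monoid G) \<cong> op_monoid G Mod Z" "op_monoid G Mod Z \<cong> pi0 (op_monoid G)"
proof -
  have closed: "A \<otimes>\<^bsub>op_monoid G Mod Z\<^esub> B \<in> carrier (op_monoid G Mod Z)"
    if "A \<in> carrier (op_monoid G Mod Z)" "B \<in> carrier (op_monoid G Mod Z)" for A B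
    using monoid.m_closed[OF group.is_monoid[OF normal.factorgroup_is_group[OF normal_subgroup]]] that by blast
  have "(\<lambda>A. A) \<in> iso (pi0 (op_monoid G)) (op_monoid G Mod Z)"
    "(\<lambda>A. A) \<in> iso (op_monoid G Mod Z) (pi0 (op_monoid G))"
    unfolding iso_def hom_def bij_betw_def by (simp_all add: pi0_carrier pi0_mult)
  then show "pi0 (op_monoid G) \<cong> op_monoid G Mod Z" "op_monoid G Mod Z \<cong> pi0 (op_monoid G)"
    by (auto simp: is_iso_def)
qed

end

section \<open>The normalizers of a conditional expectation\<close>

context normal_expectation
begin

text \<open>The inverse is an explicit argument, which avoids \<open>inv\<close>, and invariance of
  \<open>E\<close> is restated as equivariance under conjugation, a form that composes
  directly.\<close>

definition norm_pair :: "'h op \<Rightarrow> 'h op \<Rightarrow> bool" where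
  "norm_pair g h \<longleftrightarrow> g \<in> M \<and> h \<in> M \<and> g o\<^sub>L h = id_blinfun \<and> h o\<^sub>L g = id_blinfun \<and>
     (\<forall>x\<in>M. E (g o\<^sub>L x o\<^sub>L h) = g o\<^sub>L E x o\<^sub>L h)"

lemma norm_pairD:
  assumes "norm_pair g h"
  shows "g \<in> M" "h \<in> M" "g o\<^sub>L h = id_blinfun" "h o\<^sub>L g = id_blinfun"
    and "x \<in> M \<Longrightarrow> E (g o\<^sub>L x o\<^sub>L h) = g o\<^sub>L E x o\<^sub>L h"
  using assms by (auto simp: norm_pair_def)

lemma conjugate_inverse: "h o\<^sub>L g = id_blinfun \<Longrightarrow> h o\<^sub>L (g o\<^sub>L x o\<^sub>L h) o\<^sub>L g = x"
proof -
  assume hg: "h o\<^sub>L g = id_blinfun"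
  have "h o\<^sub>L (g o\<^sub>L x o\<^sub>L h) o\<^sub>L g = (h o\<^sub>L g) o\<^sub>L x o\<^sub>L (h o\<^sub>L g)" by (simp only: compose_assoc)
  then show ?thesis by (simp add: hg)
qed

lemma invertible_normalizer_iff:
  "g \<in> invertible_normalizer M E \<longleftrightarrow> (\<exists>h. norm_pair g h)"
proof -
  have inv_eq: "inv\<^bsub>op_monoid M\<^esub> g = h"
    if "h \<in> M" "g o\<^sub>L h = id_blinfun" "h o\<^sub>L g = id_blinfun" for h
    unfolding m_inv_def
  proof (rule the_equality)
    fix y assume y: "y \<in> carrier (op_monoid M) \<and> g \<otimes>\<^bsub>op_monoid M\<^esub> y = \<one>\<^bsub>op_monoid M\<^esub> \<and>
      y \<otimes>\<^bsub>op_monoid M\<^esub> g = \<one>\<^bsub>op_monoid M\<^esub>"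
    then show "y = h" using inverse_unique[of g y h] that by simp
  qed (use that in simp)
  have "(\<forall>x\<in>M. expectation_action M g E x = E x) \<longleftrightarrow> (\<forall>x\<in>M. E (g o\<^sub>L x o\<^sub>L h) = g o\<^sub>L E x o\<^sub>L h)"
    if h: "g \<in> M" "h \<in> M" "g o\<^sub>L h = id_blinfun" "h o\<^sub>L g = id_blinfun" for h
  proof -
    have act: "expectation_action M g E x = g o\<^sub>L E (h o\<^sub>L x o\<^sub>L g) o\<^sub>L h" for x
      using inv_eq[OF h(2-4)] by (simp add: expectation_action_def)
    show ?thesis
      unfolding act
    proof (intro iffI ballI)
      fix x assume x: "x \<in> M" and *: "\<forall>x\<in>M. g o\<^sub>L E (h o\<^sub>L x o\<^sub>L g) o\<^sub>L h = E x"
      then have "g o\<^sub>L E (h o\<^sub>L (g o\<^sub>L x o\<^sub>L h) o\<^sub>L g) o\<^sub>L h = E (g o\<^sub>L x o\<^sub>L h)"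
        using h by simp
      then show "E (g o\<^sub>L x o\<^sub>L h) = g o\<^sub>L E x o\<^sub>L h" by (simp only: conjugate_inverse[OF h(4)])
    next
      fix x assume x: "x \<in> M" and *: "\<forall>x\<in>M. E (g o\<^sub>L x o\<^sub>L h) = g o\<^sub>L E x o\<^sub>L h"
      then have "E (g o\<^sub>L (h o\<^sub>L x o\<^sub>L g) o\<^sub>L h) = g o\<^sub>L E (h o\<^sub>L x o\<^sub>L g) o\<^sub>L h"
        using h by simp
      then show "g o\<^sub>L E (h o\<^sub>L x o\<^sub>L g) o\<^sub>L h = E x" by (simp only: conjugate_inverse[OF h(3)])
    qed
  qed
  then show ?thesis
    unfolding invertible_normalizer_def norm_pair_def invertibles_iff by blast
qed

lemma norm_pair_sym: assumes "norm_pair g h" shows "norm_pair h g"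
proof -
  note g = norm_pairD[OF assms]
  have "E (h o\<^sub>L x o\<^sub>L g) = h o\<^sub>L E x o\<^sub>L g" if x: "x \<in> M" for x
  proof -
    have "E (g o\<^sub>L (h o\<^sub>L x o\<^sub>L g) o\<^sub>L h) = g o\<^sub>L E (h o\<^sub>L x o\<^sub>L g) o\<^sub>L h"
      by (rule g(5)) (use g x in simp)
    then have "E x = g o\<^sub>L E (h o\<^sub>L x o\<^sub>L g) o\<^sub>L h" by (simp only: conjugate_inverse[OF g(3)])
    then show ?thesis by (simp only: conjugate_inverse[OF g(4)])
  qed
  then show ?thesis using g by (simp add: norm_pair_def)
qed

lemma norm_pair_compose:
  assumes "norm_pair g h" "norm_pair g' h'"
  shows "norm_pair (g o\<^sub>L g') (h' o\<^sub>L h)"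
proof -
  note g = norm_pairD[OF assms(1)] and g' = norm_pairD[OF assms(2)]
  have "E (g o\<^sub>L g' o\<^sub>L x o\<^sub>L (h' o\<^sub>L h)) = g o\<^sub>L g' o\<^sub>L E x o\<^sub>L (h' o\<^sub>L h)" if x: "x \<in> M" for x
  proof -
    have "E (g o\<^sub>L (g' o\<^sub>L x o\<^sub>L h') o\<^sub>L h) = g o\<^sub>L E (g' o\<^sub>L x o\<^sub>L h') o\<^sub>L h"
      by (rule g(5)) (use g' x in simp)
    also have "E (g' o\<^sub>L x o\<^sub>L h') = g' o\<^sub>L E x o\<^sub>L h'" by (rule g'(5)[OF x])
    finally show ?thesis by (simp only: compose_assoc)
  qed
  then show ?thesis using g g' by (simp add: norm_pair_def cancel_middle)
qed

text \<open>\<open>E\<close> commutes with adjoints. Applied to the inverse pair this makes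
  \<open>adj g\<close> a normalizer too, and therefore \<open>adj g o\<^sub>L g\<close>.\<close>

lemma norm_pair_adj:
  assumes "norm_pair g h"
  shows "norm_pair (adj h) (adj g)"
proof -
  note g = norm_pairD[OF assms]
  have "E (adj h o\<^sub>L x o\<^sub>L adj g) = adj h o\<^sub>L E x o\<^sub>L adj g" if x: "x \<in> M" for x
  proof -
    have m: "g o\<^sub>L adj x o\<^sub>L h \<in> M" using g x by simp
    have "adj (g o\<^sub>L adj x o\<^sub>L h) = adj h o\<^sub>L x o\<^sub>L adj g" using g x by (simp add: compose_assoc)
    then have "E (adj h o\<^sub>L x o\<^sub>L adj g) = adj (E (g o\<^sub>L adj x o\<^sub>L h))" using E_adj[OF m] by simp
    also have "E (g o\<^sub>L adj x o\<^sub>L h) = g o\<^sub>L adj (E x) o\<^sub>L h"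
      using g(5)[of "adj x"] E_adj[OF x] x by simp
    finally show ?thesis using g E_mem[OF x] by (simp add: compose_assoc)
  qed
  then show ?thesis using g adj_inverse[of g h] adj_inverse[of h g] by (simp add: norm_pair_def)
qed

lemma norm_pair_N:
  assumes "n \<in> N" "n' \<in> N" "n o\<^sub>L n' = id_blinfun" "n' o\<^sub>L n = id_blinfun"
  shows "norm_pair n n'"
  using assms N_subset E_bimodule by (simp add: norm_pair_def)

lemma centralizerD:
  assumes "z \<in> C"
  shows "z \<in> M" "n \<in> N \<Longrightarrow> z o\<^sub>L n = n o\<^sub>L z" "m \<in> M \<Longrightarrow> E (z o\<^sub>L m) = E (m o\<^sub>L z)"
  using assms by (auto simp: centralizer_iff)

text \<open>Both sides equal \<open>E x\<close>: the centralizer condition brings \<open>z\<close>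
  next to its inverse inside \<open>E\<close>, and \<open>z\<close> commutes with
  \<open>E x\<close>, which lies in \<open>N\<close>.\<close>

lemma norm_pair_C:
  assumes z: "z \<in> C" "z' \<in> C" "z o\<^sub>L z' = id_blinfun" "z' o\<^sub>L z = id_blinfun"
  shows "norm_pair z z'"
proof -
  have "E (z o\<^sub>L x o\<^sub>L z') = z o\<^sub>L E x o\<^sub>L z'" if x: "x \<in> M" for x
  proof -
    have "E (z o\<^sub>L (x o\<^sub>L z')) = E ((x o\<^sub>L z') o\<^sub>L z)"
      by (rule centralizerD(3)[OF z(1)]) (use x centralizerD(1)[OF z(2)] in simp)
    then have "E (z o\<^sub>L x o\<^sub>L z') = E x" by (simp add: compose_assoc z)
    moreover have "z o\<^sub>L E x o\<^sub>L z' = E x"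
      using centralizerD(2)[OF z(1) E_mem[OF x]] by (simp add: compose_assoc z)
    ultimately show ?thesis by simp
  qed
  then show ?thesis using z centralizerD by (simp add: norm_pair_def)
qed

section \<open>The normalizers \<open>I\<close>, \<open>U\<close> and their subgroups
  \<open>Z\<close>, \<open>H\<close>\<close>

abbreviation "I \<equiv> invertible_normalizer M E"
abbreviation "U \<equiv> unitary_normalizer M E"
abbreviation "Z \<equiv> Z_sub M N E"
abbreviation "H \<equiv> H_sub M N E"

lemma U_iff: "u \<in> U \<longleftrightarrow> u \<in> unitaries M \<and> u \<in> I"
  using M.unitaries_subset_invertibles
  by (auto simp: unitary_normalizer_def invertible_normalizer_def)

lemma Z_iff: "g \<in> Z \<longleftrightarrow> (\<exists>z\<in>invertibles C. \<exists>n\<in>invertibles N. g = z o\<^sub>L n)"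
  by (auto simp: Z_sub_def set_mult_def)

lemma H_iff: "g \<in> H \<longleftrightarrow> (\<exists>w\<in>unitaries N. \<exists>v\<in>unitaries C. g = w o\<^sub>L v)"
  by (auto simp: H_sub_def set_mult_def)

lemma Z_I: "z \<in> invertibles C \<Longrightarrow> n \<in> invertibles N \<Longrightarrow> z o\<^sub>L n \<in> Z"
  unfolding Z_iff by blast

lemma H_I: "w \<in> unitaries N \<Longrightarrow> v \<in> unitaries C \<Longrightarrow> w o\<^sub>L v \<in> H"
  unfolding H_iff by blast

lemma Z_compose:
  assumes "g \<in> Z" "g' \<in> Z"
  shows "g o\<^sub>L g' \<in> Z"
proof -
  obtain z n z' n' where zn: "z \<in> invertibles C" "n \<in> invertibles N" "g = z o\<^sub>L n"
    "z' \<in> invertibles C" "n' \<in> invertibles N" "g' = z' o\<^sub>L n'"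
    using assms unfolding Z_iff by blast
  have "z' \<in> C" "n \<in> N" using zn by (auto simp: invertibles_iff)
  then have comm: "n o\<^sub>L z' = z' o\<^sub>L n" using centralizerD(2) by simp
  have "g o\<^sub>L g' = z o\<^sub>L (n o\<^sub>L z') o\<^sub>L n'" by (simp only: zn compose_assoc)
  also have "\<dots> = (z o\<^sub>L z') o\<^sub>L (n o\<^sub>L n')" by (simp only: comm compose_assoc)
  finally show ?thesis
    using Z_I[OF C.invertibles_compose N.invertibles_compose] zn by simp
qed

lemma Z_inverse:
  assumes "g \<in> Z"
  obtains h where "h \<in> Z" "norm_pair g h"
proof -
  obtain z n where "z \<in> invertibles C" "n \<in> invertibles N" and g: "g = z o\<^sub>L n"
    using assms unfolding Z_iff by blast
  then obtain z' n' where z: "z \<in> C" "z' \<in> C" "z o\<^sub>L z' = id_blinfun" "z' o\<^sub>L z = id_blinfun"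
    and n: "n \<in> N" "n' \<in> N" "n o\<^sub>L n' = id_blinfun" "n' o\<^sub>L n = id_blinfun"
    unfolding invertibles_iff by blast
  have "norm_pair (z o\<^sub>L n) (n' o\<^sub>L z')" by (rule norm_pair_compose[OF norm_pair_C[OF z] norm_pair_N[OF n]])
  moreover have "z' \<in> invertibles C" "n' \<in> invertibles N"
    using z n by (auto simp: invertibles_iff)
  then have "n' o\<^sub>L z' \<in> Z"
    using Z_I centralizerD(2)[OF z(2) n(2)] by metis
  ultimately show ?thesis using that g by simp
qed

lemma Z_subset_I: "Z \<subseteq> I"
  using Z_inverse invertible_normalizer_iff by blast

lemma id_Z: "id_blinfun \<in> Z"
proof -
  have "id_blinfun \<in> invertibles C" "id_blinfun \<in> invertibles N"
    using C.unitaries_subset_invertibles C.unitaries_id N.unitaries_subset_invertibles N.unitaries_id by blast+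
  from Z_I[OF this] show ?thesis by simp
qed

text \<open>\<^term>\<open>g\<close> and \<^term>\<open>E g\<close> induce the same automorphism of \<^term>\<open>N\<close> because \<^term>\<open>E\<close> is an
  \<^term>\<open>N\<close>-bimodule map.\<close>

lemma factor_through_expectation:
  assumes gh: "norm_pair g h" and e: "e' \<in> N" "E g o\<^sub>L e' = id_blinfun" "e' o\<^sub>L E g = id_blinfun"
  obtains z where "z \<in> invertibles C" "g = z o\<^sub>L E g" "z = e' o\<^sub>L g"
proof -
  note g = norm_pairD[OF gh]
  define z z' where "z = e' o\<^sub>L g" and "z' = h o\<^sub>L E g"
  have eN: "E g \<in> N" by (rule E_mem[OF g(1)])
  have zz: "z o\<^sub>L z' = id_blinfun" "z' o\<^sub>L z = id_blinfun"
    using g e by (simp_all add: z_def z'_def cancel_middle)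
  have zM: "z \<in> M" "z' \<in> M" using g e eN N_subset by (simp_all add: z_def z'_def)
  have comm: "z o\<^sub>L n = n o\<^sub>L z" if n: "n \<in> N" for n
  proof -
    define n' where "n' = g o\<^sub>L n o\<^sub>L h"
    \<comment> \<open>The conjugate of an element of \<open>N\<close> is fixed by \<open>E\<close>,
      so conjugation by \<open>g\<close> maps \<open>N\<close> into itself.\<close>
    have "E n' = n'" using g(5)[of n] N_subset[OF n] E_N[OF n] by (simp add: n'_def)
    moreover have "n' \<in> M" using g N_subset[OF n] by (simp add: n'_def)
    ultimately have n'N: "n' \<in> N" using E_mem by metis
    have n'g: "n' o\<^sub>L g = g o\<^sub>L n" using g by (simp add: n'_def compose_assoc)
    \<comment> \<open>Evaluating \<open>E\<close> on \<open>g o\<^sub>L n = n' o\<^sub>L g\<close>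
      from either side shows that \<open>E g\<close> intertwines \<open>n\<close> and
      \<open>n'\<close> exactly as \<open>g\<close> does.\<close>
    have "E g o\<^sub>L n = E (g o\<^sub>L n)" using E_right[OF n g(1)] by simp
    also have "\<dots> = n' o\<^sub>L E g" using E_left[OF n'N g(1)] by (simp add: n'g)
    finally have eq: "E g o\<^sub>L n = n' o\<^sub>L E g" .
    have "n o\<^sub>L e' = (e' o\<^sub>L E g) o\<^sub>L (n o\<^sub>L e')" by (simp add: e)
    also have "\<dots> = e' o\<^sub>L (E g o\<^sub>L n) o\<^sub>L e'" by (simp only: compose_assoc)
    also have "\<dots> = e' o\<^sub>L n' o\<^sub>L (E g o\<^sub>L e')" by (simp only: eq compose_assoc)
    finally have "n o\<^sub>L e' = e' o\<^sub>L n'" by (simp add: e)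
    then have "n o\<^sub>L z = e' o\<^sub>L (n' o\<^sub>L g)" by (simp add: z_def flip: compose_assoc)
    then show ?thesis by (simp add: z_def n'g compose_assoc)
  qed
  have "E (z o\<^sub>L m) = E (m o\<^sub>L z)" if m: "m \<in> M" for m
  proof -
    \<comment> \<open>\<open>z\<close> is a normalizer, being a product of two. Conjugating
      \<open>m o\<^sub>L z\<close> by it gives \<open>z o\<^sub>L m\<close>, and it acts trivially
      on values of \<open>E\<close>.\<close>
    have e_inv: "norm_pair e' (E g)" using norm_pair_N[OF e(1) eN] e by simp
    have zp: "norm_pair z z'" unfolding z_def z'_def by (rule norm_pair_compose[OF e_inv gh])
    have mz: "m o\<^sub>L z \<in> M" using m zM by simp
    have "E (z o\<^sub>L m) = E (z o\<^sub>L (m o\<^sub>L z) o\<^sub>L z')" by (simp add: zz compose_assoc)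
    also have "\<dots> = z o\<^sub>L E (m o\<^sub>L z) o\<^sub>L z'" by (rule norm_pairD(5)[OF zp mz])
    also have "\<dots> = E (m o\<^sub>L z)" using comm[OF E_mem[OF mz]] by (simp add: zz compose_assoc)
    finally show ?thesis .
  qed
  then have zC: "z \<in> C" using zM comm by (simp add: centralizer_iff)
  then have "z' \<in> C" using C.inverse_closed[of z z'] zz zM by simp
  then have "z \<in> invertibles C" using zC zz by (auto simp: invertibles_iff)
  moreover have "g = z o\<^sub>L E g"
    using centralizerD(2)[OF zC eN] e by (simp add: z_def flip: compose_assoc)
  ultimately show ?thesis using that z_def by blast
qed

lemma coercive_mem_Z:
  assumes gh: "norm_pair g h" and c: "0 < c" "\<And>x. c * (norm x)\<^sup>2 \<le> Re (cinner x (E g x))"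
  shows "g \<in> Z"
proof -
  have "E g \<in> invertibles N"
    by (rule N.coercive_invertibles[OF E_mem c]) (rule norm_pairD(1)[OF gh])
  then obtain e' where "e' \<in> N" "E g o\<^sub>L e' = id_blinfun" "e' o\<^sub>L E g = id_blinfun"
    by (auto simp: invertibles_iff)
  then obtain z where "z \<in> invertibles C" "g = z o\<^sub>L E g"
    using factor_through_expectation[OF gh] by metis
  then show ?thesis using \<open>E g \<in> invertibles N\<close> unfolding Z_iff by blast
qed

text \<open>\<open>E\<close> is unital and does not increase norms, so \<open>E g\<close> is within
  1/2 of 1; this leaves 1/2 as coercivity constant.\<close>

lemma near_id_mem_Z:
  assumes "g \<in> I" "norm (g - id_blinfun) < 1 / 2"
  shows "g \<in> Z"
proof -
  obtain h where gh: "norm_pair g h" using assms(1) invertible_normalizer_iff by blast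
  have g: "g \<in> M" by (rule norm_pairD(1)[OF gh])
  show ?thesis
  proof (rule coercive_mem_Z[OF gh, of "1/2"])
    fix x
    let ?d = "id_blinfun - E g"
    have "norm ?d = norm (E (id_blinfun - g))" using g by (simp add: E_diff E_id)
    also have "\<dots> \<le> norm (g - id_blinfun)" using E_norm[of "id_blinfun - g"] g by (simp add: norm_minus_commute)
    finally have "norm ?d \<le> 1 / 2" using assms(2) by simp
    then have "Re (cinner x (?d x)) \<le> 1 / 2 * (norm x)\<^sup>2"
      by (rule order_trans[OF form_le_norm mult_right_mono]) simp
    then show "1 / 2 * (norm x)\<^sup>2 \<le> Re (cinner x (E g x))"
      by (simp add: blinfun.diff_left cinner_diff_right Re_cinner_self)
  qed simp
qed

text \<open>If \<open>z o\<^sub>L n\<close> is unitary, then \<open>adj n o\<^sub>L n\<close> is the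
  inverse of \<open>adj z o\<^sub>L z\<close> and so belongs to both algebras. So does its root,
  which can be moved from the factor in \<open>N\<close> to the factor in the centralizer, leaving
  unitaries on both sides.\<close>

lemma H_eq: "H = U \<inter> Z"
proof
  show "H \<subseteq> U \<inter> Z"
  proof
    fix u assume "u \<in> H"
    then obtain w v where w: "w \<in> unitaries N" and v: "v \<in> unitaries C" and u: "u = w o\<^sub>L v"
      unfolding H_iff by blast
    have wv: "w \<in> N" "v \<in> C" using w v by (auto simp: unitaries_iff)
    have "u = v o\<^sub>L w" using centralizerD(2)[OF wv(2,1)] u by simp
    then have uZ: "u \<in> Z"
      unfolding Z_iff using w v N.unitaries_subset_invertibles C.unitaries_subset_invertibles by blast
    moreover have "w \<in> unitaries M" "v \<in> unitaries M"
      using w v N_subset centralizerD(1) by (auto simp: unitaries_iff)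
    then have "u \<in> unitaries M" unfolding u by (rule M.unitaries_compose)
    ultimately show "u \<in> U \<inter> Z" using U_iff Z_subset_I by blast
  qed
  show "U \<inter> Z \<subseteq> H"
  proof
    fix u assume "u \<in> U \<inter> Z"
    then have uM: "u \<in> M" "adj u o\<^sub>L u = id_blinfun" "u o\<^sub>L adj u = id_blinfun" and "u \<in> Z"
      by (auto simp: U_iff unitaries_iff)
    then obtain z n where z: "z \<in> invertibles C" and n: "n \<in> invertibles N" and u: "u = z o\<^sub>L n"
      unfolding Z_iff by blast
    have zC: "z \<in> C" "z \<in> M" and nN: "n \<in> N" "n \<in> M"
      using z n centralizerD(1) N_subset by (auto simp: invertibles_iff)
    obtain w r where w: "w \<in> unitaries N" and r: "r \<in> N" "n = w o\<^sub>L r"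
      "\<And>A. closed_unital_algebra A \<Longrightarrow> adj n o\<^sub>L n \<in> A \<Longrightarrow> r \<in> A"
      using N.polar_decomposition[OF n] by metis
    have wN: "w \<in> N" "w \<in> M" "adj w o\<^sub>L w = id_blinfun" "w o\<^sub>L adj w = id_blinfun"
      using w N_subset by (auto simp: unitaries_iff)
    have zz: "adj z o\<^sub>L z \<in> C" using zC by simp
    have nn: "adj n o\<^sub>L n \<in> N" using nN by simp
    have "adj u o\<^sub>L u = adj n o\<^sub>L ((adj z o\<^sub>L z) o\<^sub>L n)"
      using zC nN by (simp add: u compose_assoc)
    also have "\<dots> = (adj n o\<^sub>L n) o\<^sub>L (adj z o\<^sub>L z)"
      using centralizerD(2)[OF zz nN(1)] by (simp only: compose_assoc)
    finally have inv1: "(adj n o\<^sub>L n) o\<^sub>L (adj z o\<^sub>L z) = id_blinfun" using uM by simp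
    have inv2: "(adj z o\<^sub>L z) o\<^sub>L (adj n o\<^sub>L n) = id_blinfun"
      using centralizerD(2)[OF zz nn] inv1 by simp
    have "adj n o\<^sub>L n \<in> C" by (rule C.inverse_closed[OF zz _ inv2 inv1]) (use nn in simp)
    then have rC: "r \<in> C" using r(3)[OF C.closed_unital] by blast
    define v where "v = z o\<^sub>L r"
    have vC: "v \<in> C" using zC rC by (simp add: v_def)
    have uwv: "u = w o\<^sub>L v"
      using centralizerD(2)[OF zC(1) wN(1)] by (simp add: u r(2) v_def flip: compose_assoc)
    have v: "v = adj w o\<^sub>L u" using wN(3) by (simp add: uwv flip: compose_assoc)
    have va: "adj v = adj u o\<^sub>L w" using uM wN by (simp add: v)
    have "adj v o\<^sub>L v = id_blinfun" "v o\<^sub>L adj v = id_blinfun"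
      unfolding va unfolding v using uM wN by (simp_all add: cancel_middle)
    then have "v \<in> unitaries C" using vC by (simp add: unitaries_iff)
    then show "u \<in> H" unfolding H_iff using w uwv by blast
  qed
qed

text \<open>For \<^term>\<open>p = adj g o\<^sub>L g\<close> both factors of \<^term>\<open>p = E p o\<^sub>L z\<close> are positive, and the product of their
  square roots is a square root of \<^term>\<open>p\<close> in \<^term>\<open>Z\<close>.\<close>

lemma I_polar:
  assumes "g \<in> I"
  obtains u k where "u \<in> U" "k \<in> Z" "g = u o\<^sub>L k"
proof -
  obtain h where gh: "norm_pair g h" using assms invertible_normalizer_iff by blast
  note g = norm_pairD[OF gh]
  define p where "p = adj g o\<^sub>L g"
  have pp: "norm_pair p (h o\<^sub>L adj h)"
    unfolding p_def by (rule norm_pair_compose[OF norm_pair_adj[OF norm_pair_sym[OF gh]] gh])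
  have pM: "p \<in> M" using norm_pairD(1)[OF pp] .
  \<comment> \<open>A lower bound for \<open>p\<close>, from
    \<open>norm x \<le> norm h * norm (g x)\<close>; the added 1 avoids division by zero.\<close>
  define c where "c = 1 / (norm h + 1)\<^sup>2"
  have pos: "0 < norm h + 1" by (simp add: add_nonneg_pos)
  have c: "0 < c" using pos by (simp add: c_def)
  have "op_le 0 (p - c *\<^sub>R id_blinfun)"
    unfolding op_le_0_iff
  proof
    fix x
    have "norm x = norm (h (g x))" using g(4) by (metis blinfun_apply_blinfun_compose blinfun_apply_id_blinfun)
    also have "\<dots> \<le> norm h * norm (g x)" by (rule norm_blinfun)
    also have "\<dots> \<le> (norm h + 1) * norm (g x)" by (intro mult_right_mono) simp_all
    finally have "(norm x)\<^sup>2 \<le> (norm h + 1)\<^sup>2 * (norm (g x))\<^sup>2"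
      by (metis norm_ge_zero power_mono power_mult_distrib)
    then have "c * (norm x)\<^sup>2 \<le> (norm (g x))\<^sup>2" using pos by (simp add: c_def field_simps)
    then show "Im (cinner x ((p - c *\<^sub>R id_blinfun) x)) = 0 \<and> 0 \<le> Re (cinner x ((p - c *\<^sub>R id_blinfun) x))"
      using g by (simp add: p_def blinfun.bilinear_simps cinner_simps cinner_adj_right cinner_self)
  qed
  then have "op_le 0 (E (p - c *\<^sub>R id_blinfun))" using pM by (intro E_pos) simp_all
  then have "op_le 0 (E p - c *\<^sub>R id_blinfun)" using pM by (simp add: E_diff E_scaleR E_id)
  then have coer: "c * (norm x)\<^sup>2 \<le> Re (cinner x (E p x))" for x
    using op_le_0D(2)[of "E p - c *\<^sub>R id_blinfun" x]
    by (simp add: blinfun.bilinear_simps cinner_simps Re_cinner_self)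
  have eN: "E p \<in> N" by (rule E_mem[OF pM])
  have "E p \<in> invertibles N" by (rule N.coercive_invertibles[OF eN c coer])
  then obtain e' where e': "e' \<in> N" "E p o\<^sub>L e' = id_blinfun" "e' o\<^sub>L E p = id_blinfun"
    by (auto simp: invertibles_iff)
  obtain z where zi: "z \<in> invertibles C" and pz: "p = z o\<^sub>L E p" "z = e' o\<^sub>L p"
    using factor_through_expectation[OF pp e'] by metis
  have zC: "z \<in> C" using zi by (simp add: invertibles_iff)
  have "op_le 0 (E p)" using pM g unfolding p_def by (intro E_pos op_le_0_adj_compose) simp_all
  then obtain s where s: "s \<in> N" "adj s = s" "s o\<^sub>L s = E p"
    using N.sqrt_in_algebra[OF eN] by metis
  obtain t where t: "t \<in> N" "s o\<^sub>L t = id_blinfun" "t o\<^sub>L s = id_blinfun" "t o\<^sub>L t = e'"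
    using N.sqrt_invertible[OF s(1) e'(1)] e' s(3) by metis
  have tM: "t \<in> M" by (rule N_subset[OF t(1)])
  have tadj: "adj t = t"
  proof -
    have "adj t o\<^sub>L s = id_blinfun" using adj_inverse[of s t] s t by simp
    then show ?thesis by (rule inverse_unique[OF t(2), symmetric])
  qed
  \<comment> \<open>Here \<open>t\<close> is the inverse root of \<open>E p\<close>. Writing
    \<open>z\<close> as \<open>adj (g o\<^sub>L t) o\<^sub>L (g o\<^sub>L t)\<close> shows its
    positivity.\<close>
  have "adj (g o\<^sub>L t) o\<^sub>L (g o\<^sub>L t) = t o\<^sub>L p o\<^sub>L t"
    using g tM by (simp add: p_def tadj compose_assoc)
  also have "\<dots> = (t o\<^sub>L z) o\<^sub>L (s o\<^sub>L (s o\<^sub>L t))"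
    by (subst pz(1)) (simp only: compose_assoc flip: s(3))
  also have "\<dots> = (z o\<^sub>L t) o\<^sub>L s" using centralizerD(2)[OF zC t(1)] by (simp add: t(2))
  also have "\<dots> = z" by (simp add: compose_assoc t(3))
  finally have "op_le 0 z" using op_le_0_adj_compose[of "g o\<^sub>L t"] g tM by simp
  then obtain k where k: "k \<in> C" "adj k = k" "k o\<^sub>L k = z"
    using C.sqrt_in_algebra[OF zC] by metis
  obtain z' where z': "z' \<in> C" "z o\<^sub>L z' = id_blinfun" "z' o\<^sub>L z = id_blinfun"
    using zi by (auto simp: invertibles_iff)
  obtain k' where k': "k' \<in> C" "k o\<^sub>L k' = id_blinfun" "k' o\<^sub>L k = id_blinfun"
    using C.sqrt_invertible[OF k(1) z'(1)] z' k(3) by metis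
  define r r' where "r = k o\<^sub>L s" and "r' = t o\<^sub>L k'"
  have ks: "k o\<^sub>L s = s o\<^sub>L k" by (rule centralizerD(2)[OF k(1) s(1)])
  have kM: "k \<in> M" "k' \<in> M" "s \<in> M" using centralizerD(1)[OF k(1)] centralizerD(1)[OF k'(1)] N_subset[OF s(1)] .
  have rr: "r o\<^sub>L r = p"
  proof -
    have "r o\<^sub>L r = k o\<^sub>L (s o\<^sub>L k) o\<^sub>L s" by (simp only: r_def compose_assoc)
    also have "\<dots> = (k o\<^sub>L k) o\<^sub>L (s o\<^sub>L s)" by (simp only: compose_assoc flip: ks)
    finally show ?thesis using pz(1) k(3) s(3) by simp
  qed
  have radj: "adj r = r" using kM by (simp add: r_def k s ks)
  have rinv: "r o\<^sub>L r' = id_blinfun" "r' o\<^sub>L r = id_blinfun"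
    using t k' by (simp_all add: r_def r'_def cancel_middle)
  have r'M: "r' \<in> M" "r \<in> M" using tM kM by (simp_all add: r_def r'_def)
  have r'adj: "adj r' = r'"
  proof -
    have "adj r' o\<^sub>L r = id_blinfun" using adj_inverse[of r r'] r'M rinv radj by simp
    then show ?thesis by (rule inverse_unique[OF rinv(1), symmetric])
  qed
  have rZ: "r \<in> Z"
  proof -
    have "k \<in> invertibles C" "s \<in> invertibles N" using k k' s t by (auto simp: invertibles_iff)
    then show ?thesis unfolding r_def by (rule Z_I)
  qed
  then obtain r'' where r'': "r'' \<in> Z" "norm_pair r r''" by (rule Z_inverse)
  \<comment> \<open>Uniqueness of inverses transfers the normalizing property from the inverse found
    in \<open>Z\<close> to \<open>r'\<close>.\<close>
  have "r'' = r'" using inverse_unique[OF norm_pairD(3)[OF r''(2)] rinv(2)] .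
  then have r'pair: "norm_pair r' r" using norm_pair_sym[OF r''(2)] by simp
  define u where "u = g o\<^sub>L r'"
  have uI: "u \<in> I" unfolding u_def invertible_normalizer_iff using norm_pair_compose[OF gh r'pair] by blast
  have uadj: "adj u = r' o\<^sub>L adj g" using g r'M by (simp add: u_def r'adj)
  have 1: "adj u o\<^sub>L u = id_blinfun"
  proof -
    have "adj u o\<^sub>L u = r' o\<^sub>L p o\<^sub>L r'" unfolding uadj by (simp only: u_def p_def compose_assoc)
    also have "\<dots> = (r' o\<^sub>L r) o\<^sub>L (r o\<^sub>L r')" by (simp only: compose_assoc flip: rr)
    finally show ?thesis by (simp add: rinv)
  qed
  \<comment> \<open>An isometry need not be unitary; the explicit right inverse
    \<open>r o\<^sub>L h\<close> must coincide with the left inverse \<open>adj u\<close>.\<close>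
  moreover have "u o\<^sub>L (r o\<^sub>L h) = id_blinfun"
    using g by (simp add: u_def cancel_middle[OF rinv(2)])
  then have "r o\<^sub>L h = adj u" by (rule inverse_unique[OF _ 1])
  then have "u o\<^sub>L adj u = id_blinfun" using \<open>u o\<^sub>L (r o\<^sub>L h) = id_blinfun\<close> by simp
  ultimately have "u \<in> unitaries M" using g r'M by (simp add: unitaries_iff u_def)
  then have "u \<in> U" using uI U_iff by blast
  moreover have "g = u o\<^sub>L r" by (simp add: u_def compose_assoc rinv)
  ultimately show ?thesis using that rZ by blast
qed

section \<open>Group structure and connectedness\<close>

lemma I_group: "group (op_monoid I)"
proof (rule op_monoid_groupI)
  fix a assume "a \<in> I"
  then obtain b where "norm_pair a b" using invertible_normalizer_iff by blast
  then show "\<exists>b\<in>I. b o\<^sub>L a = id_blinfun"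
    using norm_pair_sym norm_pairD(4) invertible_normalizer_iff by blast
next
  show "id_blinfun \<in> I" using id_Z Z_subset_I by blast
qed (use norm_pair_compose invertible_normalizer_iff in blast)

lemma U_compose: "a \<in> U \<Longrightarrow> b \<in> U \<Longrightarrow> a o\<^sub>L b \<in> U"
  using group.is_monoid[OF I_group, THEN monoid.m_closed, of a b] M.unitaries_compose
  by (simp add: U_iff)

lemma adj_U:
  assumes "a \<in> U"
  shows "adj a \<in> U" "adj a o\<^sub>L a = id_blinfun" "a o\<^sub>L adj a = id_blinfun"
proof -
  have a: "a \<in> M" "adj a o\<^sub>L a = id_blinfun" "a o\<^sub>L adj a = id_blinfun"
    using assms by (auto simp: U_iff unitaries_iff)
  then show "adj a o\<^sub>L a = id_blinfun" "a o\<^sub>L adj a = id_blinfun" by simp_all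
  obtain b where b: "norm_pair a b" using assms invertible_normalizer_iff by (auto simp: U_iff)
  then have "b = adj a" using inverse_unique[OF norm_pairD(3)[OF b] a(2)] by simp
  then have "adj a \<in> I" using norm_pair_sym[OF b] invertible_normalizer_iff by blast
  then show "adj a \<in> U" using a by (simp add: U_iff unitaries_iff)
qed

lemma U_group: "group (op_monoid U)"
proof (rule op_monoid_groupI)
  show "id_blinfun \<in> U" using id_Z Z_subset_I M.unitaries_id U_iff by blast
qed (use U_compose adj_U in blast)+

lemma Z_subgroup: "subgroup Z (op_monoid I)"
proof (rule group.subgroupI[OF I_group])
  fix a assume a: "a \<in> Z"
  then obtain b where b: "b \<in> Z" "norm_pair a b" by (rule Z_inverse)
  have "inv\<^bsub>op_monoid I\<^esub> a = b"
    using b a Z_subset_I norm_pairD(4)[OF b(2)] by (intro group.inv_equality[OF I_group]) auto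
  then show "inv\<^bsub>op_monoid I\<^esub> a \<in> Z" using b by simp
qed (use Z_subset_I id_Z Z_compose in auto)

lemma Z_connected: "connected Z"
proof -
  have "connected_component Z id_blinfun g" if g: "g \<in> Z" for g
  proof -
    obtain z n where zn: "z \<in> invertibles C" "n \<in> invertibles N" "g = z o\<^sub>L n"
      using g unfolding Z_iff by blast
    have "id_blinfun \<in> invertibles C" "id_blinfun \<in> invertibles N"
      using C.unitaries_subset_invertibles C.unitaries_id N.unitaries_subset_invertibles N.unitaries_id by blast+
    then have "invertibles C \<subseteq> Z" "invertibles N \<subseteq> Z"
      using Z_I by (metis compose_id subsetI)+
    then have "connected_component Z id_blinfun z" "connected_component Z id_blinfun n"
      using C.invertible_connected[OF zn(1)] N.invertible_connected[OF zn(2)] connected_component_of_subset by metis+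
    then show ?thesis unfolding zn(3) by (intro connected_component_compose Z_compose)
  qed
  then show ?thesis
    unfolding connected_iff_connected_component by (metis connected_component_sym connected_component_trans)
qed

lemma H_compose: "a \<in> H \<Longrightarrow> b \<in> H \<Longrightarrow> a o\<^sub>L b \<in> H"
  unfolding H_eq using U_compose Z_compose by blast

lemma H_subgroup: "subgroup H (op_monoid U)"
proof (rule group.subgroupI[OF U_group])
  show "H \<subseteq> carrier (op_monoid U)" by (simp add: H_eq)
  show "H \<noteq> {}" using H_I[OF N.unitaries_id C.unitaries_id] by blast
  fix a assume a: "a \<in> H"
  then have aU: "a \<in> U" "a \<in> Z" by (auto simp: H_eq)
  obtain b where b: "b \<in> Z" "norm_pair a b" using aU(2) by (rule Z_inverse)
  have "b = adj a" using inverse_unique[OF norm_pairD(3)[OF b(2)] adj_U(2)[OF aU(1)]] .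
  then have "adj a \<in> H" using b adj_U(1)[OF aU(1)] by (simp add: H_eq)
  moreover have "inv\<^bsub>op_monoid U\<^esub> a = adj a"
    using adj_U[OF aU(1)] aU(1) by (intro group.inv_equality[OF U_group]) auto
  ultimately show "inv\<^bsub>op_monoid U\<^esub> a \<in> H" by simp
qed (use H_compose in auto)

lemma H_connected: "connected H"
proof -
  have "connected_component H id_blinfun g" if g: "g \<in> H" for g
  proof -
    obtain w v where wv: "w \<in> unitaries N" "v \<in> unitaries C" "g = w o\<^sub>L v"
      using g unfolding H_iff by blast
    have "unitaries N \<subseteq> H" "unitaries C \<subseteq> H"
      using H_I C.unitaries_id N.unitaries_id by (metis compose_id subsetI)+
    then have "connected_component H id_blinfun w" "connected_component H id_blinfun v"
      using N.unitary_connected[OF wv(1)] C.unitary_connected[OF wv(2)] connected_component_of_subset by metis+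
    then show ?thesis unfolding wv(3) by (intro connected_component_compose H_compose)
  qed
  then show ?thesis
    unfolding connected_iff_connected_component by (metis connected_component_sym connected_component_trans)
qed

sublocale IZ: open_connected_subgroup I Z "1 / 2"
  by (rule open_connected_subgroup.intro[OF I_group Z_subgroup Z_connected]) (simp_all add: near_id_mem_Z)

sublocale UH: open_connected_subgroup U H "1 / 2"
proof (rule open_connected_subgroup.intro[OF U_group H_subgroup H_connected])
  show "u \<in> H" if "u \<in> U" "norm (u - id_blinfun) < 1 / 2" for u
    using that near_id_mem_Z[of u] U_iff by (simp add: H_eq)
qed simp

text \<open>The second isomorphism theorem: \<open>H = U \<inter> Z\<close> is the kernel of the map
  from \<open>U\<close> to cosets of \<open>Z\<close>, and the polar decomposition
  \<open>I = U Z\<close> makes it surjective.\<close>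

lemma Mod_iso: "op_monoid U Mod H \<cong> op_monoid I Mod Z"
proof -
  let ?\<phi> = "\<lambda>u. Z #>\<^bsub>op_monoid I\<^esub> u"
  interpret Z: normal Z "op_monoid I" by (rule IZ.normal_subgroup)
  have UI: "U \<subseteq> I" using U_iff by blast
  have hom: "?\<phi> \<in> hom (op_monoid U) (op_monoid I Mod Z)"
  proof (rule homI)
    fix x y assume "x \<in> carrier (op_monoid U)" "y \<in> carrier (op_monoid U)"
    then have xy: "x \<in> I" "y \<in> I" using UI by auto
    then show "?\<phi> x \<in> carrier (op_monoid I Mod Z)" by (auto simp: FactGroup_def RCOSETS_def)
    show "?\<phi> (x \<otimes>\<^bsub>op_monoid U\<^esub> y) = ?\<phi> x \<otimes>\<^bsub>op_monoid I Mod Z\<^esub> ?\<phi> y"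
      using Z.rcos_sum[of x y] xy by (simp add: FactGroup_def)
  qed
  interpret group_hom "op_monoid U" "op_monoid I Mod Z" ?\<phi>
    using U_group Z.factorgroup_is_group hom by (simp add: group_hom_def group_hom_axioms_def)
  have "kernel (op_monoid U) (op_monoid I Mod Z) ?\<phi> = H"
  proof -
    have "?\<phi> u = Z \<longleftrightarrow> u \<in> Z" if "u \<in> U" for u
    proof -
      have u: "u \<in> carrier (op_monoid I)" using that UI by auto
      show ?thesis
        using Z.coset_join1[OF _ u Z_subgroup] Z.coset_join2[OF u Z_subgroup] by blast
    qed
    then show ?thesis by (auto simp: kernel_def FactGroup_def H_eq)
  qed
  moreover have "?\<phi> ` carrier (op_monoid U) = carrier (op_monoid I Mod Z)"
  proof -
    have "?\<phi> g \<in> ?\<phi> ` U" if gI: "g \<in> I" for g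
    proof -
      obtain u k where u: "u \<in> U" and k: "k \<in> Z" and g: "g = u o\<^sub>L k" using gI by (rule I_polar)
      \<comment> \<open>The polar decomposition places \<open>g\<close> in a left coset; normality
        of \<open>Z\<close> turns it into a right coset.\<close>
      have "g \<in> u <#\<^bsub>op_monoid I\<^esub> Z" using k by (auto simp: l_coset_def g)
      have uI: "u \<in> carrier (op_monoid I)" using u UI by auto
      have "g \<in> ?\<phi> u" using \<open>g \<in> u <#\<^bsub>op_monoid I\<^esub> Z\<close> Z.coset_eq uI by blast
      then have "?\<phi> u = ?\<phi> g" by (rule Z.repr_independence[OF _ uI Z_subgroup])
      then show ?thesis using u by blast
    qed
    then have "?\<phi> ` I \<subseteq> ?\<phi> ` U" by blast
    moreover have "?\<phi> ` U \<subseteq> ?\<phi> ` I" by (rule image_mono[OF UI])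
    moreover have "carrier (op_monoid I Mod Z) = ?\<phi> ` I" by (auto simp: FactGroup_def RCOSETS_def)
    ultimately show ?thesis by simp
  qed
  ultimately show ?thesis using FactGroup_iso by simp
qed

end

theorem theorem3p5:
  fixes M N :: "'h::chilbert_space op set" and E :: "'h op \<Rightarrow> 'h op"
  assumes "von_neumann_algebra M"
    and "conditional_expectation M N E"
    and "faithful_on M E"
    and "normal_map M N E"
  shows "weyl_group M E \<cong> op_monoid (unitary_normalizer M E) Mod H_sub M N E
    \<and> weyl_group_inv M E \<cong> op_monoid (invertible_normalizer M E) Mod Z_sub M N E
    \<and> weyl_group M E \<cong> weyl_group_inv M E"
proof -
  interpret normal_expectation M N E
    using assms by unfold_locales
  show ?thesis
    unfolding weyl_group_def weyl_group_inv_def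
    using UH.pi0_iso_Mod IZ.pi0_iso_Mod Mod_iso iso_trans by blast
qed

end
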